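(* Let $T>0$, $\mathcal{X}=(0,T)\times\mathbb{T}^3$ with coordinates $X=(t,x)$, and let $\alpha\in(0,1)$ with $\alpha>\frac13$. Let $\mathcal{U}\subseteq\mathbb{M}^{3\times3}$ be open and $W\in C^3(\mathcal{U};\mathbb{R})$. Let $(F,\mathbf{v})\in B^\alpha_{3,\infty}(\mathcal{X};\mathbb{M}^{3\times3})\times B^\alpha_{3,\infty}(\mathcal{X};\mathbb{R}^3)$, with $F$ taking values in $\mathcal{U}$, be a weak solution of the system of nonlinear elasticity $$\partial_tF_{i,j}=\partial_{x_i}v_j,\qquad \partial_tv_j=\sum_{i=1}^3\partial_{x_i}\Big(\frac{\partial W}{\partial F_{i,j}}(F)\Big),\qquad i,j\in\{1,2,3\},\quad\text{in }\mathcal{X}.$$ Suppose that the essential range of $F$ is a compact subset of $\mathcal{U}$ and the essential range of $\mathbf{v}$ is a compact subset of $\mathbb{R}^3$. Then $(F,\mathbf{v})$ is a weak solution of the energy equation $$\partial_t\Big(\tfrac12|\mathbf{v}|^2+W(F)\Big)-\sum_{i=1}^3\partial_{x_i}\Big(\sum_{j=1}^3\frac{\partial W}{\partial F_{i,j}}(F)\,v_j\Big)=0\quad\text{in }\mathcal{X}.$$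
   Context: $\mathbb{T}^3$ is the flat three-dimensional torus; $\mathbb{M}^{3\times3}$ is the space of real $3\times3$ matrices. Weak solution means that all quantities under derivatives are locally integrable in $\mathcal{X}$ and the equations hold in the sense of distributions on $\mathcal{X}$, i.e. when tested against smooth functions with compact support in $\mathcal{X}$. The essential range of a measurable function $f$ on $\mathcal{X}$ is the set of values $y$ such that $\{X\in\mathcal{X}:|f(X)-y|<r\}$ has positive Lebesgue measure for every $r>0$. Besov space: for $\alpha\in(0,1)$ and $q\in[1,\infty)$, $B^\alpha_{q,\infty}(\mathcal{X})$ is the set of $f\in L^q(\mathcal{X})$ with $\sup_{\xi\ne0}|\xi|^{-\alpha}\|f(\cdot)-f(\cdot-\xi)\|_{L^q(\mathcal{X}\cap(\mathcal{X}+\xi))}<\infty$, where $\xi$ ranges over $\mathbb{R}^{4}$ (acting by translation modulo periods in the torus directions); for vector- or matrix-valued functions the condition is imposed on each component. *)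

theory Defs
  imports "HOL-Analysis.Analysis"
begin

type_synonym vec3 = "real^3"
type_synonym mat3 = "real^3^3"
type_synonym spacetime = "real \<times> vec3"

text \<open>The torus is R^3/Z^3.  A function on X = (0,T) \<times> T^3 is given by its lift to the cover
  (0,T) \<times> R^3, which is Z^3-periodic in the space variable; integrals over X are integrals over
  (0,T) \<times> [0,1)^3.  Values of a lift outside the cover are irrelevant.\<close>

definition cover :: "real \<Rightarrow> spacetime set" where
  "cover T = {0<..<T} \<times> UNIV"

definition cell :: "real \<Rightarrow> spacetime set" where
  "cell T = {0<..<T} \<times> {x. \<forall>i. 0 \<le> x $ i \<and> x $ i < 1}"

definition fun_on_X :: "real \<Rightarrow> (spacetime \<Rightarrow> 'b) \<Rightarrow> bool" where
  "fun_on_X T f \<longleftrightarrow>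
     (\<forall>t\<in>{0<..<T}. \<forall>x k. (\<forall>i. k $ i \<in> \<int>) \<longrightarrow> f (t, x + k) = f (t, x))"

text \<open>C^k on an open set.  In finite dimensions, differentiability with all directional
  derivatives of class C^(k-1) is the usual notion.\<close>

fun C_k_on :: "nat \<Rightarrow> 'a::real_normed_vector set \<Rightarrow> ('a \<Rightarrow> 'b::real_normed_vector) \<Rightarrow> bool" where
  "C_k_on 0 S f \<longleftrightarrow> continuous_on S f"
| "C_k_on (Suc k) S f \<longleftrightarrow>
     (\<forall>x\<in>S. f differentiable (at x)) \<and> (\<forall>e. C_k_on k S (\<lambda>x. frechet_derivative f (at x) e))"

definition smooth_on :: "'a::real_normed_vector set \<Rightarrow> ('a \<Rightarrow> 'b::real_normed_vector) \<Rightarrow> bool" where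
  "smooth_on S f \<longleftrightarrow> (\<forall>k. C_k_on k S f)"

definition partial_W :: "(mat3 \<Rightarrow> real) \<Rightarrow> 3 \<Rightarrow> 3 \<Rightarrow> mat3 \<Rightarrow> real" where
  "partial_W W i j A = frechet_derivative W (at A) (axis i (axis j 1))"


text \<open>As the torus is compact, a set is relatively compact in X iff its times lie in a compact
  subset of (0,T).\<close>

definition test_fun :: "real \<Rightarrow> (spacetime \<Rightarrow> real) \<Rightarrow> bool" where
  "test_fun T \<phi> \<longleftrightarrow> fun_on_X T \<phi> \<and> smooth_on (cover T) \<phi> \<and>
     (\<exists>K. compact K \<and> K \<subseteq> {0<..<T} \<and> (\<forall>t\<in>{0<..<T} - K. \<forall>x. \<phi> (t, x) = 0))"

definition locally_integrable :: "real \<Rightarrow> (spacetime \<Rightarrow> real) \<Rightarrow> bool" where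
  "locally_integrable T g \<longleftrightarrow>
     (\<forall>K. compact K \<and> K \<subseteq> cover T \<longrightarrow> set_integrable lebesgue K g)"

definition dt :: spacetime where "dt = (1, 0)"

definition dx :: "3 \<Rightarrow> spacetime" where "dx i = (0, axis i 1)"

text \<open>The pairing of the distributional derivative of g in direction e with the test function.\<close>

definition dist_deriv :: "real \<Rightarrow> spacetime \<Rightarrow> (spacetime \<Rightarrow> real) \<Rightarrow> (spacetime \<Rightarrow> real) \<Rightarrow> real" where
  "dist_deriv T e g \<phi> = - (LINT p:cell T|lebesgue. g p * frechet_derivative \<phi> (at p) e)"

definition weak_solution_elasticity ::
    "real \<Rightarrow> (mat3 \<Rightarrow> real) \<Rightarrow> (spacetime \<Rightarrow> mat3) \<Rightarrow> (spacetime \<Rightarrow> vec3) \<Rightarrow> bool" where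
  "weak_solution_elasticity T W F v \<longleftrightarrow>
     (\<forall>i j. locally_integrable T (\<lambda>p. F p $ i $ j)) \<and>
     (\<forall>j. locally_integrable T (\<lambda>p. v p $ j)) \<and>
     (\<forall>i j. locally_integrable T (\<lambda>p. partial_W W i j (F p))) \<and>
     (\<forall>i j \<phi>. test_fun T \<phi> \<longrightarrow>
        dist_deriv T dt (\<lambda>p. F p $ i $ j) \<phi> = dist_deriv T (dx i) (\<lambda>p. v p $ j) \<phi>) \<and>
     (\<forall>j \<phi>. test_fun T \<phi> \<longrightarrow>
        dist_deriv T dt (\<lambda>p. v p $ j) \<phi> =
        (\<Sum>i\<in>UNIV. dist_deriv T (dx i) (\<lambda>p. partial_W W i j (F p)) \<phi>))"

definition weak_solution_energy ::
    "real \<Rightarrow> (mat3 \<Rightarrow> real) \<Rightarrow> (spacetime \<Rightarrow> mat3) \<Rightarrow> (spacetime \<Rightarrow> vec3) \<Rightarrow> bool" where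
  "weak_solution_energy T W F v \<longleftrightarrow>
     locally_integrable T (\<lambda>p. (norm (v p))\<^sup>2 / 2 + W (F p)) \<and>
     (\<forall>i. locally_integrable T (\<lambda>p. \<Sum>j\<in>UNIV. partial_W W i j (F p) * v p $ j)) \<and>
     (\<forall>\<phi>. test_fun T \<phi> \<longrightarrow>
        dist_deriv T dt (\<lambda>p. (norm (v p))\<^sup>2 / 2 + W (F p)) \<phi>
        - (\<Sum>i\<in>UNIV. dist_deriv T (dx i)
             (\<lambda>p. \<Sum>j\<in>UNIV. partial_W W i j (F p) * v p $ j) \<phi>) = 0)"


definition in_Lq :: "real \<Rightarrow> spacetime set \<Rightarrow> (spacetime \<Rightarrow> real) \<Rightarrow> bool" where
  "in_Lq q S f \<longleftrightarrow> f \<in> borel_measurable (lebesgue_on S) \<and>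
     integrable (lebesgue_on S) (\<lambda>p. \<bar>f p\<bar> powr q)"

definition Lq_norm :: "real \<Rightarrow> spacetime set \<Rightarrow> (spacetime \<Rightarrow> real) \<Rightarrow> real" where
  "Lq_norm q S f = (integral\<^sup>L (lebesgue_on S) (\<lambda>p. \<bar>f p\<bar> powr q)) powr (1 / q)"

text \<open>B^alpha_(q,infinity)(X) for alpha in (0,1) and q at least 1.  The set
  \<^term>\<open>cell T \<inter> (\<lambda>p. p + \<xi>) ` cover T\<close> is a fundamental domain of X \<inter> (X + \<xi>); for f in L^q(X)
  the difference is in L^q there, so the Bochner integral in the norm is the true one.\<close>

definition besov_inf :: "real \<Rightarrow> real \<Rightarrow> real \<Rightarrow> (spacetime \<Rightarrow> real) \<Rightarrow> bool" where
  "besov_inf T \<alpha> q f \<longleftrightarrow> in_Lq q (cell T) f \<and>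
     bdd_above ((\<lambda>\<xi>. norm \<xi> powr (- \<alpha>) *
         Lq_norm q (cell T \<inter> (\<lambda>p. p + \<xi>) ` cover T) (\<lambda>p. f p - f (p - \<xi>))) ` (UNIV - {0}))"

definition ess_range :: "real \<Rightarrow> (spacetime \<Rightarrow> 'b::real_normed_vector) \<Rightarrow> 'b set" where
  "ess_range T f = {y. \<forall>r>0. emeasure lebesgue {p \<in> cell T. norm (f p - y) < r} > 0}"

end

theory Submission
  imports Defs
begin

text \<open>Why energy is conserved.  Mollify F and v at scale \<epsilon> to smooth fields \<open>F\<^sub>\<epsilon>\<close> and \<open>v\<^sub>\<epsilon>\<close>.  Test the
equation for F with the weight \<psi> times the stress (the gradient G of W) at \<open>F\<^sub>\<epsilon>\<close>, and the
equation for v with \<psi> times \<open>v\<^sub>\<epsilon>\<close>.  By the chain rule, the time derivatives combine to the time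
derivative of the energy density of \<open>(F\<^sub>\<epsilon>, v\<^sub>\<epsilon>)\<close>, and the space derivatives to a divergence, up
to one defect (lemma mollified_balance): the integral of \<psi> times the space derivatives of \<open>v\<^sub>\<epsilon>\<close>
times the commutator between mollifying the stress and taking the stress of the mollified field.

The commutator is quadratic in the increments of F over distances at most \<epsilon>, because averaging
commutes with the linear part of the Taylor expansion of the stress (lemma commutator); this is where
W has to be of class C^3.  A derivative of \<open>v\<^sub>\<epsilon>\<close> is 1/\<epsilon> times one increment of v.  So the defect is
1/\<epsilon> times a product of three increments, which the Besov bound in L^3 makes O(\<epsilon> powr (3 * \<alpha> - 1)).
This tends to zero since \<alpha> > 1/3, and the remaining terms converge to those of the energy
equation (theorem energy_balance).

Three points need preparation.  Averages of values of F may leave U, so W is first replaced by a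
compactly supported function on all matrices that agrees with W near the essential range of F
(lemma C_k_extension).  The fields are only determined up to null sets, so they are replaced by
bounded Borel functions that are periodic and take values in the essential range everywhere
(lemma periodic_representative).  Finally, all integrations by parts rest on one fact, the
translation invariance of the integral over a cell for periodic functions with compact support in
time (lemma nn_integral_strip_translate), which yields both the vanishing of integrals of
derivatives and the self-duality of mollification.\<close>

section \<open>Functions of class C^k\<close>

lemma C_k_on_cong:
  assumes S: "open S"
  shows "C_k_on k S f \<Longrightarrow> (\<And>x. x \<in> S \<Longrightarrow> f x = g x) \<Longrightarrow> C_k_on k S g"
proof (induction k arbitrary: f g)
  case 0
  then show ?case using continuous_on_cong by fastforce
next
  case (Suc k)
  have "(g has_derivative frechet_derivative f (at x)) (at x)" if "x \<in> S" for x
  proof (rule has_derivative_transform_within_open[OF _ S that])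
    show "(f has_derivative frechet_derivative f (at x)) (at x)"
      using Suc.prems(1) that by (simp add: frechet_derivative_works)
  qed (use Suc.prems in auto)
  note g = this
  then have "frechet_derivative f (at x) = frechet_derivative g (at x)" if "x \<in> S" for x
    using that by (metis frechet_derivative_at)
  moreover have "C_k_on k S (\<lambda>x. frechet_derivative f (at x) e)" for e
    using Suc.prems by simp
  ultimately have "C_k_on k S (\<lambda>x. frechet_derivative g (at x) e)" for e
    using Suc.IH[of "\<lambda>x. frechet_derivative f (at x) e" "\<lambda>x. frechet_derivative g (at x) e"]
    by metis
  moreover have "\<forall>x\<in>S. g differentiable (at x)"
    using g by (meson differentiable_def)
  ultimately show ?case by simp
qed

lemma C_k_on_SucI:
  assumes S: "open S" and f: "\<And>x. x \<in> S \<Longrightarrow> (f has_derivative f' x) (at x)"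
    and k: "\<And>e. C_k_on k S (\<lambda>x. f' x e)"
  shows "C_k_on (Suc k) S f"
proof -
  have "f' x = frechet_derivative f (at x)" if "x \<in> S" for x
    using f[OF that] by (rule frechet_derivative_at)
  then have "C_k_on k S (\<lambda>x. frechet_derivative f (at x) e)" for e
    by (intro C_k_on_cong[OF S k[of e]]) simp
  moreover have "\<forall>x\<in>S. f differentiable (at x)"
    using f by (meson differentiable_def)
  ultimately show ?thesis by simp
qed

lemma C_k_on_SucD:
  assumes "C_k_on (Suc k) S f"
  shows "x \<in> S \<Longrightarrow> (f has_derivative frechet_derivative f (at x)) (at x)"
    and "C_k_on k S (\<lambda>x. frechet_derivative f (at x) e)"
  using assms by (auto simp: frechet_derivative_works)

lemma C_k_on_Suc_imp: "C_k_on (Suc k) S f \<Longrightarrow> C_k_on k S f"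
proof (induction k arbitrary: f)
  case 0
  then show ?case
    by (auto simp: differentiable_imp_continuous_within intro!: continuous_at_imp_continuous_on)
qed auto

lemma C_k_on_mono: "C_k_on k S f \<Longrightarrow> j \<le> k \<Longrightarrow> C_k_on j S f"
proof (induction k)
  case (Suc k)
  then show ?case using C_k_on_Suc_imp le_Suc_eq by metis
qed simp

lemma C_k_on_imp_continuous_on: "C_k_on k S f \<Longrightarrow> continuous_on S f"
  using C_k_on_mono[of k S f 0] by simp

lemma C_k_on_subset: "C_k_on k S f \<Longrightarrow> S' \<subseteq> S \<Longrightarrow> C_k_on k S' f"
  by (induction k arbitrary: f) (auto intro: continuous_on_subset)

lemma C_k_on_const: "open S \<Longrightarrow> C_k_on k S (\<lambda>x. c)"
proof (induction k arbitrary: c)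
  case (Suc k)
  show ?case
    by (rule C_k_on_SucI[where f' = "\<lambda>x e. 0"]) (use Suc in auto)
qed simp

lemma C_k_on_bounded_linear:
  assumes "open S" "bounded_linear f"
  shows "C_k_on k S f"
proof (cases k)
  case 0
  then show ?thesis using assms by (simp add: linear_continuous_on)
next
  case (Suc j)
  show ?thesis unfolding Suc
    by (rule C_k_on_SucI[where f' = "\<lambda>x e. f e"])
      (use assms in \<open>auto intro: bounded_linear_imp_has_derivative C_k_on_const\<close>)
qed

lemma C_k_on_add:
  assumes S: "open S"
  shows "C_k_on k S f \<Longrightarrow> C_k_on k S g \<Longrightarrow> C_k_on k S (\<lambda>x. f x + g x)"
proof (induction k arbitrary: f g)
  case 0
  then show ?case by (auto intro: continuous_on_add)
next
  case (Suc k)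
  show ?case
    by (rule C_k_on_SucI[OF S has_derivative_add[OF C_k_on_SucD(1)[OF Suc.prems(1)]
          C_k_on_SucD(1)[OF Suc.prems(2)]]])
      (use C_k_on_SucD(2)[OF Suc.prems(1)] C_k_on_SucD(2)[OF Suc.prems(2)] Suc.IH in auto)
qed

lemma C_k_on_mult:
  fixes f g :: "'a::real_normed_vector \<Rightarrow> real"
  assumes S: "open S"
  shows "C_k_on k S f \<Longrightarrow> C_k_on k S g \<Longrightarrow> C_k_on k S (\<lambda>x. f x * g x)"
proof (induction k arbitrary: f g)
  case 0
  then show ?case by (auto intro: continuous_on_mult)
next
  case (Suc k)
  have "C_k_on k S (\<lambda>x. f x * frechet_derivative g (at x) e + frechet_derivative f (at x) e * g x)" for e
    by (intro C_k_on_add S Suc.IH C_k_on_SucD(2)[OF Suc.prems(1)] C_k_on_SucD(2)[OF Suc.prems(2)]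
        C_k_on_Suc_imp[OF Suc.prems(1)] C_k_on_Suc_imp[OF Suc.prems(2)])
  with has_derivative_mult[OF C_k_on_SucD(1)[OF Suc.prems(1)] C_k_on_SucD(1)[OF Suc.prems(2)]]
  show ?case
    by (rule C_k_on_SucI[OF S])
qed

lemma C_k_on_diff:
  fixes f g :: "'a::real_normed_vector \<Rightarrow> real"
  assumes S: "open S" "C_k_on k S f" "C_k_on k S g"
  shows "C_k_on k S (\<lambda>x. f x - g x)"
  using C_k_on_add[OF S(1,2) C_k_on_mult[OF S(1) C_k_on_const[OF S(1), of _ "-1"] S(3)]] by simp

lemma C_k_on_sum:
  fixes f :: "'i \<Rightarrow> 'a::real_normed_vector \<Rightarrow> real"
  assumes "open S" "finite I" "\<And>i. i \<in> I \<Longrightarrow> C_k_on k S (f i)"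
  shows "C_k_on k S (\<lambda>x. \<Sum>i\<in>I. f i x)"
  using assms(2,3) by induction (auto simp: C_k_on_const C_k_on_add assms(1))

lemma C_k_on_compose_real:
  fixes h :: "real \<Rightarrow> real"
  assumes S: "open S"
  shows "C_k_on k UNIV h \<Longrightarrow> C_k_on k S g \<Longrightarrow> C_k_on k S (\<lambda>x. h (g x))"
proof (induction k arbitrary: h)
  case 0
  then show ?case
    by (auto intro: continuous_on_compose2)
next
  case (Suc k)
  let ?h' = "\<lambda>y. frechet_derivative h (at y) 1"
  have h': "(h has_derivative (\<lambda>r. ?h' y * r)) (at y)" for y
  proof -
    have 1: "(h has_derivative frechet_derivative h (at y)) (at y)"
      using C_k_on_SucD(1)[OF Suc.prems(1)] by simp
    then have "linear (frechet_derivative h (at y))"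
      by (simp add: has_derivative_linear)
    then have "frechet_derivative h (at y) r = ?h' y * r" for r
      using linear_cmul[of "frechet_derivative h (at y)" r 1] by (simp add: mult.commute)
    then have "frechet_derivative h (at y) = (\<lambda>r. ?h' y * r)" by (rule ext)
    with 1 show ?thesis by metis
  qed
  have d: "((\<lambda>x. h (g x)) has_derivative (\<lambda>e. ?h' (g x) * frechet_derivative g (at x) e)) (at x)"
    if "x \<in> S" for x
    using has_derivative_compose[OF C_k_on_SucD(1)[OF Suc.prems(2) that] h'] .
  have "C_k_on k S (\<lambda>x. ?h' (g x) * frechet_derivative g (at x) e)" for e
    by (rule C_k_on_mult[OF S Suc.IH[OF C_k_on_SucD(2)[OF Suc.prems(1)] C_k_on_Suc_imp[OF Suc.prems(2)]]
          C_k_on_SucD(2)[OF Suc.prems(2)]])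
  with d show ?case
    by (rule C_k_on_SucI[OF S])
qed

lemma C_k_on_sq_dist:
  fixes c :: "'a::real_inner"
  shows "C_k_on k UNIV (\<lambda>x. (x - c) \<bullet> (x - c))"
proof (cases k)
  case 0
  then show ?thesis by (auto intro!: continuous_intros)
next
  case (Suc j)
  have "((\<lambda>x. (x - c) \<bullet> (x - c)) has_derivative (\<lambda>e. 2 * ((x - c) \<bullet> e))) (at x)" for x
    by (auto intro!: derivative_eq_intros simp: inner_commute)
  moreover have "C_k_on j UNIV (\<lambda>x. 2 * ((x - c) \<bullet> e))" for e
  proof -
    have "C_k_on j UNIV (\<lambda>x. x \<bullet> e)"
      by (intro C_k_on_bounded_linear bounded_linear_inner_left) simp
    from C_k_on_mult[OF _ C_k_on_const[of UNIV _ 2] C_k_on_diff[OF _ this C_k_on_const[of UNIV _ "c \<bullet> e"]]]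
    show ?thesis by (simp add: inner_diff_left)
  qed
  ultimately show ?thesis unfolding Suc
    by (intro C_k_on_SucI[where f' = "\<lambda>x e. 2 * ((x - c) \<bullet> e)"]) simp_all
qed

text \<open>The derivative of exp(-1/x)/x^n is a combination of the same expressions for n + 1 and n + 2.
Proving smoothness for the whole family at once is therefore one induction.\<close>

definition flat :: "nat \<Rightarrow> real \<Rightarrow> real" where
  "flat n x = (if x > 0 then exp (- inverse x) * inverse x ^ n else 0)"

lemma flat_has_derivative:
  "(flat n has_derivative (\<lambda>r. (flat (n + 2) x - real n * flat (n + 1) x) * r)) (at x)"
proof -
  consider "x > 0" | "x < 0" | "x = 0" by linarith
  then have "(flat n has_real_derivative (flat (n + 2) x - real n * flat (n + 1) x)) (at x)"
  proof cases
    case 1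
    have e: "((\<lambda>x. exp (- inverse x)) has_real_derivative exp (- inverse x) * inverse x ^ 2) (at x)"
      using 1 by (auto intro!: derivative_eq_intros simp: power2_eq_square)
    have p: "((\<lambda>x. inverse x ^ n) has_real_derivative - real n * inverse x ^ Suc n) (at x)"
    proof (cases n)
      case (Suc m)
      show ?thesis unfolding Suc
        by (rule DERIV_cong[OF DERIV_power_Suc[OF DERIV_inverse]]) (use 1 in \<open>auto simp: power2_eq_square algebra_simps\<close>)
    qed simp
    have "((\<lambda>x. exp (- inverse x) * inverse x ^ n) has_real_derivative
        (flat (n + 2) x - real n * flat (n + 1) x)) (at x)"
      by (rule DERIV_cong[OF DERIV_mult[OF e p]]) (use 1 in \<open>simp add: flat_def algebra_simps power2_eq_square\<close>)
    then show ?thesis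
      by (rule has_field_derivative_transform_within_open[where S = "{0<..}"])
         (use 1 in \<open>auto simp: flat_def\<close>)
  next
    case 2
    have "((\<lambda>x. 0) has_real_derivative (flat (n + 2) x - real n * flat (n + 1) x)) (at x)"
      using 2 by (auto simp: flat_def)
    then show ?thesis
      by (rule has_field_derivative_transform_within_open[where S = "{..<0}"])
         (use 2 in \<open>auto simp: flat_def\<close>)
  next
    case 3
    have "((\<lambda>y. y ^ Suc n / exp y) \<longlongrightarrow> (0::real)) at_top"
      by (rule tendsto_power_div_exp_0)
    then have "((\<lambda>h. inverse h ^ Suc n / exp (inverse h)) \<longlongrightarrow> (0::real)) (at_right 0)"
      by (rule filterlim_compose) (rule filterlim_inverse_at_top_right)
    then have "((\<lambda>h. flat n h / h) \<longlongrightarrow> 0) (at_right 0)"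
      by (rule Lim_transform_eventually)
        (auto simp: flat_def eventually_at_filter exp_minus field_simps)
    moreover have "((\<lambda>h. flat n h / h) \<longlongrightarrow> 0) (at_left 0)"
      by (rule Lim_transform_eventually[OF tendsto_const])
        (auto simp: flat_def eventually_at_filter)
    ultimately have "((\<lambda>h. flat n h / h) \<longlongrightarrow> 0) (at 0)"
      by (simp add: filterlim_at_split)
    then show ?thesis
      using 3 by (simp add: DERIV_def flat_def)
  qed
  then show ?thesis by (simp add: has_field_derivative_def)
qed

lemma flat_C_k: "C_k_on k UNIV (flat n)"
proof (induction k arbitrary: n)
  case 0
  show ?case
    by (auto intro!: continuous_at_imp_continuous_on has_derivative_continuous[OF flat_has_derivative])
next
  case (Suc k)
  show ?case
    by (rule C_k_on_SucI[OF _ flat_has_derivative])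
       (auto intro!: C_k_on_mult C_k_on_diff C_k_on_const Suc)
qed

lemma flat_nonneg: "flat n x \<ge> 0" and flat_pos: "x > 0 \<Longrightarrow> flat n x > 0"
  and flat_zero: "x \<le> 0 \<Longrightarrow> flat n x = 0"
  by (auto simp: flat_def)

definition bump :: "'a::real_inner \<Rightarrow> real \<Rightarrow> 'a \<Rightarrow> real" where
  "bump c r x = flat 0 (r\<^sup>2 - (x - c) \<bullet> (x - c))"

lemma bump_C_k: "C_k_on k UNIV (bump c r)"
  unfolding bump_def
  by (rule C_k_on_compose_real[OF _ flat_C_k])
    (intro C_k_on_diff C_k_on_const C_k_on_sq_dist open_UNIV)+

lemma bump_nonneg: "bump c r x \<ge> 0"
  by (simp add: bump_def flat_nonneg)

lemma bump_pos: "dist c x < r \<Longrightarrow> bump c r x > 0"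
proof -
  assume "dist c x < r"
  then have "(norm (x - c))\<^sup>2 < r\<^sup>2"
    by (intro power_strict_mono) (auto simp: dist_norm norm_minus_commute)
  then show ?thesis by (simp add: bump_def flat_pos power2_norm_eq_inner)
qed

lemma bump_zero: "0 \<le> r \<Longrightarrow> r \<le> dist c x \<Longrightarrow> bump c r x = 0"
proof -
  assume "0 \<le> r" "r \<le> dist c x"
  then have "r\<^sup>2 \<le> (norm (x - c))\<^sup>2"
    by (intro power_mono) (auto simp: dist_norm norm_minus_commute)
  then show ?thesis by (simp add: bump_def flat_zero power2_norm_eq_inner)
qed

section \<open>Compactly supported functions, cutoffs and extensions\<close>

lemma compact_support_bounded:
  fixes f :: "'a::euclidean_space \<Rightarrow> 'b::real_normed_vector"
  assumes f: "continuous_on UNIV f" and K: "compact K" and z: "\<And>x. x \<notin> K \<Longrightarrow> f x = 0"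
  obtains C where "C > 0" "\<And>x. norm (f x) \<le> C"
proof -
  have "bounded (f ` K)"
    using compact_continuous_image[OF continuous_on_subset[OF f] K] compact_imp_bounded by auto
  then obtain C where C: "C > 0" "\<And>x. x \<in> K \<Longrightarrow> norm (f x) \<le> C"
    by (auto simp: bounded_pos)
  then have "norm (f x) \<le> C" for x
    using z[of x] by (cases "x \<in> K") auto
  with C(1) that show thesis by blast
qed

lemma frechet_derivative_zero_off:
  assumes K: "closed K" and z: "\<And>x. x \<notin> K \<Longrightarrow> f x = 0" and x: "x \<notin> K"
  shows "frechet_derivative f (at x) e = 0"
proof -
  have "(f has_derivative (\<lambda>e. 0)) (at x)"
    by (rule has_derivative_transform_within_open[where f = "\<lambda>x. 0" and s = "- K"])
       (use K x z in \<open>auto simp: open_Compl\<close>)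
  then show ?thesis by (simp add: frechet_derivative_at[symmetric])
qed

lemma norm_linear_le_basis:
  fixes L :: "'a::euclidean_space \<Rightarrow> 'b::real_normed_vector"
  assumes L: "linear L" and C: "\<And>b. b \<in> Basis \<Longrightarrow> norm (L b) \<le> C"
  shows "norm (L h) \<le> real DIM('a) * C * norm h"
proof -
  have "L h = (\<Sum>b\<in>Basis. (h \<bullet> b) *\<^sub>R L b)"
    by (subst euclidean_representation[of h, symmetric]) (simp add: linear_sum[OF L] linear_cmul[OF L])
  also have "norm \<dots> \<le> (\<Sum>b\<in>Basis. norm ((h \<bullet> b) *\<^sub>R L b))"
    by (rule norm_sum)
  also have "\<dots> \<le> (\<Sum>b\<in>(Basis::'a set). norm h * C)"
    by (intro sum_mono) (auto intro!: mult_mono C Basis_le_norm)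
  finally show ?thesis by (simp add: mult_ac)
qed

text \<open>Only directional derivatives are known to be continuous; each is bounded by compactness, and a
finite basis turns these bounds into one operator bound, to which the mean value inequality applies.\<close>

lemma C1_compact_support_Lipschitz:
  fixes f :: "'a::euclidean_space \<Rightarrow> 'b::real_normed_vector"
  assumes f: "C_k_on 1 UNIV f" and K: "compact K" and z: "\<And>x. x \<notin> K \<Longrightarrow> f x = 0"
  obtains L where "L > 0" "\<And>x y. norm (f x - f y) \<le> L * norm (x - y)"
    "\<And>x e. norm (frechet_derivative f (at x) e) \<le> L * norm e"
proof -
  let ?D = "\<lambda>x. frechet_derivative f (at x)"
  have d: "(f has_derivative ?D x) (at x)" for x
    using C_k_on_SucD(1)[of 0 UNIV f x] f by simp
  have "\<forall>b. \<exists>C>0. \<forall>x. norm (?D x b) \<le> C"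
  proof
    fix b
    have "continuous_on UNIV (\<lambda>x. ?D x b)" using f by simp
    from compact_support_bounded[OF this K frechet_derivative_zero_off[OF compact_imp_closed[OF K] z]]
    show "\<exists>C>0. \<forall>x. norm (?D x b) \<le> C" by metis
  qed
  then obtain C where C: "\<And>b. C b > 0" "\<And>b x. norm (?D x b) \<le> C b" by metis
  define M where "M = (\<Sum>b\<in>(Basis::'a set). C b)"
  have M: "C b \<le> M" if "b \<in> Basis" for b
    unfolding M_def using that C(1) by (intro member_le_sum) (auto intro: less_imp_le)
  define L where "L = real DIM('a) * M"
  have "M > 0" unfolding M_def using C(1) by (intro sum_pos) auto
  then have L: "L > 0" by (simp add: L_def)
  have D: "norm (?D x h) \<le> L * norm h" for x h
    unfolding L_def
    by (rule norm_linear_le_basis[OF has_derivative_linear[OF d]]) (use C(2) M in \<open>metis order_trans\<close>)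
  have "norm (f x - f y) \<le> L * norm (x - y)" for x y
  proof (rule differentiable_bound[of UNIV f ?D])
    show "onorm (?D z) \<le> L" for z
      by (rule onorm_le) (rule D)
  qed (use d in auto)
  with L D show thesis using that by blast
qed

text \<open>Compact support makes the remainder constant uniform over all pairs of points, however far apart.
Both uses need this: the kernel of a mollifier is expanded uniformly in its argument, and the stress
is expanded between two values of F whose distance is not small.\<close>

lemma C2_compact_support_Taylor:
  fixes f :: "'a::euclidean_space \<Rightarrow> 'b::real_normed_vector"
  assumes f: "C_k_on 2 UNIV f" and K: "compact K" and z: "\<And>x. x \<notin> K \<Longrightarrow> f x = 0"
  obtains C where "C > 0"
    "\<And>x y. norm (f x - f y - frechet_derivative f (at y) (x - y)) \<le> C * (norm (x - y))\<^sup>2"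
proof -
  let ?D = "\<lambda>x. frechet_derivative f (at x)"
  have f2: "C_k_on (Suc 1) UNIV f" using f by (simp add: numeral_2_eq_2)
  have d: "(f has_derivative ?D x) (at x)" for x
    using C_k_on_SucD(1)[OF f2] by simp
  have "\<forall>b. \<exists>C>0. \<forall>x y. norm (?D x b - ?D y b) \<le> C * norm (x - y)"
  proof
    fix b
    have "C_k_on 1 UNIV (\<lambda>x. ?D x b)" using C_k_on_SucD(2)[OF f2] .
    from C1_compact_support_Lipschitz[OF this K frechet_derivative_zero_off[OF compact_imp_closed[OF K] z]]
    show "\<exists>C>0. \<forall>x y. norm (?D x b - ?D y b) \<le> C * norm (x - y)" by metis
  qed
  then obtain C where C: "\<And>b. C b > 0" "\<And>b x y. norm (?D x b - ?D y b) \<le> C b * norm (x - y)" by metis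
  define M where "M = (\<Sum>b\<in>(Basis::'a set). C b)"
  have M: "C b \<le> M" if "b \<in> Basis" for b
    unfolding M_def using that C(1) by (intro member_le_sum) (auto intro: less_imp_le)
  define L where "L = real DIM('a) * M"
  have "M > 0" unfolding M_def using C(1) by (intro sum_pos) auto
  then have L: "L > 0" by (simp add: L_def)
  have D: "norm (?D x h - ?D y h) \<le> L * norm (x - y) * norm h" for x y h
  proof -
    have "norm (?D x h - ?D y h) \<le> real DIM('a) * (M * norm (x - y)) * norm h"
      by (rule norm_linear_le_basis[OF linear_compose_sub[OF has_derivative_linear[OF d] has_derivative_linear[OF d]]])
        (meson C(2) M mult_right_mono norm_ge_zero order_trans)
    then show ?thesis by (simp add: L_def mult_ac)
  qed
  have "norm (f x - f y - ?D y (x - y)) \<le> L * (norm (x - y))\<^sup>2" for x y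
  proof -
    have "norm (f x - f y - ?D y (x - y)) \<le> norm (x - y) * (L * norm (x - y))"
    proof (rule differentiable_bound_linearization[where S = "closed_segment y x" and f' = ?D])
      show "y + t *\<^sub>R (x - y) \<in> closed_segment y x" if "t \<in> {0..1}" for t
        using that by (auto simp: in_segment algebra_simps intro!: exI[of _ t])
      show "onorm (?D w - ?D y) \<le> L * norm (x - y)" if w: "w \<in> closed_segment y x" for w
      proof (rule onorm_le)
        fix h
        have "norm (?D w h - ?D y h) \<le> L * norm (w - y) * norm h" by (rule D)
        also have "\<dots> \<le> L * norm (x - y) * norm h"
          using segment_bound(1)[OF w] L by (intro mult_right_mono mult_left_mono) auto
        finally show "norm ((?D w - ?D y) h) \<le> L * norm (x - y) * norm h" by simp
      qed
    qed (use d in \<open>auto intro: has_derivative_at_withinI\<close>)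
    then show ?thesis by (simp add: power2_eq_square mult_ac)
  qed
  with L that show thesis by blast
qed

text \<open>A finite sum of bumps is bounded below by some m > 0 on K.  Composing it with a smooth function
that is 0 at 0 and constantly 1 above m/2 gives a function equal to 1 on a neighbourhood of K,
so that not only values but also derivatives survive the multiplication.\<close>

lemma smooth_cutoff:
  fixes K U :: "'a::euclidean_space set"
  assumes K: "compact K" and U: "open U" and KU: "K \<subseteq> U"
  obtains \<kappa> K' N where "\<And>k. C_k_on k UNIV \<kappa>" "compact K'" "K' \<subseteq> U" "\<And>x. x \<notin> K' \<Longrightarrow> \<kappa> x = 0"
    "open N" "K \<subseteq> N" "N \<subseteq> U" "\<And>x. x \<in> N \<Longrightarrow> \<kappa> x = (1::real)"
proof -
  have "\<forall>x\<in>K. \<exists>r>0. cball x r \<subseteq> U"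
    using U KU open_contains_cball by blast
  then obtain r where r: "\<And>x. x \<in> K \<Longrightarrow> r x > 0" "\<And>x. x \<in> K \<Longrightarrow> cball x (r x) \<subseteq> U" by metis
  obtain I where I: "I \<subseteq> K" "finite I" "K \<subseteq> (\<Union>x\<in>I. ball x (r x))"
  proof (rule compactE_image[OF K, of K "\<lambda>x. ball x (r x)"])
    show "K \<subseteq> (\<Union>x\<in>K. ball x (r x))" using r by force
  qed auto
  define s where "s x = (\<Sum>c\<in>I. bump c (r c) x)" for x
  have sC: "C_k_on k UNIV s" for k
    unfolding s_def by (intro C_k_on_sum I bump_C_k) auto
  define K' where "K' = (\<Union>c\<in>I. cball c (r c))"
  have K': "compact K'" "K' \<subseteq> U"
  proof -
    show "compact K'" unfolding K'_def using I(2) by (intro compact_UN) auto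
    show "K' \<subseteq> U" unfolding K'_def using I(1) r(2) by blast
  qed
  have sz: "s x = 0" if "x \<notin> K'" for x
    unfolding s_def
  proof (intro sum.neutral ballI bump_zero)
    fix c assume c: "c \<in> I"
    show "0 \<le> r c" using r(1) I(1) c by (meson less_imp_le subsetD)
    show "r c \<le> dist c x" using that c by (auto simp: K'_def)
  qed
  have spos: "s x > 0" if x: "x \<in> K" for x
  proof -
    obtain c where c: "c \<in> I" "dist c x < r c" using I(3) x by auto
    have "bump c (r c) x \<le> s x"
      unfolding s_def using c I(2) by (intro member_le_sum) (auto simp: bump_nonneg)
    then show ?thesis using bump_pos[OF c(2)] by linarith
  qed
  obtain m where m: "m > 0" "\<And>x. x \<in> K \<Longrightarrow> s x \<ge> m"
  proof (cases "K = {}")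
    case False
    have "\<exists>x\<in>K. \<forall>y\<in>K. s x \<le> s y"
      by (rule continuous_attains_inf[OF K False])
        (use C_k_on_imp_continuous_on[OF sC] in \<open>blast intro: continuous_on_subset\<close>)
    then show ?thesis using spos that by metis
  qed (use that[of 1] in auto)
  define N where "N = {x. m / 2 < s x}"
  define \<kappa> where "\<kappa> x = 1 - flat 0 (m / 2 - s x) * inverse (flat 0 (m / 2))" for x
  have fm: "flat 0 (m / 2) > 0" using m by (simp add: flat_pos)
  show thesis
  proof (rule that[of \<kappa> K' N])
    show "C_k_on k UNIV \<kappa>" for k
    proof -
      have "C_k_on k UNIV (\<lambda>x. flat 0 (m / 2 - s x))"
        by (rule C_k_on_compose_real[OF _ flat_C_k]) (intro C_k_on_diff C_k_on_const sC open_UNIV)+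
      then show ?thesis unfolding \<kappa>_def
        by (intro C_k_on_diff C_k_on_mult C_k_on_const) auto
    qed
    show "\<kappa> x = 0" if "x \<notin> K'" for x
      using fm sz[OF that] by (simp add: \<kappa>_def)
    have "continuous_on UNIV s" using C_k_on_imp_continuous_on[OF sC] .
    then show "open N" unfolding N_def by (intro open_Collect_less) (auto intro: continuous_intros)
    show "K \<subseteq> N" using m by (force simp: N_def)
    show "N \<subseteq> U"
    proof
      fix x assume "x \<in> N"
      then have "s x \<noteq> 0" using m by (auto simp: N_def)
      then show "x \<in> U" using sz K' by blast
    qed
    show "\<kappa> x = 1" if "x \<in> N" for x
      using that by (simp add: \<kappa>_def N_def flat_zero)
  qed (use K' in auto)
qed

lemma C_k_on_extend_zero:
  fixes g :: "'a::real_normed_vector \<Rightarrow> 'b::real_normed_vector"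
  assumes U: "open U" and K: "closed K" "K \<subseteq> U"
  shows "C_k_on k U g \<Longrightarrow> (\<And>x. x \<notin> K \<Longrightarrow> g x = 0) \<Longrightarrow> C_k_on k UNIV g"
proof (induction k arbitrary: g)
  case 0
  have "continuous_on (U \<union> - K) g"
  proof (rule continuous_on_open_Un)
    show "continuous_on (- K) g"
      using 0(2) continuous_on_cong[of "- K" "- K" g "\<lambda>x. 0"] by simp
  qed (use 0 U K(1) in \<open>auto simp: open_Compl\<close>)
  moreover have "U \<union> - K = UNIV" using K(2) by auto
  ultimately show ?case by simp
next
  case (Suc k)
  have "g differentiable (at x)" for x
  proof (cases "x \<in> U")
    case True
    then show ?thesis using Suc.prems by auto
  next
    case False
    have "(g has_derivative (\<lambda>e. 0)) (at x)"
      by (rule has_derivative_transform_within_open[where f = "\<lambda>x. 0" and s = "- K"])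
         (use K False Suc.prems in \<open>auto simp: open_Compl\<close>)
    then show ?thesis by (auto simp: differentiable_def)
  qed
  moreover have "C_k_on k UNIV (\<lambda>x. frechet_derivative g (at x) e)" for e
    by (rule Suc.IH[OF C_k_on_SucD(2)[OF Suc.prems(1)] frechet_derivative_zero_off[OF K(1) Suc.prems(2)]])
  ultimately show ?case by simp
qed

text \<open>Averages of values of F leave the possibly non-convex set U.  This extension replaces the energy
density by a globally defined one with the same values and derivatives on the essential range of F,
so that it can be evaluated at mollified fields.\<close>

lemma C_k_extension:
  fixes W :: "'a::euclidean_space \<Rightarrow> real"
  assumes K: "compact K" and U: "open U" and KU: "K \<subseteq> U" and W: "C_k_on k U W"
  obtains V K' N where "C_k_on k UNIV V" "compact K'" "\<And>x. x \<notin> K' \<Longrightarrow> V x = 0"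
    "open N" "K \<subseteq> N" "N \<subseteq> U" "\<And>x. x \<in> N \<Longrightarrow> V x = W x"
proof -
  obtain \<kappa> K' N where c: "\<And>k. C_k_on k UNIV \<kappa>" "compact K'" "K' \<subseteq> U" "\<And>x. x \<notin> K' \<Longrightarrow> \<kappa> x = 0"
    "open N" "K \<subseteq> N" "N \<subseteq> U" "\<And>x. x \<in> N \<Longrightarrow> \<kappa> x = (1::real)"
    by (rule smooth_cutoff[OF K U KU]) blast
  define V where "V x = (if x \<in> U then \<kappa> x * W x else 0)" for x
  have "C_k_on k U (\<lambda>x. \<kappa> x * W x)"
    by (intro C_k_on_mult U W C_k_on_subset[OF c(1)]) simp
  then have "C_k_on k U V"
    by (rule C_k_on_cong[OF U]) (simp add: V_def)
  then have "C_k_on k UNIV V"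
    by (rule C_k_on_extend_zero[OF U compact_imp_closed[OF c(2)] c(3)]) (simp add: V_def c(4))
  then show thesis
    by (rule that[OF _ c(2) _ c(5,6,7)]) (use c in \<open>auto simp: V_def\<close>)
qed

section \<open>Mollification\<close>

lemma bounded_borel_integrable:
  fixes g :: "'a::topological_space \<Rightarrow> 'b::{banach, second_countable_topology}"
  assumes "finite_measure M" "sets M = sets borel" "g \<in> borel_measurable borel" "\<And>x. norm (g x) \<le> B"
  shows "integrable M g"
proof -
  interpret finite_measure M by fact
  have "g \<in> borel_measurable M"
    using assms(3) measurable_cong_sets[OF assms(2) refl, where N = borel] by blast
  then show ?thesis using assms(4) by (intro integrable_const_bound[where B = B]) auto
qed

lemma integral_lborel_shift:
  fixes f :: "'a::euclidean_space \<Rightarrow> 'b::{banach, second_countable_topology}"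
  assumes [measurable]: "f \<in> borel_measurable borel"
  shows "(\<integral>x. f (x + c) \<partial>lborel) = integral\<^sup>L lborel f"
proof -
  have "integral\<^sup>L lborel f = integral\<^sup>L (distr lborel borel ((+) c)) f"
    by (simp add: lborel_distr_plus)
  also have "\<dots> = (\<integral>x. f (c + x) \<partial>lborel)"
    by (rule integral_distr) auto
  finally show ?thesis by (simp add: add.commute)
qed

lemma nn_integral_lborel_shift:
  fixes f :: "'a::euclidean_space \<Rightarrow> ennreal"
  assumes [measurable]: "f \<in> borel_measurable borel"
  shows "(\<integral>\<^sup>+x. f (x + c) \<partial>lborel) = integral\<^sup>N lborel f"
proof -
  have "integral\<^sup>N lborel f = integral\<^sup>N (distr lborel borel ((+) c)) f"
    by (simp add: lborel_distr_plus)
  also have "\<dots> = (\<integral>\<^sup>+x. f (c + x) \<partial>lborel)"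
    by (rule nn_integral_distr) auto
  finally show ?thesis by (simp add: add.commute)
qed

text \<open>Kernels live in the unit ball.  Integrating them against this finite measure makes every bounded
Borel integrand integrable, so integrability never needs a separate decay argument.\<close>

definition ubm :: "'a::euclidean_space measure" where
  "ubm = density lborel (\<lambda>z. ennreal (indicator (ball 0 1) z))"

lemma sets_ubm [simp, measurable_cong]: "sets ubm = sets borel" and space_ubm [simp]: "space ubm = UNIV"
  by (auto simp: ubm_def)

lemma AE_ubm: "(AE z in ubm. P z) \<longleftrightarrow> (AE z in lborel. z \<in> ball 0 1 \<longrightarrow> P z)"
  unfolding ubm_def by (subst AE_density) (auto simp: indicator_def)

lemma finite_measure_ubm: "finite_measure (ubm :: 'a::euclidean_space measure)"
proof
  have "emeasure (ubm :: 'a measure) (space ubm) = (\<integral>\<^sup>+z. indicator (ball (0::'a) 1) z \<partial>lborel)"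
    unfolding ubm_def by (subst emeasure_density) (auto simp: ennreal_indicator intro!: borel_measurable_indicator)
  also have "\<dots> = emeasure lborel (ball (0::'a) 1)" by (rule nn_integral_indicator) simp
  also have "\<dots> < \<infinity>" by (rule emeasure_lborel_ball_finite)
  finally show "emeasure ubm (space (ubm :: 'a measure)) \<noteq> \<infinity>" by (rule less_imp_neq)
qed

interpretation ubm: finite_measure ubm
  by (rule finite_measure_ubm)

lemma ubm_integrable:
  fixes g :: "'a::euclidean_space \<Rightarrow> 'b::{banach, second_countable_topology}"
  shows "g \<in> borel_measurable borel \<Longrightarrow> (\<And>x. norm (g x) \<le> B) \<Longrightarrow> integrable ubm g"
  by (rule bounded_borel_integrable[OF finite_measure_ubm sets_ubm])

lemma integral_ubm:
  fixes g :: "'a::euclidean_space \<Rightarrow> 'b::{banach, second_countable_topology}"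
  assumes "g \<in> borel_measurable borel" "\<And>z. 1 \<le> norm z \<Longrightarrow> g z = 0"
  shows "integral\<^sup>L ubm g = integral\<^sup>L lborel g"
proof -
  have "integral\<^sup>L ubm g = (\<integral>z. indicator (ball 0 1) z *\<^sub>R g z \<partial>lborel)"
    unfolding ubm_def using assms(1) by (intro integral_density borel_measurable_indicator) auto
  also have "\<dots> = integral\<^sup>L lborel g"
    by (intro Bochner_Integration.integral_cong)
      (use assms(2) in \<open>auto simp: indicator_def not_less\<close>)
  finally show ?thesis .
qed

lemma compact_support_integrable:
  fixes g :: "'a::euclidean_space \<Rightarrow> 'b::{banach, second_countable_topology}"
  assumes [measurable]: "g \<in> borel_measurable borel" and "\<And>z. norm (g z) \<le> B" "\<And>z. r \<le> norm z \<Longrightarrow> g z = 0"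
  shows "integrable lborel g"
  by (rule integrableI_bounded_set[where A = "ball 0 r" and B = B])
    (use assms emeasure_lborel_ball_finite[of "0::'a" r] in \<open>auto simp: not_less\<close>)

definition kernel :: "('a::euclidean_space \<Rightarrow> real) \<Rightarrow> bool" where
  "kernel k \<longleftrightarrow> smooth_on UNIV k \<and> (\<forall>z. 1 \<le> norm z \<longrightarrow> k z = 0)"

text \<open>The scale sits in the argument of g, not in the kernel: bounds then need no change of variables,
and a negative scale is the adjoint mollification.\<close>

definition moll :: "('a::euclidean_space \<Rightarrow> real) \<Rightarrow> real \<Rightarrow> ('a \<Rightarrow> 'b::euclidean_space) \<Rightarrow> 'a \<Rightarrow> 'b" where
  "moll k s g p = (\<integral>z. k z *\<^sub>R g (p + s *\<^sub>R z) \<partial>ubm)"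

text \<open>The kernel that produces the derivative in direction e of the mollification at scale s: after
moving p to the kernel, differentiation acts on k at the rate -1/s.\<close>

definition dker :: "('a::euclidean_space \<Rightarrow> real) \<Rightarrow> real \<Rightarrow> 'a \<Rightarrow> 'a \<Rightarrow> real" where
  "dker k s e z = - (1 / s) * frechet_derivative k (at z) e"

lemma kernel_continuous: "kernel k \<Longrightarrow> continuous_on UNIV k"
  using C_k_on_imp_continuous_on[of 0 UNIV k] by (auto simp: kernel_def smooth_on_def)

lemma kernel_measurable [measurable]: "kernel k \<Longrightarrow> k \<in> borel_measurable borel"
  by (intro borel_measurable_continuous_onI kernel_continuous)

lemma kernel_zero: "kernel k \<Longrightarrow> 1 \<le> norm z \<Longrightarrow> k z = 0"
  by (simp add: kernel_def)

lemma kernel_zero_cball: "kernel k \<Longrightarrow> z \<notin> cball 0 1 \<Longrightarrow> k z = 0"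
  by (simp add: kernel_def)

lemma kernel_bound:
  assumes "kernel k"
  obtains C where "C > 0" "\<And>z. \<bar>k z\<bar> \<le> C"
  using compact_support_bounded[OF kernel_continuous[OF assms] compact_cball kernel_zero_cball[OF assms]]
  by (metis real_norm_def)

text \<open>Off the closed unit ball the derivative vanishes because k does; on the unit sphere it vanishes
by continuity.\<close>

lemma kernel_dker:
  assumes k: "kernel k"
  shows "kernel (dker k s e)"
proof -
  have s: "C_k_on n UNIV k" for n using k by (auto simp: kernel_def smooth_on_def)
  have "C_k_on n UNIV (dker k s e)" for n
    unfolding dker_def
    by (intro C_k_on_mult C_k_on_const C_k_on_SucD(2)[OF s]) auto
  then have sm: "smooth_on UNIV (dker k s e)" by (simp add: smooth_on_def)
  have "dker k s e z = 0" if "1 < norm z" for z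
    unfolding dker_def
    using frechet_derivative_zero_off[of "cball 0 1" k z e] kernel_zero_cball[OF k] that by auto
  moreover have "dker k s e z = 0" if z: "norm z = 1" for z
  proof -
    have "((\<lambda>r. dker k s e (r *\<^sub>R z)) \<longlongrightarrow> dker k s e (1 *\<^sub>R z)) (at_right 1)"
    proof -
      have "continuous_on UNIV (dker k s e)"
        using sm by (metis C_k_on_imp_continuous_on smooth_on_def)
      then have "continuous_on UNIV (\<lambda>r. dker k s e (r *\<^sub>R z))"
        by (rule continuous_on_compose2[where f = "\<lambda>r. r *\<^sub>R z"]) (auto intro!: continuous_intros)
      then have "isCont (\<lambda>r. dker k s e (r *\<^sub>R z)) 1"
        by (simp add: continuous_on_eq_continuous_at)
      then show ?thesis
        unfolding isCont_def filterlim_at_split by blast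
    qed
    moreover have "((\<lambda>r. dker k s e (r *\<^sub>R z)) \<longlongrightarrow> 0) (at_right 1)"
      by (rule Lim_transform_eventually[OF tendsto_const])
        (use \<open>\<And>z. 1 < norm z \<Longrightarrow> dker k s e z = 0\<close> z in \<open>auto simp: eventually_at_filter\<close>)
    ultimately show ?thesis
      using tendsto_unique[of "at_right (1::real)"] by (metis scaleR_one trivial_limit_at_right_real)
  qed
  ultimately have "dker k s e z = 0" if "1 \<le> norm z" for z
    using that by (cases "norm z = 1") auto
  with sm show ?thesis by (simp add: kernel_def)
qed

lemma moll_integrand_bound:
  fixes g :: "'a::euclidean_space \<Rightarrow> 'b::euclidean_space"
  assumes "\<And>z. \<bar>k z\<bar> \<le> C" "\<And>q. norm (g q) \<le> B"
  shows "norm (k z *\<^sub>R g q) \<le> C * B"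
  using mult_mono[OF assms(1)[of z] assms(2)[of q]] order_trans[OF abs_ge_zero assms(1)] by simp

lemma moll_integrable:
  fixes g :: "'a::euclidean_space \<Rightarrow> 'b::euclidean_space"
  assumes k: "kernel k" and [measurable]: "g \<in> borel_measurable borel" and B: "\<And>q. norm (g q) \<le> B"
  shows "integrable ubm (\<lambda>z. k z *\<^sub>R g (p + s *\<^sub>R z))"
proof -
  note kernel_measurable[OF k, measurable]
  obtain C where C: "\<And>z. \<bar>k z\<bar> \<le> C" using kernel_bound[OF k] by blast
  show ?thesis
    by (rule ubm_integrable[where B = "C * B"]) (use moll_integrand_bound[OF C B] in auto)
qed

lemma moll_lborel:
  assumes k: "kernel k" and [measurable]: "g \<in> borel_measurable borel"
  shows "moll k s g p = (\<integral>z. k z *\<^sub>R g (p + s *\<^sub>R z) \<partial>lborel)"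
  unfolding moll_def using kernel_measurable[OF k, measurable]
  by (intro integral_ubm) (auto simp: kernel_zero[OF k])

lemma moll_add_shift:
  assumes k: "kernel k" and [measurable]: "g \<in> borel_measurable borel" and s: "s \<noteq> 0"
  shows "moll k s g (p + h) = (\<integral>z. k (z - (1 / s) *\<^sub>R h) *\<^sub>R g (p + s *\<^sub>R z) \<partial>lborel)"
proof -
  note kernel_measurable[OF k, measurable]
  have "(\<integral>z. k (z - (1 / s) *\<^sub>R h) *\<^sub>R g (p + s *\<^sub>R z) \<partial>lborel) =
      (\<integral>z. k ((z + (1 / s) *\<^sub>R h) - (1 / s) *\<^sub>R h) *\<^sub>R g (p + s *\<^sub>R (z + (1 / s) *\<^sub>R h)) \<partial>lborel)"
    by (rule integral_lborel_shift[symmetric]) measurable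
  also have "\<dots> = moll k s g (p + h)"
    unfolding moll_lborel[OF k assms(2)] using s
    by (intro Bochner_Integration.integral_cong) (auto simp: algebra_simps)
  finally show ?thesis by simp
qed

text \<open>Translating p amounts to translating the kernel, so the difference quotients are controlled by the
Taylor expansion of k alone.  This is why g may be an arbitrary bounded Borel function.\<close>

lemma moll_has_derivative:
  fixes g :: "'a::euclidean_space \<Rightarrow> 'b::euclidean_space"
  assumes k: "kernel k" and g [measurable]: "g \<in> borel_measurable borel" and B: "\<And>q. norm (g q) \<le> B" 
    and s: "s \<noteq> 0"
  shows "(moll k s g has_derivative (\<lambda>e. moll (dker k s e) s g p)) (at p)"
proof -
  note kernel_measurable[OF k, measurable]
  let ?D = "\<lambda>z. frechet_derivative k (at z)"
  have C2: "C_k_on 2 UNIV k" and C1: "C_k_on (Suc 0) UNIV k"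
    using k by (auto simp: kernel_def smooth_on_def)
  have lin: "linear (?D z)" for z
    using has_derivative_linear[OF C_k_on_SucD(1)[OF C1]] by simp
  obtain C where C: "C > 0" "\<And>x y. norm (k x - k y - ?D y (x - y)) \<le> C * (norm (x - y))\<^sup>2"
    using C2_compact_support_Taylor[OF C2 compact_cball kernel_zero_cball[OF k]] by blast
  obtain C0 where C0: "\<And>z. \<bar>k z\<bar> \<le> C0" using kernel_bound[OF k] by blast
  have B0: "B \<ge> 0" using B[of 0] norm_ge_zero order_trans by blast
  have D_meas [measurable]: "(\<lambda>z. ?D z u) \<in> borel_measurable borel" for u
    using kernel_measurable[OF kernel_dker[OF k, of "-1" u]] by (simp add: dker_def[abs_def])
  have D_zero: "?D z u = 0" if "1 \<le> norm z" for z u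
    using kernel_zero[OF kernel_dker[OF k, of "-1" u] that] by (simp add: dker_def)
  have D_int: "integrable ubm (\<lambda>z. dker k s e z *\<^sub>R g (p + s *\<^sub>R z))" for e
    by (rule moll_integrable[OF kernel_dker[OF k] g B])
  have dlin: "dker k s (a + b) z = dker k s a z + dker k s b z" "dker k s (r *\<^sub>R a) z = r * dker k s a z" for a b r z
    unfolding dker_def by (auto simp: linear_add[OF lin] linear_cmul[OF lin] algebra_simps)
  have "linear (\<lambda>e. moll (dker k s e) s g p)"
  proof
    fix a b :: 'a and r :: real
    show "moll (dker k s (a + b)) s g p = moll (dker k s a) s g p + moll (dker k s b) s g p"
      unfolding moll_def dlin scaleR_add_left by (rule Bochner_Integration.integral_add[OF D_int D_int])
    show "moll (dker k s (r *\<^sub>R a)) s g p = r *\<^sub>R moll (dker k s a) s g p"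
      unfolding moll_def dlin scaleR_scaleR[symmetric]
      by (rule Bochner_Integration.integral_scaleR_right)
  qed
  then have bl: "bounded_linear (\<lambda>e. moll (dker k s e) s g p)"
    by (simp add: linear_conv_bounded_linear)
  define V where "V = measure lborel (ball (0::'a) 2)"
  have est: "norm (moll k s g (p + h) - moll k s g p - moll (dker k s h) s g p)
      \<le> C * B * V * (norm ((1 / s) *\<^sub>R h))\<^sup>2" if h: "norm h < \<bar>s\<bar>" for h
  proof -
    define u where "u = (1 / s) *\<^sub>R h"
    have u: "norm u \<le> 1" using h s by (simp add: u_def divide_simps)
    have Dh: "dker k s h z = - ?D z u" for z
      unfolding dker_def u_def by (simp add: linear_cmul[OF lin])
    define E where "E z = k (z - u) - k z + ?D z u" for z
    have E: "norm (E z) \<le> C * (norm u)\<^sup>2" for z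
      using C(2)[of "z - u" z] by (simp add: E_def linear_neg[OF lin])
    have ku0: "k (z - u) = 0" if "2 \<le> norm z" for z
      using that u norm_triangle_ineq2[of z u] by (intro kernel_zero[OF k]) linarith
    have E0: "E z = 0" if "2 \<le> norm z" for z
      using that ku0[OF that] by (simp add: E_def kernel_zero[OF k] D_zero)
    have [measurable]: "E \<in> borel_measurable borel" unfolding E_def by measurable
    have i1: "integrable lborel (\<lambda>z. k (z - u) *\<^sub>R g (p + s *\<^sub>R z))"
      by (rule compact_support_integrable[where B = "C0 * B" and r = 2])
         (use moll_integrand_bound[OF C0 B] in \<open>auto simp: ku0\<close>)
    have i2: "integrable lborel (\<lambda>z. k z *\<^sub>R g (p + s *\<^sub>R z))"
      by (rule compact_support_integrable[where B = "C0 * B" and r = 1])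
         (use moll_integrand_bound[OF C0 B] in \<open>auto simp: kernel_zero[OF k]\<close>)
    obtain C1 where C1: "\<And>z. \<bar>dker k s h z\<bar> \<le> C1" using kernel_bound[OF kernel_dker[OF k]] by blast
    have i3: "integrable lborel (\<lambda>z. dker k s h z *\<^sub>R g (p + s *\<^sub>R z))"
      using kernel_measurable[OF kernel_dker[OF k], measurable]
      by (intro compact_support_integrable[where B = "C1 * B" and r = 1])
         (use moll_integrand_bound[OF C1 B] in \<open>auto simp: kernel_zero[OF kernel_dker[OF k]]\<close>)
    have "moll k s g (p + h) - moll k s g p - moll (dker k s h) s g p
        = (\<integral>z. E z *\<^sub>R g (p + s *\<^sub>R z) \<partial>lborel)"
    proof -
      have "moll k s g (p + h) - moll k s g p - moll (dker k s h) s g p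
          = (\<integral>z. k (z - u) *\<^sub>R g (p + s *\<^sub>R z) - k z *\<^sub>R g (p + s *\<^sub>R z)
              - dker k s h z *\<^sub>R g (p + s *\<^sub>R z) \<partial>lborel)"
        unfolding moll_add_shift[OF k g s] moll_lborel[OF k g, of s p] moll_lborel[OF kernel_dker[OF k] g] u_def[symmetric]
        using i1 i2 i3 by simp
      then show ?thesis by (simp add: Dh E_def algebra_simps)
    qed
    also have "norm \<dots> \<le> (\<integral>z. norm (E z *\<^sub>R g (p + s *\<^sub>R z)) \<partial>lborel)"
      by (rule integral_norm_bound)
    also have "\<dots> \<le> (\<integral>z. C * (norm u)\<^sup>2 * B * indicator (ball 0 2) (z::'a) \<partial>lborel)"
    proof (rule integral_mono)
      have Eg: "norm (E z *\<^sub>R g (p + s *\<^sub>R z)) \<le> C * (norm u)\<^sup>2 * B" for z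
        using moll_integrand_bound[where k = E and C = "C * (norm u)\<^sup>2" and g = g and B = B] E B by simp
      show "integrable lborel (\<lambda>z. norm (E z *\<^sub>R g (p + s *\<^sub>R z)))"
        by (rule compact_support_integrable[where B = "C * (norm u)\<^sup>2 * B" and r = 2])
           (use Eg E0 in auto)
      show "integrable lborel (\<lambda>z. C * (norm u)\<^sup>2 * B * indicator (ball 0 2) (z::'a))"
        using emeasure_lborel_ball_finite[of "0::'a" 2] by simp
      show "norm (E z *\<^sub>R g (p + s *\<^sub>R z)) \<le> C * (norm u)\<^sup>2 * B * indicator (ball 0 2) z" for z
        using Eg[of z] E0[of z] by (auto simp: indicator_def)
    qed
    also have "\<dots> = C * B * V * (norm u)\<^sup>2"
      by (simp add: V_def)
    finally show ?thesis by (simp add: u_def)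
  qed
  show ?thesis
  proof (rule has_derivativeI_sandwich[where e = "\<bar>s\<bar>"])
    show "norm (moll k s g y - moll k s g p - moll (dker k s (y - p)) s g p) / norm (y - p)
        \<le> C * B * V / s\<^sup>2 * norm (y - p)"
      if "y \<noteq> p" "dist y p < \<bar>s\<bar>" for y
    proof -
      have "norm (moll k s g y - moll k s g p - moll (dker k s (y - p)) s g p) \<le>
          C * B * V / s\<^sup>2 * norm (y - p) * norm (y - p)"
      proof -
        have "(norm ((1 / s) *\<^sub>R (y - p)))\<^sup>2 = 1 / s\<^sup>2 * (norm (y - p) * norm (y - p))"
          by (simp add: power2_eq_square)
        then show ?thesis using est[of "y - p"] that by (simp add: dist_norm mult_ac)
      qed
      then show ?thesis using that by (simp add: divide_le_eq)
    qed
    show "((\<lambda>y. C * B * V / s\<^sup>2 * norm (y - p)) \<longlongrightarrow> 0) (at p)"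
      by (use s in \<open>auto intro!: tendsto_eq_intros\<close>)
  qed (use s bl in auto)
qed

lemma moll_smooth:
  assumes g: "g \<in> borel_measurable borel" "\<And>q. norm (g q) \<le> B" and s: "s \<noteq> 0"
  shows "kernel k \<Longrightarrow> C_k_on n UNIV (moll k s g)"
proof (induction n arbitrary: k)
  case 0
  then show ?case
    by (auto intro!: continuous_at_imp_continuous_on has_derivative_continuous[OF moll_has_derivative[OF _ g s]])
next
  case (Suc n)
  show ?case
    by (rule C_k_on_SucI[OF _ moll_has_derivative[OF Suc.prems g s]])
      (auto intro: Suc.IH kernel_dker[OF Suc.prems])
qed

lemma moll_measurable:
  assumes "kernel k" and g: "g \<in> borel_measurable borel" "\<And>q. norm (g q) \<le> B" and s: "s \<noteq> 0"
  shows "moll k s g \<in> borel_measurable borel"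
  by (rule borel_measurable_continuous_onI[OF C_k_on_imp_continuous_on[OF moll_smooth[OF g s assms(1), of 0]]])

text \<open>Constants are annihilated, so the derivative of a mollification is an average of increments
g (p + s z) - g p; this turns Besov regularity into a gain of one power of the increment.\<close>

lemma moll_dker_const:
  assumes k: "kernel k" and s: "s \<noteq> 0"
  shows "moll (dker k s e) s (\<lambda>q. c) p = 0"
proof -
  have "(moll k s (\<lambda>q. c) has_derivative (\<lambda>e. moll (dker k s e) s (\<lambda>q. c) p)) (at p)"
    by (rule moll_has_derivative[OF k _ _ s, where B = "norm c"]) auto
  moreover have "(moll k s (\<lambda>q. c) has_derivative (\<lambda>e. 0)) (at p)"
  proof -
    have "moll k s (\<lambda>q. c) = (\<lambda>p. \<integral>z. k z *\<^sub>R c \<partial>ubm)" by (auto simp: moll_def)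
    then show ?thesis by simp
  qed
  ultimately show ?thesis
    using has_derivative_unique by metis
qed

text \<open>A bump is normalised; its mass is not zero because it is positive on the whole open ball.\<close>

lemma standard_mollifier:
  obtains \<rho> :: "'a::euclidean_space \<Rightarrow> real"
  where "kernel \<rho>" "\<And>z. \<rho> z \<ge> 0" "(\<integral>z. \<rho> z \<partial>ubm) = 1"
proof -
  let ?b = "bump (0::'a) 1"
  have k: "kernel ?b"
    by (auto simp: kernel_def smooth_on_def bump_C_k intro!: bump_zero)
  define m where "m = (\<integral>z. ?b z \<partial>ubm)"
  have int: "integrable ubm ?b"
    using moll_integrable[OF k, where g = "\<lambda>q. 1::real" and B = 1] by simp
  have "m \<noteq> 0"
  proof
    assume "m = 0"
    then have "AE z in ubm. ?b z = 0"
      using integral_nonneg_eq_0_iff_AE[OF int] bump_nonneg by (auto simp: m_def)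
    then have "AE z in lborel. z \<in> ball 0 1 \<longrightarrow> ?b z = 0"
      by (simp add: AE_ubm)
    then have "AE z in lborel. z \<notin> ball (0::'a) 1"
      by eventually_elim (use bump_pos[of "0::'a" _ 1] in force)
    then have "emeasure lborel (ball (0::'a) 1) = 0"
      by (subst (asm) AE_iff_measurable[of "ball 0 1"]) auto
    then show False
      using content_ball_pos[where r = 1 and c = "0::'a"] by (simp add: measure_def)
  qed
  moreover have "m \<ge> 0" unfolding m_def by (intro integral_nonneg_AE) (auto simp: bump_nonneg)
  ultimately have m: "m > 0" by simp
  show thesis
  proof (rule that[of "\<lambda>z. inverse m * ?b z"])
    show "kernel (\<lambda>z. inverse m * ?b z)"
      using k unfolding kernel_def smooth_on_def by (auto intro!: C_k_on_mult C_k_on_const)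
    show "(\<integral>z. inverse m * ?b z \<partial>ubm) = 1" using m by (simp add: m_def[symmetric])
    show "0 \<le> inverse m * ?b z" for z using m bump_nonneg[of 0 1 z] by simp
  qed
qed

section \<open>Integration over the periodic cell\<close>

lemma fst_borel [measurable]:
  "(fst :: 'a::second_countable_topology \<times> 'b::second_countable_topology \<Rightarrow> 'a) \<in> borel_measurable borel"
  by (intro borel_measurable_continuous_onI continuous_intros)

lemma snd_borel [measurable]:
  "(snd :: 'a::second_countable_topology \<times> 'b::second_countable_topology \<Rightarrow> 'b) \<in> borel_measurable borel"
  by (intro borel_measurable_continuous_onI continuous_intros)

definition lattice_vec :: "vec3 \<Rightarrow> bool" where
  "lattice_vec k \<longleftrightarrow> (\<forall>i. k $ i \<in> \<int>)"

definition periodic :: "(spacetime \<Rightarrow> 'b) \<Rightarrow> bool" where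
  "periodic f \<longleftrightarrow> (\<forall>p k. lattice_vec k \<longrightarrow> f (p + (0, k)) = f p)"

definition unit_cube :: "vec3 set" where
  "unit_cube = {x. \<forall>i. 0 \<le> x $ i \<and> x $ i < 1}"

definition lattice :: "spacetime set" where
  "lattice = {(0, k) | k. lattice_vec k}"

lemma countable_lattice: "countable lattice"
proof -
  have "{k. lattice_vec k} \<subseteq> range (\<lambda>m::int^3. \<chi> i. of_int (m $ i))"
  proof
    fix k :: vec3 assume "k \<in> {k. lattice_vec k}"
    then have "k = (\<chi> i. of_int ((\<chi> i. \<lfloor>k $ i\<rfloor>) $ i))"
      by (auto simp: lattice_vec_def vec_eq_iff elim!: Ints_cases)
    then show "k \<in> range (\<lambda>m::int^3. \<chi> i. of_int (m $ i))" by blast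
  qed
  then have "countable {k. lattice_vec k}"
    using countable_subset by fastforce
  moreover have "lattice = Pair 0 ` {k. lattice_vec k}" by (auto simp: lattice_def)
  ultimately show ?thesis by (metis countable_image)
qed

lemma lattice_uminus: "k \<in> lattice \<Longrightarrow> - k \<in> lattice"
  by (auto simp: lattice_def lattice_vec_def)

lemma periodic_lattice: "periodic f \<Longrightarrow> k \<in> lattice \<Longrightarrow> f (p + k) = f p"
  unfolding periodic_def lattice_def by blast

lemma unique_translate:
  obtains k where "k \<in> lattice" "\<And>l. l \<in> lattice \<Longrightarrow> q + l \<in> UNIV \<times> unit_cube \<longleftrightarrow> l = k"
proof
  let ?k = "(0, \<chi> i. - of_int \<lfloor>snd q $ i\<rfloor>) :: spacetime"
  show "?k \<in> lattice" by (auto simp: lattice_def lattice_vec_def)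
  show "q + l \<in> UNIV \<times> unit_cube \<longleftrightarrow> l = ?k" if l: "l \<in> lattice" for l
  proof -
    obtain m where m: "l = (0, m)" "\<And>i. m $ i \<in> \<int>" using l by (auto simp: lattice_def lattice_vec_def)
    have "0 \<le> snd q $ i + m $ i \<and> snd q $ i + m $ i < 1 \<longleftrightarrow> m $ i = - of_int \<lfloor>snd q $ i\<rfloor>" for i
    proof -
      obtain n where n: "m $ i = of_int n" using m(2)[of i] by (auto elim: Ints_cases)
      have "m $ i = - of_int \<lfloor>snd q $ i\<rfloor> \<longleftrightarrow> \<lfloor>snd q $ i\<rfloor> = - n"
        unfolding n by linarith
      also have "\<dots> \<longleftrightarrow> 0 \<le> snd q $ i + m $ i \<and> snd q $ i + m $ i < 1"
        unfolding n floor_eq_iff by auto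
      finally show ?thesis by simp
    qed
    then show ?thesis
      by (cases q) (auto simp: m(1) unit_cube_def vec_eq_iff)
  qed
qed

lemma measurable_unit_cube [measurable]: "unit_cube \<in> sets borel"
proof -
  have "{x::vec3. 0 \<le> x $ i \<and> x $ i < 1} \<in> sets borel" for i
  proof -
    have "{x::vec3. 0 \<le> x $ i} \<inter> {x. x $ i < 1} \<in> sets borel"
      by (intro sets.Int borel_closed borel_open closed_Collect_le open_Collect_less continuous_intros)
    then show ?thesis by (simp add: Int_def)
  qed
  then have "(\<Inter>i. {x::vec3. 0 \<le> x $ i \<and> x $ i < 1}) \<in> sets borel"
    by (intro sets.finite_INT) auto
  then show ?thesis by (simp add: unit_cube_def Inter_eq)
qed

lemma measurable_strip [measurable]: "A \<in> sets borel \<Longrightarrow> A \<times> unit_cube \<in> sets (borel :: spacetime measure)"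
  by (simp add: borel_prod[symmetric])

lemma cell_eq: "cell T = {0<..<T} \<times> unit_cube"
  by (simp add: cell_def unit_cube_def)

lemma measurable_cell [measurable]: "cell T \<in> sets borel"
  by (simp add: cell_eq measurable_strip)

lemma emeasure_cell_finite: "emeasure lborel (cell T) < \<infinity>"
proof (rule emeasure_bounded_finite)
  have "cell T \<subseteq> cbox (0, 0) (T, 1)"
    by (auto simp: cell_def cbox_Pair_eq mem_box_cart less_imp_le)
  then show "bounded (cell T)" using bounded_cbox bounded_subset by blast
qed

text \<open>As a finite measure on all of space-time whose measurable sets are the Borel sets, this reduces
integrability over the cell to boundedness and Borel measurability.\<close>

definition cellm :: "real \<Rightarrow> spacetime measure" where
  "cellm T = density lborel (\<lambda>p. ennreal (indicator (cell T) p))"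

lemma sets_cellm [simp, measurable_cong]: "sets (cellm T) = sets borel" and space_cellm [simp]: "space (cellm T) = UNIV"
  by (auto simp: cellm_def)

lemma finite_measure_cellm: "finite_measure (cellm T)"
proof
  have "emeasure (cellm T) (space (cellm T)) = (\<integral>\<^sup>+p. indicator (cell T) p \<partial>lborel)"
    unfolding cellm_def by (subst emeasure_density) (auto simp: ennreal_indicator intro!: borel_measurable_indicator)
  also have "\<dots> = emeasure lborel (cell T)" by (rule nn_integral_indicator) simp
  also have "\<dots> < \<infinity>" by (rule emeasure_cell_finite)
  finally show "emeasure (cellm T) (space (cellm T)) \<noteq> \<infinity>" by (rule less_imp_neq)
qed

interpretation cellm: finite_measure "cellm T"
  by (rule finite_measure_cellm)

lemma cellm_integrable:
  fixes g :: "spacetime \<Rightarrow> 'b::{banach, second_countable_topology}"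
  shows "g \<in> borel_measurable borel \<Longrightarrow> (\<And>x. norm (g x) \<le> B) \<Longrightarrow> integrable (cellm T) g"
  by (rule bounded_borel_integrable[OF finite_measure_cellm sets_cellm])

lemma nn_integral_cellm:
  assumes [measurable]: "h \<in> borel_measurable borel"
  shows "integral\<^sup>N (cellm T) h = (\<integral>\<^sup>+p. indicator (cell T) p * h p \<partial>lborel)"
  unfolding cellm_def by (subst nn_integral_density) (auto simp: ennreal_indicator)

lemma integral_cellm:
  fixes h :: "spacetime \<Rightarrow> 'b::{banach, second_countable_topology}"
  assumes [measurable]: "h \<in> borel_measurable borel"
  shows "integral\<^sup>L (cellm T) h = (\<integral>p. indicator (cell T) p *\<^sub>R h p \<partial>lborel)"
  unfolding cellm_def by (subst integral_density) auto

lemma sum_translates: "(\<integral>\<^sup>+k. indicator (UNIV \<times> unit_cube) (q + k) \<partial>count_space lattice) = (1::ennreal)"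
proof -
  obtain k where k: "k \<in> lattice" "\<And>l. l \<in> lattice \<Longrightarrow> q + l \<in> UNIV \<times> unit_cube \<longleftrightarrow> l = k"
    using unique_translate[of q] by metis
  have "(\<integral>\<^sup>+l. indicator (UNIV \<times> unit_cube) (q + l) \<partial>count_space lattice)
      = (\<integral>\<^sup>+l. 1 * indicator {k} l \<partial>count_space lattice)"
    by (rule nn_integral_cong) (use k in \<open>auto simp: indicator_def\<close>)
  also have "\<dots> = (1::ennreal)"
    using k(1) by (subst nn_integral_indicator_singleton) auto
  finally show ?thesis .
qed

lemma sum_translates_minus: "(\<integral>\<^sup>+k. indicator (UNIV \<times> unit_cube) (q - k) \<partial>count_space lattice) = (1::ennreal)"
proof -
  obtain k where k: "k \<in> lattice" "\<And>l. l \<in> lattice \<Longrightarrow> q + l \<in> UNIV \<times> unit_cube \<longleftrightarrow> l = k"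
    using unique_translate[of q] by metis
  have k': "q - l \<in> UNIV \<times> unit_cube \<longleftrightarrow> l = - k" if "l \<in> lattice" for l
    using k(2)[OF lattice_uminus[OF that]] by (auto simp: minus_equation_iff)
  have "(\<integral>\<^sup>+l. indicator (UNIV \<times> unit_cube) (q - l) \<partial>count_space lattice)
      = (\<integral>\<^sup>+l. 1 * indicator {- k} l \<partial>count_space lattice)"
    by (rule nn_integral_cong) (use k' in \<open>auto simp: indicator_def\<close>)
  also have "\<dots> = (1::ennreal)"
    using lattice_uminus[OF k(1)] by (subst nn_integral_indicator_singleton) auto
  finally show ?thesis .
qed

text \<open>Unfolding.  The lattice translates of the strip tile space-time; inserting this partition of
unity, exchanging sum and integral, and moving each summand back by periodicity exchanges the roles
of the strip and its translate.\<close>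

lemma nn_integral_strip_translate:
  fixes h :: "spacetime \<Rightarrow> ennreal"
  assumes [measurable]: "h \<in> borel_measurable borel" and per: "periodic h"
  shows "(\<integral>\<^sup>+p. indicator (UNIV \<times> unit_cube) p * h (p + y) \<partial>lborel)
       = (\<integral>\<^sup>+p. indicator (UNIV \<times> unit_cube) p * h p \<partial>lborel)"
proof -
  let ?S = "UNIV \<times> unit_cube :: spacetime set"
  have "(\<integral>\<^sup>+p. indicator ?S p * h (p + y) \<partial>lborel) = (\<integral>\<^sup>+p. indicator ?S ((p + y) - y) * h (p + y) \<partial>lborel)"
    by simp
  also have "\<dots> = (\<integral>\<^sup>+p. indicator ?S (p - y) * h p \<partial>lborel)"
    by (rule nn_integral_lborel_shift) measurable
  also have "\<dots> = (\<integral>\<^sup>+p. (\<integral>\<^sup>+k. indicator ?S (p - k) \<partial>count_space lattice) * (indicator ?S (p - y) * h p) \<partial>lborel)"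
    by (simp add: sum_translates_minus)
  also have "\<dots> = (\<integral>\<^sup>+p. (\<integral>\<^sup>+k. indicator ?S (p - k) * (indicator ?S (p - y) * h p) \<partial>count_space lattice) \<partial>lborel)"
    by (simp add: nn_integral_multc)
  also have "\<dots> = (\<integral>\<^sup>+k. (\<integral>\<^sup>+p. indicator ?S (p - k) * (indicator ?S (p - y) * h p) \<partial>lborel) \<partial>count_space lattice)"
    by (rule nn_integral_count_space_nn_integral[OF countable_lattice]) measurable
  also have "\<dots> = (\<integral>\<^sup>+k. (\<integral>\<^sup>+p. indicator ?S p * (indicator ?S (p - y + k) * h p) \<partial>lborel) \<partial>count_space lattice)"
  proof (rule nn_integral_cong)
    fix k assume "k \<in> space (count_space lattice)"
    then have k: "h (p + k) = h p" for p using periodic_lattice[OF per] by simp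
    have "(\<integral>\<^sup>+p. indicator ?S (p - k) * (indicator ?S (p - y) * h p) \<partial>lborel)
       = (\<integral>\<^sup>+p. indicator ?S ((p + k) - k) * (indicator ?S ((p + k) - y) * h (p + k)) \<partial>lborel)"
      by (rule nn_integral_lborel_shift[symmetric]) measurable
    then show "(\<integral>\<^sup>+p. indicator ?S (p - k) * (indicator ?S (p - y) * h p) \<partial>lborel)
       = (\<integral>\<^sup>+p. indicator ?S p * (indicator ?S (p - y + k) * h p) \<partial>lborel)"
      by (simp add: k algebra_simps)
  qed
  also have "\<dots> = (\<integral>\<^sup>+p. (\<integral>\<^sup>+k. indicator ?S p * (indicator ?S (p - y + k) * h p) \<partial>count_space lattice) \<partial>lborel)"
    by (rule nn_integral_count_space_nn_integral[OF countable_lattice, symmetric]) measurable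
  also have "\<dots> = (\<integral>\<^sup>+p. indicator ?S p * ((\<integral>\<^sup>+k. indicator ?S (p - y + k) \<partial>count_space lattice) * h p) \<partial>lborel)"
    by (simp add: nn_integral_multc nn_integral_cmult)
  also have "\<dots> = (\<integral>\<^sup>+p. indicator ?S p * h p \<partial>lborel)"
    by (simp add: sum_translates)
  finally show ?thesis .
qed

lemma periodic_shift:
  assumes "periodic h"
  shows "periodic (\<lambda>p. h (p + y))"
  unfolding periodic_def
proof (intro allI impI)
  fix p k assume "lattice_vec k"
  then have "h (p + y + (0, k)) = h (p + y)"
    using assms unfolding periodic_def by blast
  moreover have "p + (0, k) + y = p + y + (0, k)" by (simp only: add_ac)
  ultimately show "h (p + (0, k) + y) = h (p + y)" by (simp only:)
qed

text \<open>Time is not periodic.  The support condition keeps both the function and its translate inside the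
time interval, where the cell and the strip cannot be told apart.\<close>

lemma nn_integral_cellm_translate:
  fixes h :: "spacetime \<Rightarrow> ennreal"
  assumes [measurable]: "h \<in> borel_measurable borel" and per: "periodic h"
    and supp: "\<And>p. h p \<noteq> 0 \<Longrightarrow> fst p \<in> {0<..<T} \<and> fst p - fst y \<in> {0<..<T}"
  shows "(\<integral>\<^sup>+p. h (p + y) \<partial>cellm T) = integral\<^sup>N (cellm T) h"
proof -
  have "(\<integral>\<^sup>+p. h (p + y) \<partial>cellm T) = (\<integral>\<^sup>+p. indicator (cell T) p * h (p + y) \<partial>lborel)"
    by (rule nn_integral_cellm) measurable
  also have "\<dots> = (\<integral>\<^sup>+p. indicator (UNIV \<times> unit_cube) p * h (p + y) \<partial>lborel)"
    by (rule nn_integral_cong) (use supp[of "_ + y"] in \<open>auto simp: indicator_def cell_eq\<close>)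
  also have "\<dots> = (\<integral>\<^sup>+p. indicator (UNIV \<times> unit_cube) p * h p \<partial>lborel)"
    by (rule nn_integral_strip_translate[OF assms(1) per])
  also have "\<dots> = (\<integral>\<^sup>+p. indicator (cell T) p * h p \<partial>lborel)"
    by (rule nn_integral_cong) (use supp in \<open>auto simp: indicator_def cell_eq\<close>)
  also have "\<dots> = integral\<^sup>N (cellm T) h"
    by (rule nn_integral_cellm[symmetric]) measurable
  finally show ?thesis .
qed

lemma integral_cellm_translate:
  fixes h :: "spacetime \<Rightarrow> real"
  assumes [measurable]: "h \<in> borel_measurable borel" and per: "periodic h" and B: "\<And>p. \<bar>h p\<bar> \<le> B"
    and supp: "\<And>p. h p \<noteq> 0 \<Longrightarrow> fst p \<in> {0<..<T} \<and> fst p - fst y \<in> {0<..<T}"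
  shows "(\<integral>p. h (p + y) \<partial>cellm T) = integral\<^sup>L (cellm T) h"
proof -
  have i: "integrable (cellm T) h" "integrable (cellm T) (\<lambda>p. h (p + y))"
    by (rule cellm_integrable[where B = B]; use B in auto)+
  have "(\<integral>\<^sup>+p. ennreal (h (p + y)) \<partial>cellm T) = (\<integral>\<^sup>+p. ennreal (h p) \<partial>cellm T)"
  proof (rule nn_integral_cellm_translate[of "\<lambda>p. ennreal (h p)"])
    show "periodic (\<lambda>p. ennreal (h p))"
      using per by (simp add: periodic_def)
    show "fst p \<in> {0<..<T} \<and> fst p - fst y \<in> {0<..<T}" if "ennreal (h p) \<noteq> 0" for p
      using that by (intro supp) auto
  qed measurable
  moreover have "(\<integral>\<^sup>+p. ennreal (- h (p + y)) \<partial>cellm T) = (\<integral>\<^sup>+p. ennreal (- h p) \<partial>cellm T)"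
  proof (rule nn_integral_cellm_translate[of "\<lambda>p. ennreal (- h p)"])
    show "periodic (\<lambda>p. ennreal (- h p))"
      using per by (simp add: periodic_def)
    show "fst p \<in> {0<..<T} \<and> fst p - fst y \<in> {0<..<T}" if "ennreal (- h p) \<noteq> 0" for p
      using that by (intro supp) auto
  qed measurable
  ultimately show ?thesis
    using i by (simp add: real_lebesgue_integral_def)
qed

lemma integral_swap:
  fixes f :: "spacetime \<Rightarrow> spacetime \<Rightarrow> real"
  assumes f [measurable]: "case_prod f \<in> borel_measurable borel" and B: "\<And>p z. \<bar>f p z\<bar> \<le> B"
  shows "(\<integral>p. (\<integral>z. f p z \<partial>ubm) \<partial>cellm T) = (\<integral>z. (\<integral>p. f p z \<partial>cellm T) \<partial>ubm)"
    and "(\<lambda>p. \<integral>z. f p z \<partial>ubm) \<in> borel_measurable borel"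
    and "(\<lambda>z. \<integral>p. f p z \<partial>cellm T) \<in> borel_measurable borel"
proof -
  interpret P: pair_sigma_finite "cellm T" "ubm :: spacetime measure" ..
  interpret Q: finite_measure "cellm T \<Otimes>\<^sub>M (ubm :: spacetime measure)"
    by (rule finite_measure_pair_measure[OF finite_measure_ubm finite_measure_cellm])
  have "sets (cellm T \<Otimes>\<^sub>M (ubm :: spacetime measure)) = sets (borel \<Otimes>\<^sub>M borel)"
    by (rule sets_pair_measure_cong) auto
  then have s: "sets (cellm T \<Otimes>\<^sub>M (ubm :: spacetime measure)) = sets borel"
    by (simp only: borel_prod)
  have m: "case_prod f \<in> borel_measurable (cellm T \<Otimes>\<^sub>M ubm)"
    using f measurable_cong_sets[OF s refl] by blast
  have "integrable (cellm T \<Otimes>\<^sub>M ubm) (case_prod f)"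
    by (rule bounded_borel_integrable[OF Q.finite_measure_axioms s f, of B]) (use B in auto)
  then show "(\<integral>p. (\<integral>z. f p z \<partial>ubm) \<partial>cellm T) = (\<integral>z. (\<integral>p. f p z \<partial>cellm T) \<partial>ubm)"
    by (rule P.Fubini_integral[symmetric])
  have "(\<lambda>p. \<integral>z. f p z \<partial>ubm) \<in> borel_measurable (cellm T)"
    using ubm.borel_measurable_lebesgue_integral[OF m] by simp
  then show "(\<lambda>p. \<integral>z. f p z \<partial>ubm) \<in> borel_measurable borel"
    using measurable_cong_sets[OF sets_cellm refl] by blast
  have m': "case_prod (\<lambda>z p. f p z) \<in> borel_measurable (ubm \<Otimes>\<^sub>M cellm T)"
    using measurable_pair_swap[OF m] by (simp add: case_prod_beta')
  have "(\<lambda>z. \<integral>p. f p z \<partial>cellm T) \<in> borel_measurable ubm"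
    using cellm.borel_measurable_lebesgue_integral[OF m'] by simp
  then show "(\<lambda>z. \<integral>p. f p z \<partial>cellm T) \<in> borel_measurable borel"
    using measurable_cong_sets[OF sets_ubm refl] by blast
qed

text \<open>By translation invariance every difference quotient has integral zero; dominated convergence
passes this to the derivative.  No boundary terms and no iterated one-dimensional integrals appear.\<close>

lemma integral_derivative_zero:
  fixes h :: "spacetime \<Rightarrow> real"
  assumes per: "periodic h" and d: "\<And>p. (h has_derivative h' p) (at p)"
    and h'm [measurable]: "(\<lambda>p. h' p e) \<in> borel_measurable borel"
    and B: "\<And>p. \<bar>h p\<bar> \<le> B" and C: "\<And>p. \<bar>h' p e\<bar> \<le> C"
    and ab: "0 < a" "b < T" and supp: "\<And>p. h p \<noteq> 0 \<Longrightarrow> a \<le> fst p \<and> fst p \<le> b"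
  shows "(\<integral>p. h' p e \<partial>cellm T) = 0"
proof -
  have "continuous_on UNIV h"
    using d has_derivative_continuous by (blast intro: continuous_at_imp_continuous_on)
  then have [measurable]: "h \<in> borel_measurable borel"
    by (rule borel_measurable_continuous_onI)
  \<comment> \<open>Translates by less than \<open>d0\<close> times e keep the support inside the time interval.\<close>
  define d0 where "d0 = min a (T - b) / (\<bar>fst e\<bar> + 1)"
  have d0: "d0 > 0" using ab by (simp add: d0_def)
  have quot: "(\<integral>p. (h (p + r *\<^sub>R e) - h p) / r \<partial>cellm T) = 0" if r: "\<bar>r\<bar> < d0" for r
  proof -
    have i: "integrable (cellm T) h" "integrable (cellm T) (\<lambda>p. h (p + r *\<^sub>R e))"
      by (rule cellm_integrable[where B = B]; use B in auto)+
    have "\<bar>r\<bar> * \<bar>fst e\<bar> \<le> \<bar>r\<bar> * (\<bar>fst e\<bar> + 1)" by (simp add: mult_left_mono)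
    also have "\<dots> < min a (T - b)" using r by (simp add: d0_def pos_less_divide_eq)
    finally have "\<bar>r * fst e\<bar> < min a (T - b)" by (simp add: abs_mult)
    then have "(\<integral>p. h (p + r *\<^sub>R e) \<partial>cellm T) = integral\<^sup>L (cellm T) h"
      by (intro integral_cellm_translate[OF _ per B]) (use ab supp in \<open>fastforce+\<close>)
    then show ?thesis using i by simp
  qed
  define r where "r n = d0 / 2 * inverse (real (Suc n))" for n
  have r0: "0 < r n" "r n < d0" for n
  proof -
    show "0 < r n" using d0 by (simp add: r_def)
    have "inverse (real (Suc n)) \<le> 1" by (simp add: field_simps)
    then have "r n \<le> d0 / 2 * 1" unfolding r_def using d0 by (intro mult_left_mono) auto
    then show "r n < d0" using d0 by simp
  qed
  have rlim: "r \<longlonglongrightarrow> 0" unfolding r_def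
    by (rule tendsto_mult_right_zero[OF LIMSEQ_inverse_real_of_nat])
  have lim: "(\<lambda>n. \<integral>p. (h (p + r n *\<^sub>R e) - h p) / r n \<partial>cellm T) \<longlonglongrightarrow> (\<integral>p. h' p e \<partial>cellm T)"
  proof (rule integral_dominated_convergence[where w = "\<lambda>p. C"])
    show "AE p in cellm T. (\<lambda>n. (h (p + r n *\<^sub>R e) - h p) / r n) \<longlonglongrightarrow> h' p e"
    proof (rule AE_I2)
      fix p
      have "((\<lambda>r. h (p + r *\<^sub>R e)) has_derivative (\<lambda>s. h' p (s *\<^sub>R e))) (at 0)"
        by (rule has_derivative_compose[of "\<lambda>r. p + r *\<^sub>R e" "\<lambda>s. s *\<^sub>R e" 0 UNIV h "h' p"])
          (use d[of p] in \<open>auto intro!: derivative_eq_intros\<close>)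
      moreover have "h' p (s *\<^sub>R e) = h' p e * s" for s
        using linear_cmul[OF has_derivative_linear[OF d]] by simp
      ultimately have "((\<lambda>r. h (p + r *\<^sub>R e)) has_real_derivative h' p e) (at 0)"
        by (simp add: has_field_derivative_def)
      then have "((\<lambda>s. (h (p + s *\<^sub>R e) - h p) / s) \<longlongrightarrow> h' p e) (at 0)"
        by (simp add: DERIV_def)
      then show "(\<lambda>n. (h (p + r n *\<^sub>R e) - h p) / r n) \<longlonglongrightarrow> h' p e"
        by (rule filterlim_compose) (use rlim r0 in \<open>auto simp: filterlim_at less_imp_neq[OF r0(1), symmetric]\<close>)
    qed
    show "AE p in cellm T. norm ((h (p + r n *\<^sub>R e) - h p) / r n) \<le> C" for n
    proof (rule AE_I2)
      fix p
      have "norm (h (p + r n *\<^sub>R e) - h (p + 0 *\<^sub>R e)) \<le> C * norm (r n - 0)"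
      proof (rule differentiable_bound[of UNIV "\<lambda>r. h (p + r *\<^sub>R e)" "\<lambda>r s. h' (p + r *\<^sub>R e) (s *\<^sub>R e)"])
        fix x
        show "((\<lambda>r. h (p + r *\<^sub>R e)) has_derivative (\<lambda>s. h' (p + x *\<^sub>R e) (s *\<^sub>R e))) (at x within UNIV)"
          by (rule has_derivative_compose[of "\<lambda>r. p + r *\<^sub>R e" "\<lambda>s. s *\<^sub>R e" x UNIV h "h' (p + x *\<^sub>R e)"])
            (use d in \<open>auto intro!: derivative_eq_intros\<close>)
        show "onorm (\<lambda>s. h' (p + x *\<^sub>R e) (s *\<^sub>R e)) \<le> C"
        proof (rule onorm_le)
          fix s :: real
          have "norm (h' (p + x *\<^sub>R e) (s *\<^sub>R e)) = norm s * \<bar>h' (p + x *\<^sub>R e) e\<bar>"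
            using linear_cmul[OF has_derivative_linear[OF d]] by (simp add: abs_mult)
          also have "\<dots> \<le> norm s * C" by (intro mult_left_mono C) simp
          finally show "norm (h' (p + x *\<^sub>R e) (s *\<^sub>R e)) \<le> C * norm s" by (simp add: mult.commute)
        qed
      qed auto
      then show "norm ((h (p + r n *\<^sub>R e) - h p) / r n) \<le> C"
        using r0(1)[of n] by (simp add: divide_le_eq)
    qed
  qed (auto intro!: cellm_integrable)
  have "(\<lambda>n. 0) \<longlonglongrightarrow> (\<integral>p. h' p e \<partial>cellm T)"
    using lim by (subst (asm) quot) (use r0 in \<open>simp_all add: abs_of_pos\<close>)
  then show ?thesis by (simp add: LIMSEQ_const_iff)
qed

lemma moll_periodic: "periodic g \<Longrightarrow> periodic (moll k s g)"
proof -
  assume "periodic g"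
  then have "g (p + (0, l) + s *\<^sub>R z) = g (p + s *\<^sub>R z)" if "lattice_vec l" for p l z
    using periodic_shift[of g "s *\<^sub>R z"] that unfolding periodic_def by blast
  then show ?thesis by (simp add: periodic_def moll_def)
qed

lemma ubm_AE_ball: "AE z in ubm. norm z < 1"
  by (simp add: AE_ubm)

lemma moll_support:
  assumes supp: "\<And>p. \<Psi> p \<noteq> 0 \<Longrightarrow> a \<le> fst p \<and> fst p \<le> b"
    and nz: "moll k s \<Psi> p \<noteq> (0::real)"
  shows "a - \<bar>s\<bar> \<le> fst p \<and> fst p \<le> b + \<bar>s\<bar>"
proof (rule ccontr)
  assume n: "\<not> ?thesis"
  have "k z *\<^sub>R \<Psi> (p + s *\<^sub>R z) = 0" if z: "norm z < 1" for z
  proof -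
    have "\<bar>s * fst z\<bar> \<le> \<bar>s\<bar>"
      using norm_fst_le[of "fst z" "snd z"] z by (auto simp: abs_mult intro!: mult_left_le)
    then have "\<Psi> (p + s *\<^sub>R z) = 0"
      using n supp[of "p + s *\<^sub>R z"] by (cases "\<Psi> (p + s *\<^sub>R z) = 0") (simp_all, linarith)
    then show ?thesis by simp
  qed
  then have "AE z in ubm. k z *\<^sub>R \<Psi> (p + s *\<^sub>R z) = 0"
    by (intro eventually_mono[OF ubm_AE_ball])
  then have "moll k s \<Psi> p = 0"
    unfolding moll_def by (rule integral_eq_zero_AE)
  with nz show False by simp
qed

text \<open>Fubini, and translation of the inner integral by s z.  The time margin keeps the translated
support inside (0,T).\<close>

lemma moll_duality:
  fixes g \<Psi> :: "spacetime \<Rightarrow> real"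
  assumes k: "kernel k" and g [measurable]: "g \<in> borel_measurable borel" and Bg: "\<And>p. \<bar>g p\<bar> \<le> B"
    and Psi [measurable]: "\<Psi> \<in> borel_measurable borel" and BPsi: "\<And>p. \<bar>\<Psi> p\<bar> \<le> B'"
    and per: "periodic g" "periodic \<Psi>"
    and supp: "\<And>p. \<Psi> p \<noteq> 0 \<Longrightarrow> a \<le> fst p \<and> fst p \<le> b"
    and s: "\<bar>s\<bar> < a" "b + \<bar>s\<bar> < T"
  shows "(\<integral>p. g p * moll k (- s) \<Psi> p \<partial>cellm T) = (\<integral>p. moll k s g p * \<Psi> p \<partial>cellm T)"
proof -
  note kernel_measurable[OF k, measurable]
  obtain C where C: "\<And>z. \<bar>k z\<bar> \<le> C" using kernel_bound[OF k] by blast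
  have bd: "\<bar>k z * (g p * \<Psi> q)\<bar> \<le> C * (B * B')" for z p q
  proof -
    have "\<bar>g p * \<Psi> q\<bar> \<le> B * B'"
      unfolding abs_mult using Bg BPsi order_trans[OF abs_ge_zero Bg] by (intro mult_mono) auto
    then show ?thesis
      unfolding abs_mult[of "k z"] using C order_trans[OF abs_ge_zero C] by (intro mult_mono) auto
  qed
  have "(\<integral>p. g p * moll k (- s) \<Psi> p \<partial>cellm T) = (\<integral>p. (\<integral>z. k z * (g p * \<Psi> (p - s *\<^sub>R z)) \<partial>ubm) \<partial>cellm T)"
  proof (rule Bochner_Integration.integral_cong[OF refl])
    fix p
    have "g p * moll k (- s) \<Psi> p = (\<integral>z. g p * (k z * \<Psi> (p - s *\<^sub>R z)) \<partial>ubm)"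
      by (simp add: moll_def)
    then show "g p * moll k (- s) \<Psi> p = (\<integral>z. k z * (g p * \<Psi> (p - s *\<^sub>R z)) \<partial>ubm)"
      by (simp add: mult_ac)
  qed
  also have "\<dots> = (\<integral>z. (\<integral>p. k z * (g p * \<Psi> (p - s *\<^sub>R z)) \<partial>cellm T) \<partial>ubm)"
    by (rule integral_swap(1)[where B = "C * (B * B')"]) (use bd in \<open>auto simp: split_beta'\<close>)
  also have "\<dots> = (\<integral>z. (\<integral>p. k z * (g (p + s *\<^sub>R z) * \<Psi> p) \<partial>cellm T) \<partial>ubm)"
  proof (rule integral_cong_AE)
    show "AE z in ubm. (\<integral>p. k z * (g p * \<Psi> (p - s *\<^sub>R z)) \<partial>cellm T) = (\<integral>p. k z * (g (p + s *\<^sub>R z) * \<Psi> p) \<partial>cellm T)"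
      using ubm_AE_ball
    proof eventually_elim
      fix z :: spacetime assume z: "norm z < 1"
      have sz: "\<bar>s * fst z\<bar> \<le> \<bar>s\<bar>"
        using norm_fst_le[of "fst z" "snd z"] z by (auto simp: abs_mult intro!: mult_left_le)
      have "(\<integral>p. k z * (g ((p + s *\<^sub>R z)) * \<Psi> ((p + s *\<^sub>R z) - s *\<^sub>R z)) \<partial>cellm T)
          = (\<integral>p. k z * (g p * \<Psi> (p - s *\<^sub>R z)) \<partial>cellm T)"
      proof (rule integral_cellm_translate[where B = "C * (B * B')"])
        show "periodic (\<lambda>p. k z * (g p * \<Psi> (p - s *\<^sub>R z)))"
          using per(1) periodic_shift[OF per(2), of "- (s *\<^sub>R z)"] by (simp add: periodic_def)
        show "fst p \<in> {0<..<T} \<and> fst p - fst (s *\<^sub>R z) \<in> {0<..<T}"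
          if "k z * (g p * \<Psi> (p - s *\<^sub>R z)) \<noteq> 0" for p
        proof -
          have "\<Psi> (p - s *\<^sub>R z) \<noteq> 0" using that by auto
          from supp[OF this] show ?thesis using sz s by auto
        qed
      qed (use bd in auto)
      then show "(\<integral>p. k z * (g p * \<Psi> (p - s *\<^sub>R z)) \<partial>cellm T) = (\<integral>p. k z * (g (p + s *\<^sub>R z) * \<Psi> p) \<partial>cellm T)"
        unfolding add_diff_cancel_right' by (rule sym)
    qed
    show "(\<lambda>z. \<integral>p. k z * (g p * \<Psi> (p - s *\<^sub>R z)) \<partial>cellm T) \<in> borel_measurable ubm"
      using integral_swap(3)[where f = "\<lambda>p z. k z * (g p * \<Psi> (p - s *\<^sub>R z))" and B = "C * (B * B')"] bd
      by (simp add: split_beta' measurable_cong_sets[OF sets_ubm refl])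
    show "(\<lambda>z. \<integral>p. k z * (g (p + s *\<^sub>R z) * \<Psi> p) \<partial>cellm T) \<in> borel_measurable ubm"
      using integral_swap(3)[where f = "\<lambda>p z. k z * (g (p + s *\<^sub>R z) * \<Psi> p)" and B = "C * (B * B')"] bd
      by (simp add: split_beta' measurable_cong_sets[OF sets_ubm refl])
  qed
  also have "\<dots> = (\<integral>p. (\<integral>z. k z * (g (p + s *\<^sub>R z) * \<Psi> p) \<partial>ubm) \<partial>cellm T)"
    by (rule integral_swap(1)[where B = "C * (B * B')", symmetric]) (use bd in \<open>auto simp: split_beta'\<close>)
  also have "\<dots> = (\<integral>p. moll k s g p * \<Psi> p \<partial>cellm T)"
    by (simp add: moll_def mult.assoc[symmetric])
  finally show ?thesis .
qed

section \<open>The energy balance for regularised data\<close>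

text \<open>An algebra of functions that are integrable for every finite Borel measure; it discharges all
integrability and measurability side conditions below.\<close>

definition bounded_borel :: "('a::topological_space \<Rightarrow> real) \<Rightarrow> bool" where
  "bounded_borel f \<longleftrightarrow> f \<in> borel_measurable borel \<and> (\<exists>B. \<forall>p. \<bar>f p\<bar> \<le> B)"

lemma bounded_borelI: "f \<in> borel_measurable borel \<Longrightarrow> (\<And>p. \<bar>f p\<bar> \<le> B) \<Longrightarrow> bounded_borel f"
  by (auto simp: bounded_borel_def)

lemma bounded_borel_const: "bounded_borel (\<lambda>p. c)"
  by (rule bounded_borelI[where B = "\<bar>c\<bar>"]) auto

lemma bounded_borel_add: "bounded_borel f \<Longrightarrow> bounded_borel g \<Longrightarrow> bounded_borel (\<lambda>p. f p + g p)"
  unfolding bounded_borel_def by (auto intro: order_trans[OF abs_triangle_ineq add_mono])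

lemma bounded_borel_mult: "bounded_borel f \<Longrightarrow> bounded_borel g \<Longrightarrow> bounded_borel (\<lambda>p. f p * g p)"
  unfolding bounded_borel_def
  by (auto simp: abs_mult intro: mult_mono[OF _ _ order_trans[OF abs_ge_zero] abs_ge_zero])

lemma bounded_borel_minus: "bounded_borel f \<Longrightarrow> bounded_borel (\<lambda>p. - f p)"
  unfolding bounded_borel_def by auto

lemma bounded_borel_diff: "bounded_borel f \<Longrightarrow> bounded_borel g \<Longrightarrow> bounded_borel (\<lambda>p. f p - g p)"
  using bounded_borel_add[OF _ bounded_borel_minus, of f g] by simp

lemma bounded_borel_power: "bounded_borel f \<Longrightarrow> bounded_borel (\<lambda>p. f p ^ n)"
  by (induction n) (auto intro: bounded_borel_const bounded_borel_mult)

lemma bounded_borel_sum: "(\<And>i. i \<in> I \<Longrightarrow> bounded_borel (f i)) \<Longrightarrow> bounded_borel (\<lambda>p. \<Sum>i\<in>I. f i p)"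
  by (induction I rule: infinite_finite_induct) (auto intro: bounded_borel_const bounded_borel_add)

lemma bounded_borel_abs: "bounded_borel f \<Longrightarrow> bounded_borel (\<lambda>p. \<bar>f p\<bar>)"
  unfolding bounded_borel_def by auto

lemma bounded_borel_divide: "bounded_borel f \<Longrightarrow> bounded_borel (\<lambda>p. f p / c)"
  using bounded_borel_mult[OF _ bounded_borel_const[of "inverse c"], of f] by (simp add: divide_inverse)

lemma bounded_borel_indicator: "A \<in> sets borel \<Longrightarrow> bounded_borel (\<lambda>p. indicator A p)"
  by (rule bounded_borelI[where B = 1]) (auto simp: indicator_def)

lemmas bounded_borel_intros = bounded_borel_const bounded_borel_add bounded_borel_mult bounded_borel_minus
  bounded_borel_diff bounded_borel_power bounded_borel_sum bounded_borel_abs bounded_borel_divide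
  bounded_borel_indicator

lemma bounded_borel_integrable_cellm: "bounded_borel f \<Longrightarrow> integrable (cellm T) f"
  unfolding bounded_borel_def by (metis cellm_integrable real_norm_def)

lemma bounded_borel_integrable_ubm:
  fixes f :: "'a::euclidean_space \<Rightarrow> real" shows "bounded_borel f \<Longrightarrow> integrable ubm f"
  unfolding bounded_borel_def by (metis ubm_integrable real_norm_def)

lemma moll_const:
  "(\<integral>z. k z \<partial>ubm) = m \<Longrightarrow> kernel k \<Longrightarrow> moll k s (\<lambda>q. c) p = m *\<^sub>R c"
  unfolding moll_def
  using moll_integrable[of k "\<lambda>q. 1::real" 1 0 0] by (auto simp: integral_scaleR_left)

lemma moll_diff:
  assumes "kernel k" "f \<in> borel_measurable borel" "\<And>q. norm (f q) \<le> A"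
    "g \<in> borel_measurable borel" "\<And>q. norm (g q) \<le> B"
  shows "moll k s (\<lambda>q. f q - g q) p = moll k s f p - moll k s g p"
  unfolding moll_def scaleR_diff_right
  by (intro Bochner_Integration.integral_diff moll_integrable[OF assms(1,2,3)] moll_integrable[OF assms(1,4,5)])

lemma moll_bounded_linear:
  assumes "kernel k" "g \<in> borel_measurable borel" "\<And>q. norm (g q) \<le> B" and L: "bounded_linear L"
  shows "moll k s (\<lambda>q. L (g q)) p = L (moll k s g p)"
proof -
  interpret L: bounded_linear L by fact
  have "L (moll k s g p) = (\<integral>z. L (k z *\<^sub>R g (p + s *\<^sub>R z)) \<partial>ubm)"
    unfolding moll_def by (rule integral_bounded_linear[OF L moll_integrable[OF assms(1,2,3)], symmetric])
  then show ?thesis by (simp add: moll_def L.scaleR)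
qed

lemma moll_norm_le:
  assumes k: "kernel k" and c: "\<And>z. \<bar>k z\<bar> \<le> c" and g: "g \<in> borel_measurable borel" "\<And>q. norm (g q) \<le> B"
    and h: "integrable ubm h" "\<And>z. norm (g (p + s *\<^sub>R z)) \<le> h z"
  shows "norm (moll k s g p) \<le> c * (\<integral>z. h z \<partial>ubm)"
proof -
  have "norm (moll k s g p) \<le> (\<integral>z. norm (k z *\<^sub>R g (p + s *\<^sub>R z)) \<partial>ubm)"
    unfolding moll_def by (rule integral_norm_bound)
  also have "\<dots> \<le> (\<integral>z. c * h z \<partial>ubm)"
  proof (rule integral_mono)
    show "integrable ubm (\<lambda>z. norm (k z *\<^sub>R g (p + s *\<^sub>R z)))"
      by (rule integrable_norm[OF moll_integrable[OF k g]])
    show "norm (k z *\<^sub>R g (p + s *\<^sub>R z)) \<le> c * h z" for z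
      unfolding norm_scaleR real_norm_def
      by (rule mult_mono[OF c h(2)]) (use order_trans[OF abs_ge_zero c] in auto)
  qed (use h in auto)
  finally show ?thesis by simp
qed

lemma moll_bounded_borel:
  fixes g :: "'a::euclidean_space \<Rightarrow> real"
  assumes k: "kernel k" and s: "s \<noteq> 0" and g: "bounded_borel g"
  shows "bounded_borel (moll k s g)"
proof -
  obtain c where c: "\<And>z. \<bar>k z\<bar> \<le> c" using kernel_bound[OF k] by blast
  obtain B where B: "\<And>p. norm (g p) \<le> B" and [measurable]: "g \<in> borel_measurable borel"
    using g by (auto simp: bounded_borel_def)
  have "norm (moll k s g p) \<le> c * (\<integral>z. B \<partial>(ubm :: 'a measure))" for p
    by (rule moll_norm_le[OF k c _ B]) (use B in auto)
  then show ?thesis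
    using moll_measurable[OF k _ B s] by (intro bounded_borelI) auto
qed

abbreviation window :: "real \<Rightarrow> real \<Rightarrow> spacetime set" where
  "window a b \<equiv> {p. a \<le> fst p \<and> fst p \<le> b}"

lemma window_closed: "closed (window a b)"
  by (intro closed_Collect_conj closed_Collect_le continuous_intros)

lemma window_borel [measurable]: "window a b \<in> sets borel"
  using window_closed by (rule borel_closed)

abbreviation cubic_increment ::
    "real \<Rightarrow> real \<Rightarrow> real \<Rightarrow> (spacetime \<Rightarrow> 'b::real_normed_vector) \<Rightarrow> spacetime \<Rightarrow> real" where
  "cubic_increment T a b g \<xi> \<equiv> \<integral>p. indicator (window a b) p * norm (g (p + \<xi>) - g p) ^ 3 \<partial>cellm T"

definition periodic_test :: "real \<Rightarrow> (spacetime \<Rightarrow> real) \<Rightarrow> bool" where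
  "periodic_test T \<phi> \<longleftrightarrow> periodic \<phi> \<and> smooth_on UNIV \<phi> \<and>
     (\<exists>a b. 0 < a \<and> b < T \<and> (\<forall>p. \<phi> p \<noteq> 0 \<longrightarrow> p \<in> window a b))"

definition directions :: "spacetime set" where
  "directions = insert dt (range dx)"

text \<open>The situation after all reductions: F and v are bounded, Borel and periodic everywhere, and the
energy density W is defined on all matrices, with gradient G and second-order data DG.  One constant
L serves as bound, Lipschitz constant, Taylor constant and Besov constant throughout.  The weight
\<psi> is the test function of the energy equation; \<delta> is the margin in time that lets everything
be mollified at scales below \<delta>.\<close>

locale elastic_flow =
  fixes T a b \<delta> \<alpha> L :: real
    and F :: "spacetime \<Rightarrow> mat3" and v :: "spacetime \<Rightarrow> vec3"
    and W :: "mat3 \<Rightarrow> real" and G :: "3 \<Rightarrow> 3 \<Rightarrow> mat3 \<Rightarrow> real" and DG :: "3 \<Rightarrow> 3 \<Rightarrow> mat3 \<Rightarrow> mat3 \<Rightarrow> real"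
    and \<psi> :: "spacetime \<Rightarrow> real" and D\<psi> :: "spacetime \<Rightarrow> spacetime \<Rightarrow> real"
    and \<rho> :: "spacetime \<Rightarrow> real"
  assumes \<delta>: "0 < \<delta>" "\<delta> < a" "b + \<delta> < T"
    and \<alpha>: "1 / 3 < \<alpha>"
    and F: "F \<in> borel_measurable borel" "periodic F" "\<And>p. norm (F p) \<le> L"
    and v: "v \<in> borel_measurable borel" "periodic v" "\<And>p. norm (v p) \<le> L"
    and besov: "\<And>\<xi>. norm \<xi> < \<delta> \<Longrightarrow>
        cubic_increment T a b F \<xi> \<le> L * norm \<xi> powr (3 * \<alpha>)"
      "\<And>\<xi>. norm \<xi> < \<delta> \<Longrightarrow>
        cubic_increment T a b v \<xi> \<le> L * norm \<xi> powr (3 * \<alpha>)"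
    and W: "\<And>A. (W has_derivative (\<lambda>H. \<Sum>i\<in>UNIV. \<Sum>j\<in>UNIV. G i j A * H $ i $ j)) (at A)"
      "\<And>A. \<bar>W A\<bar> \<le> L" "\<And>A B. \<bar>W A - W B\<bar> \<le> L * norm (A - B)"
    and G: "\<And>i j A. \<bar>G i j A\<bar> \<le> L" "\<And>i j A B. \<bar>G i j A - G i j B\<bar> \<le> L * norm (A - B)"
    and DG: "\<And>i j A. bounded_linear (DG i j A)"
      "\<And>i j A B. \<bar>G i j A - G i j B - DG i j B (A - B)\<bar> \<le> L * (norm (A - B))\<^sup>2"
    and \<psi>: "\<And>p. (\<psi> has_derivative (\<lambda>e. D\<psi> p e)) (at p)" "periodic \<psi>" "\<And>p. \<bar>\<psi> p\<bar> \<le> L"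
      "\<And>p. \<psi> p \<noteq> 0 \<Longrightarrow> p \<in> window a b"
    and D\<psi>: "\<And>e. (\<lambda>p. D\<psi> p e) \<in> borel_measurable borel" "\<And>e p. e \<in> directions \<Longrightarrow> \<bar>D\<psi> p e\<bar> \<le> L"
      "\<And>e p. D\<psi> p e \<noteq> 0 \<Longrightarrow> p \<in> window a b"
    and \<rho>: "kernel \<rho>" "\<And>z. \<bar>\<rho> z\<bar> \<le> L" "(\<integral>z. \<rho> z \<partial>ubm) = 1"
      "\<And>e z. e \<in> directions \<Longrightarrow> \<bar>dker \<rho> 1 e z\<bar> \<le> L"
    and weak_F: "\<And>i j \<phi>. periodic_test T \<phi> \<Longrightarrow>
        (\<integral>p. F p $ i $ j * frechet_derivative \<phi> (at p) dt \<partial>cellm T) =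
        (\<integral>p. v p $ j * frechet_derivative \<phi> (at p) (dx i) \<partial>cellm T)"
    and weak_v: "\<And>j \<phi>. periodic_test T \<phi> \<Longrightarrow>
        (\<integral>p. v p $ j * frechet_derivative \<phi> (at p) dt \<partial>cellm T) =
        (\<Sum>i\<in>UNIV. \<integral>p. G i j (F p) * frechet_derivative \<phi> (at p) (dx i) \<partial>cellm T)"
begin

abbreviation E :: "spacetime \<Rightarrow> real" where
  "E p \<equiv> W (F p) + (\<Sum>j\<in>UNIV. v p $ j * v p $ j) / 2"

lemma L0: "0 \<le> L"
  using W(2) abs_ge_zero order_trans by blast

lemma G_measurable [measurable]: "G i j \<in> borel_measurable borel"
proof -
  have "L-lipschitz_on UNIV (G i j)"
    using G(2) L0 by (intro lipschitz_onI) (auto simp: dist_norm)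
  then show ?thesis
    by (intro borel_measurable_continuous_onI lipschitz_on_continuous_on)
qed

lemma W_measurable [measurable]: "W \<in> borel_measurable borel"
  using W(1) by (intro borel_measurable_continuous_onI continuous_at_imp_continuous_on)
    (auto intro: has_derivative_continuous)

lemmas [measurable] = F(1) v(1) D\<psi>(1)

lemma F_comp: "bounded_borel (\<lambda>p. F p $ i $ j)"
proof (rule bounded_borelI[where B = L])
  show "(\<lambda>p. F p $ i $ j) \<in> borel_measurable borel"
    by (rule measurable_compose[OF F(1), of "\<lambda>A. A $ i $ j"])
      (intro borel_measurable_continuous_onI continuous_intros)
  show "\<bar>F p $ i $ j\<bar> \<le> L" for p
    using Finite_Cartesian_Product.norm_nth_le[of "F p $ i" j] Finite_Cartesian_Product.norm_nth_le[of "F p" i] F(3)[of p] by simp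
qed

lemma v_comp: "bounded_borel (\<lambda>p. v p $ j)"
proof (rule bounded_borelI[where B = L])
  show "(\<lambda>p. v p $ j) \<in> borel_measurable borel"
    by (rule measurable_compose[OF v(1), of "\<lambda>A. A $ j"])
      (intro borel_measurable_continuous_onI continuous_intros)
  show "\<bar>v p $ j\<bar> \<le> L" for p
    using Finite_Cartesian_Product.norm_nth_le[of "v p" j] v(3)[of p] by simp
qed

lemma GF_bounded: "bounded_borel (\<lambda>p. G i j (F p))"
  by (rule bounded_borelI[where B = L]) (auto simp: G(1))

lemma \<psi>_continuous: "continuous_on UNIV \<psi>"
  using \<psi>(1) by (intro continuous_at_imp_continuous_on) (auto intro: has_derivative_continuous)

lemma \<psi>_bounded: "bounded_borel \<psi>"
  using borel_measurable_continuous_onI[OF \<psi>_continuous] \<psi>(3) by (rule bounded_borelI)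

lemma D\<psi>_bounded: "e \<in> directions \<Longrightarrow> bounded_borel (\<lambda>p. D\<psi> p e)"
  using D\<psi> by (intro bounded_borelI)

context
  fixes \<epsilon> :: real
  assumes \<epsilon>: "0 < \<epsilon>" "\<epsilon> < \<delta>"
begin

definition D :: "spacetime \<Rightarrow> (spacetime \<Rightarrow> 'b::euclidean_space) \<Rightarrow> spacetime \<Rightarrow> 'b" where
  "D e g = moll (dker \<rho> \<epsilon> e) \<epsilon> g"

abbreviation F\<^sub>\<epsilon> where "F\<^sub>\<epsilon> \<equiv> moll \<rho> \<epsilon> F"
abbreviation v\<^sub>\<epsilon> where "v\<^sub>\<epsilon> \<equiv> moll \<rho> \<epsilon> v"
abbreviation E\<^sub>\<epsilon> where "E\<^sub>\<epsilon> p \<equiv> W (F\<^sub>\<epsilon> p) + (\<Sum>j\<in>UNIV. v\<^sub>\<epsilon> p $ j * v\<^sub>\<epsilon> p $ j) / 2"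
abbreviation G\<^sub>\<epsilon> where "G\<^sub>\<epsilon> i j \<equiv> moll \<rho> \<epsilon> (\<lambda>p. G i j (F p))"

lemma moll_test:
  assumes Psi: "bounded_borel \<Psi>" "periodic \<Psi>" "\<And>p. \<Psi> p \<noteq> 0 \<Longrightarrow> p \<in> window a b"
  shows "periodic_test T (moll \<rho> (- \<epsilon>) \<Psi>)"
  unfolding periodic_test_def
proof (intro conjI exI allI impI)
  obtain B where "\<And>p. norm (\<Psi> p) \<le> B" "\<Psi> \<in> borel_measurable borel"
    using Psi(1) by (auto simp: bounded_borel_def)
  then show "smooth_on UNIV (moll \<rho> (- \<epsilon>) \<Psi>)"
    unfolding smooth_on_def using moll_smooth[of \<Psi> B "- \<epsilon>" \<rho>] \<rho>(1) \<epsilon> by auto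
  show "moll \<rho> (- \<epsilon>) \<Psi> p \<noteq> 0 \<Longrightarrow> p \<in> window (a - \<epsilon>) (b + \<epsilon>)" for p
    using moll_support[of \<Psi> a b \<rho> "- \<epsilon>" p] Psi(3) \<epsilon> by auto
qed (use moll_periodic[OF Psi(2)] \<epsilon> \<delta> in auto)

text \<open>Testing an equation with a mollified function is testing the mollified equation.  As \<Psi> may be
any bounded Borel function, nonlinear expressions in the mollified fields are admissible tests.\<close>

lemma weak_transfer:
  assumes g: "bounded_borel g" "periodic g"
    and Psi: "bounded_borel \<Psi>" "periodic \<Psi>" "\<And>p. \<Psi> p \<noteq> 0 \<Longrightarrow> p \<in> window a b"
  shows "(\<integral>p. g p * frechet_derivative (moll \<rho> (- \<epsilon>) \<Psi>) (at p) e \<partial>cellm T)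
       = - (\<integral>p. D e g p * \<Psi> p \<partial>cellm T)"
proof -
  obtain B where B: "\<And>p. norm (\<Psi> p) \<le> B" "\<Psi> \<in> borel_measurable borel"
    using Psi(1) by (auto simp: bounded_borel_def)
  obtain Bg where Bg: "\<And>p. norm (g p) \<le> Bg" "g \<in> borel_measurable borel"
    using g(1) by (auto simp: bounded_borel_def)
  have k: "kernel (dker \<rho> (- \<epsilon>) e)" by (rule kernel_dker[OF \<rho>(1)])
  have hd: "(moll \<rho> (- \<epsilon>) \<Psi> has_derivative (\<lambda>e. moll (dker \<rho> (- \<epsilon>) e) (- \<epsilon>) \<Psi> p)) (at p)" for p
    by (rule moll_has_derivative[OF \<rho>(1) B(2,1)]) (use \<epsilon> in simp)
  have "frechet_derivative (moll \<rho> (- \<epsilon>) \<Psi>) (at p) e = moll (dker \<rho> (- \<epsilon>) e) (- \<epsilon>) \<Psi> p" for p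
    using fun_cong[OF frechet_derivative_at[OF hd[of p]], of e] by simp
  then have "(\<integral>p. g p * frechet_derivative (moll \<rho> (- \<epsilon>) \<Psi>) (at p) e \<partial>cellm T)
      = (\<integral>p. g p * moll (dker \<rho> (- \<epsilon>) e) (- \<epsilon>) \<Psi> p \<partial>cellm T)"
    by (simp only:)
  also have "\<dots> = (\<integral>p. moll (dker \<rho> (- \<epsilon>) e) \<epsilon> g p * \<Psi> p \<partial>cellm T)"
    by (rule moll_duality[OF k, where B = Bg and B' = B and a = a and b = b])
      (use B Bg g Psi \<epsilon> \<delta> in auto)
  also have "\<dots> = (\<integral>p. - (D e g p * \<Psi> p) \<partial>cellm T)"
    by (simp add: D_def moll_def dker_def)
  finally show ?thesis by simp
qed

lemma weak_F_moll:
  assumes Psi: "bounded_borel \<Psi>" "periodic \<Psi>" "\<And>p. \<Psi> p \<noteq> 0 \<Longrightarrow> p \<in> window a b"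
  shows "(\<integral>p. D dt (\<lambda>q. F q $ i $ j) p * \<Psi> p \<partial>cellm T) = (\<integral>p. D (dx i) (\<lambda>q. v q $ j) p * \<Psi> p \<partial>cellm T)"
proof -
  have "periodic (\<lambda>q. F q $ i $ j)" "periodic (\<lambda>q. v q $ j)"
    using F(2) v(2) by (simp_all add: periodic_def)
  note per = this
  show ?thesis
    using weak_F[OF moll_test[OF Psi], of i j]
      weak_transfer[OF F_comp per(1) Psi, of dt] weak_transfer[OF v_comp per(2) Psi, of "dx i"] by simp
qed

lemma weak_v_moll:
  assumes Psi: "bounded_borel \<Psi>" "periodic \<Psi>" "\<And>p. \<Psi> p \<noteq> 0 \<Longrightarrow> p \<in> window a b"
  shows "(\<integral>p. D dt (\<lambda>q. v q $ j) p * \<Psi> p \<partial>cellm T)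
       = (\<Sum>i\<in>UNIV. \<integral>p. D (dx i) (\<lambda>q. G i j (F q)) p * \<Psi> p \<partial>cellm T)"
proof -
  have "periodic (\<lambda>q. v q $ j)" "\<And>i. periodic (\<lambda>q. G i j (F q))"
    using F(2) v(2) by (simp_all add: periodic_def)
  note per = this
  show ?thesis
    using weak_v[OF moll_test[OF Psi], of j]
      weak_transfer[OF v_comp per(1) Psi, of dt] weak_transfer[OF GF_bounded per(2) Psi, of _ "dx _"]
    by (simp add: sum_negf)
qed

lemma \<epsilon>_nz: "\<epsilon> \<noteq> 0" using \<epsilon> by simp

lemma moll_bb: "bounded_borel g \<Longrightarrow> bounded_borel (moll \<rho> \<epsilon> g)"
  for g :: "spacetime \<Rightarrow> real"
  by (rule moll_bounded_borel[OF \<rho>(1) \<epsilon>_nz])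

lemma D_bb: "bounded_borel g \<Longrightarrow> bounded_borel (D e g)"
  for g :: "spacetime \<Rightarrow> real"
  unfolding D_def by (rule moll_bounded_borel[OF kernel_dker[OF \<rho>(1)] \<epsilon>_nz])

lemma DF_nth: "D e F p $ i $ j = D e (\<lambda>q. F q $ i $ j) p"
proof -
  have l: "bounded_linear (\<lambda>A::mat3. A $ i $ j)"
    by (intro bounded_linear_compose[OF bounded_linear_vec_nth bounded_linear_vec_nth])
  show ?thesis
    unfolding D_def by (rule moll_bounded_linear[OF kernel_dker[OF \<rho>(1)] F(1,3) l, symmetric])
qed

lemma v_moll_nth: "v\<^sub>\<epsilon> p $ j = moll \<rho> \<epsilon> (\<lambda>q. v q $ j) p"
  and Dv_nth: "D e v p $ j = D e (\<lambda>q. v q $ j) p"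
proof -
  show "v\<^sub>\<epsilon> p $ j = moll \<rho> \<epsilon> (\<lambda>q. v q $ j) p"
    by (rule moll_bounded_linear[OF \<rho>(1) v(1,3) bounded_linear_vec_nth, symmetric])
  show "D e v p $ j = D e (\<lambda>q. v q $ j) p"
    unfolding D_def by (rule moll_bounded_linear[OF kernel_dker[OF \<rho>(1)] v(1,3) bounded_linear_vec_nth, symmetric])
qed

lemma F_moll_measurable [measurable]: "F\<^sub>\<epsilon> \<in> borel_measurable borel"
  by (rule moll_measurable[OF \<rho>(1) F(1,3) \<epsilon>_nz])

lemma v_moll_measurable [measurable]: "v\<^sub>\<epsilon> \<in> borel_measurable borel"
  by (rule moll_measurable[OF \<rho>(1) v(1,3) \<epsilon>_nz])

lemma v_moll_bb: "bounded_borel (\<lambda>p. v\<^sub>\<epsilon> p $ j)"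
  unfolding v_moll_nth by (rule moll_bb[OF v_comp])

lemma GF_moll_bb: "bounded_borel (\<lambda>p. G i j (F\<^sub>\<epsilon> p))"
  by (rule bounded_borelI[where B = L]) (auto simp: G(1))

lemma WF_moll_bb: "bounded_borel (\<lambda>p. W (F\<^sub>\<epsilon> p))"
  by (rule bounded_borelI[where B = L]) (auto simp: W(2))

lemmas bb = bounded_borel_intros \<psi>_bounded D\<psi>_bounded v_moll_bb GF_moll_bb WF_moll_bb moll_bb D_bb
  F_comp v_comp GF_bounded

lemma deriv_moll:
  fixes g :: "spacetime \<Rightarrow> 'b::euclidean_space"
  assumes "g \<in> borel_measurable borel" "\<And>q. norm (g q) \<le> B"
  shows "(moll \<rho> \<epsilon> g has_derivative (\<lambda>e. D e g p)) (at p)"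
  unfolding D_def by (rule moll_has_derivative[OF \<rho>(1) assms \<epsilon>_nz])

lemma moll_periodic_F: "periodic F\<^sub>\<epsilon>" and moll_periodic_v: "periodic v\<^sub>\<epsilon>" and moll_periodic_G: "periodic (G\<^sub>\<epsilon> i j)"
  using moll_periodic[OF F(2)] moll_periodic[OF v(2)] moll_periodic[of "\<lambda>p. G i j (F p)"] F(2)
  by (auto simp: periodic_def)

lemma weighted_by_parts:
  assumes d: "\<And>p. (g has_derivative g' p) (at p)" and per: "periodic g"
    and g: "bounded_borel g" "bounded_borel (\<lambda>p. g' p e)" and e: "e \<in> directions"
  shows "(\<integral>p. D\<psi> p e * g p + \<psi> p * g' p e \<partial>cellm T) = 0"
proof -
  let ?h' = "\<lambda>p e. D\<psi> p e * g p + \<psi> p * g' p e"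
  have hb: "bounded_borel (\<lambda>p. \<psi> p * g p)" by (intro bb g)
  have h'b: "bounded_borel (\<lambda>p. ?h' p e)" by (intro bb g e)
  obtain B where B: "\<And>p. \<bar>\<psi> p * g p\<bar> \<le> B" using hb by (auto simp: bounded_borel_def)
  obtain C where C: "\<And>p. \<bar>?h' p e\<bar> \<le> C" using h'b by (auto simp: bounded_borel_def)
  show ?thesis
  proof (rule integral_derivative_zero[where h' = ?h' and h = "\<lambda>p. \<psi> p * g p" and B = B and C = C and a = a and b = b])
    show "periodic (\<lambda>p. \<psi> p * g p)"
      using \<psi>(2) per by (simp add: periodic_def)
    show "((\<lambda>p. \<psi> p * g p) has_derivative ?h' p) (at p)" for p
      by (rule has_derivative_eq_rhs[OF has_derivative_mult[OF \<psi>(1) d]]) (simp add: fun_eq_iff)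
    show "(\<lambda>p. ?h' p e) \<in> borel_measurable borel"
      using h'b by (simp add: bounded_borel_def)
    show "\<psi> p * g p \<noteq> 0 \<Longrightarrow> a \<le> fst p \<and> fst p \<le> b" for p using \<psi>(4)[of p] by auto
  qed (use B C \<delta> in auto)
qed

lemma deriv_v_nth: "((\<lambda>p. v\<^sub>\<epsilon> p $ j) has_derivative (\<lambda>e. D e (\<lambda>q. v q $ j) p)) (at p)"
  using bounded_linear.has_derivative[OF bounded_linear_vec_nth deriv_moll[OF v(1,3)], of j p]
  by (simp add: Dv_nth)

text \<open>The chain rule for W is used here and only here, at the smooth field \<open>F\<^sub>\<epsilon>\<close>.\<close>

lemma energy_by_parts:
  "(\<integral>p. D\<psi> p dt * E\<^sub>\<epsilon> p
     + \<psi> p * ((\<Sum>i\<in>UNIV. \<Sum>j\<in>UNIV. G i j (F\<^sub>\<epsilon> p) * D dt (\<lambda>q. F q $ i $ j) p)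
        + (\<Sum>j\<in>UNIV. v\<^sub>\<epsilon> p $ j * D dt (\<lambda>q. v q $ j) p)) \<partial>cellm T) = 0"
proof (rule weighted_by_parts[where g' = "\<lambda>p e. (\<Sum>i\<in>UNIV. \<Sum>j\<in>UNIV. G i j (F\<^sub>\<epsilon> p) * D e (\<lambda>q. F q $ i $ j) p)
        + (\<Sum>j\<in>UNIV. v\<^sub>\<epsilon> p $ j * D e (\<lambda>q. v q $ j) p)"])
  fix p
  have 1: "((\<lambda>p. W (F\<^sub>\<epsilon> p)) has_derivative (\<lambda>e. \<Sum>i\<in>UNIV. \<Sum>j\<in>UNIV. G i j (F\<^sub>\<epsilon> p) * D e (\<lambda>q. F q $ i $ j) p)) (at p)"
    using has_derivative_compose[OF deriv_moll[OF F(1,3)] W(1)] by (simp add: DF_nth)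
  have 2: "((\<lambda>p. (\<Sum>j\<in>UNIV. v\<^sub>\<epsilon> p $ j * v\<^sub>\<epsilon> p $ j) / 2) has_derivative
      (\<lambda>e. (\<Sum>j\<in>UNIV. v\<^sub>\<epsilon> p $ j * D e (\<lambda>q. v q $ j) p + D e (\<lambda>q. v q $ j) p * v\<^sub>\<epsilon> p $ j) / 2)) (at p)"
    by (intro bounded_linear.has_derivative[OF bounded_linear_divide] has_derivative_sum has_derivative_mult deriv_v_nth)
  have 3: "(\<lambda>e. (\<Sum>j\<in>UNIV. v\<^sub>\<epsilon> p $ j * D e (\<lambda>q. v q $ j) p + D e (\<lambda>q. v q $ j) p * v\<^sub>\<epsilon> p $ j) / 2)
      = (\<lambda>e. \<Sum>j\<in>UNIV. v\<^sub>\<epsilon> p $ j * D e (\<lambda>q. v q $ j) p)"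
    by (simp add: fun_eq_iff sum.distrib mult.commute sum_distrib_left)
  show "(E\<^sub>\<epsilon> has_derivative (\<lambda>e. (\<Sum>i\<in>UNIV. \<Sum>j\<in>UNIV. G i j (F\<^sub>\<epsilon> p) * D e (\<lambda>q. F q $ i $ j) p)
        + (\<Sum>j\<in>UNIV. v\<^sub>\<epsilon> p $ j * D e (\<lambda>q. v q $ j) p))) (at p)"
    by (rule has_derivative_add[OF 1 2[unfolded 3]])
qed (intro bb | use moll_periodic_F moll_periodic_v in \<open>simp add: periodic_def directions_def\<close>)+

text \<open>The derivative falls on the mollified stress \<open>G\<^sub>\<epsilon>\<close>, not on the stress G of the mollified
field, so no second derivative of W is needed for this identity.\<close>

lemma flux_by_parts:
  "(\<integral>p. D\<psi> p (dx i) * (G\<^sub>\<epsilon> i j p * v\<^sub>\<epsilon> p $ j)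
     + \<psi> p * (G\<^sub>\<epsilon> i j p * D (dx i) (\<lambda>q. v q $ j) p + D (dx i) (\<lambda>q. G i j (F q)) p * v\<^sub>\<epsilon> p $ j) \<partial>cellm T) = 0"
proof (rule weighted_by_parts[where g' = "\<lambda>p e. G\<^sub>\<epsilon> i j p * D e (\<lambda>q. v q $ j) p + D e (\<lambda>q. G i j (F q)) p * v\<^sub>\<epsilon> p $ j"])
  fix p
  have "(G\<^sub>\<epsilon> i j has_derivative (\<lambda>e. D e (\<lambda>q. G i j (F q)) p)) (at p)"
    by (rule deriv_moll[where B = L]) (auto simp: G(1))
  then show "((\<lambda>p. G\<^sub>\<epsilon> i j p * v\<^sub>\<epsilon> p $ j) has_derivative
      (\<lambda>e. G\<^sub>\<epsilon> i j p * D e (\<lambda>q. v q $ j) p + D e (\<lambda>q. G i j (F q)) p * v\<^sub>\<epsilon> p $ j)) (at p)"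
    by (rule has_derivative_mult[OF _ deriv_v_nth])
qed (intro bb | use moll_periodic_G moll_periodic_v in \<open>simp add: periodic_def directions_def\<close>)+

text \<open>The equation for F is tested with \<psi> times the stress at \<open>F\<^sub>\<epsilon>\<close>, the equation for v with \<psi>
times \<open>v\<^sub>\<epsilon>\<close>.  The two resulting fluxes would cancel if mollification commuted with G; what is
left is the commutator of the two.\<close>

lemma mollified_balance:
  "(\<integral>p. D\<psi> p dt * E\<^sub>\<epsilon> p \<partial>cellm T)
   - (\<Sum>i\<in>UNIV. \<Sum>j\<in>UNIV. \<integral>p. D\<psi> p (dx i) * (G\<^sub>\<epsilon> i j p * v\<^sub>\<epsilon> p $ j) \<partial>cellm T)
   = (\<Sum>i\<in>UNIV. \<Sum>j\<in>UNIV. \<integral>p. \<psi> p * ((G\<^sub>\<epsilon> i j p - G i j (F\<^sub>\<epsilon> p)) * D (dx i) (\<lambda>q. v q $ j) p) \<partial>cellm T)"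
proof -
  have dirs: "dt \<in> directions" "dx i \<in> directions" for i by (auto simp: directions_def)
  note int = bounded_borel_integrable_cellm[where T = T]
  let ?E = "\<integral>p. D\<psi> p dt * E\<^sub>\<epsilon> p \<partial>cellm T"
  let ?B = "\<lambda>i j. \<integral>p. D\<psi> p (dx i) * (G\<^sub>\<epsilon> i j p * v\<^sub>\<epsilon> p $ j) \<partial>cellm T"
  let ?C = "\<lambda>i j. \<integral>p. D (dx i) (\<lambda>q. v q $ j) p * (\<psi> p * G\<^sub>\<epsilon> i j p) \<partial>cellm T"
  let ?H = "\<lambda>i j. \<integral>p. D (dx i) (\<lambda>q. v q $ j) p * (\<psi> p * G i j (F\<^sub>\<epsilon> p)) \<partial>cellm T"
  let ?K = "\<lambda>i j. \<integral>p. D (dx i) (\<lambda>q. G i j (F q)) p * (\<psi> p * v\<^sub>\<epsilon> p $ j) \<partial>cellm T"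
  have "?E + ((\<Sum>i\<in>UNIV. \<Sum>j\<in>UNIV. \<integral>p. D dt (\<lambda>q. F q $ i $ j) p * (\<psi> p * G i j (F\<^sub>\<epsilon> p)) \<partial>cellm T)
      + (\<Sum>j\<in>UNIV. \<integral>p. D dt (\<lambda>q. v q $ j) p * (\<psi> p * v\<^sub>\<epsilon> p $ j) \<partial>cellm T))
    = (\<integral>p. D\<psi> p dt * E\<^sub>\<epsilon> p
      + ((\<Sum>i\<in>UNIV. \<Sum>j\<in>UNIV. D dt (\<lambda>q. F q $ i $ j) p * (\<psi> p * G i j (F\<^sub>\<epsilon> p)))
      + (\<Sum>j\<in>UNIV. D dt (\<lambda>q. v q $ j) p * (\<psi> p * v\<^sub>\<epsilon> p $ j))) \<partial>cellm T)"
    by (subst Bochner_Integration.integral_add Bochner_Integration.integral_sum; (intro int bb dirs)?)+ simp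
  also have "\<dots> = 0"
    unfolding energy_by_parts[symmetric]
    by (intro Bochner_Integration.integral_cong) (auto simp: sum_distrib_left distrib_left mult_ac)
  finally have 1: "?E + ((\<Sum>i\<in>UNIV. \<Sum>j\<in>UNIV. \<integral>p. D dt (\<lambda>q. F q $ i $ j) p * (\<psi> p * G i j (F\<^sub>\<epsilon> p)) \<partial>cellm T)
      + (\<Sum>j\<in>UNIV. \<integral>p. D dt (\<lambda>q. v q $ j) p * (\<psi> p * v\<^sub>\<epsilon> p $ j) \<partial>cellm T)) = 0" .
  have 2: "(\<integral>p. D dt (\<lambda>q. F q $ i $ j) p * (\<psi> p * G i j (F\<^sub>\<epsilon> p)) \<partial>cellm T) = ?H i j" for i j
  proof (rule weak_F_moll)
    show "bounded_borel (\<lambda>p. \<psi> p * G i j (F\<^sub>\<epsilon> p))" by (intro bb)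
    show "periodic (\<lambda>p. \<psi> p * G i j (F\<^sub>\<epsilon> p))"
      using \<psi>(2) moll_periodic_F by (simp add: periodic_def)
    show "\<psi> p * G i j (F\<^sub>\<epsilon> p) \<noteq> 0 \<Longrightarrow> p \<in> window a b" for p using \<psi>(4)[of p] by auto
  qed
  have 3: "(\<integral>p. D dt (\<lambda>q. v q $ j) p * (\<psi> p * v\<^sub>\<epsilon> p $ j) \<partial>cellm T) = (\<Sum>i\<in>UNIV. ?K i j)" for j
  proof (rule weak_v_moll)
    show "bounded_borel (\<lambda>p. \<psi> p * v\<^sub>\<epsilon> p $ j)" by (intro bb)
    show "periodic (\<lambda>p. \<psi> p * v\<^sub>\<epsilon> p $ j)"
      using \<psi>(2) moll_periodic_v by (simp add: periodic_def)
    show "\<psi> p * v\<^sub>\<epsilon> p $ j \<noteq> 0 \<Longrightarrow> p \<in> window a b" for p using \<psi>(4)[of p] by auto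
  qed
  have 4: "?B i j + (?C i j + ?K i j) = 0" for i j
  proof -
    have "?B i j + (?C i j + ?K i j) = (\<integral>p. D\<psi> p (dx i) * (G\<^sub>\<epsilon> i j p * v\<^sub>\<epsilon> p $ j)
        + (D (dx i) (\<lambda>q. v q $ j) p * (\<psi> p * G\<^sub>\<epsilon> i j p) + D (dx i) (\<lambda>q. G i j (F q)) p * (\<psi> p * v\<^sub>\<epsilon> p $ j)) \<partial>cellm T)"
      by (subst Bochner_Integration.integral_add; (intro int bb dirs)?)+ simp
    also have "\<dots> = 0"
      unfolding flux_by_parts[of i j, symmetric]
      by (intro Bochner_Integration.integral_cong) (auto simp: distrib_left mult_ac)
    finally show ?thesis .
  qed
  have 5: "(\<integral>p. \<psi> p * ((G\<^sub>\<epsilon> i j p - G i j (F\<^sub>\<epsilon> p)) * D (dx i) (\<lambda>q. v q $ j) p) \<partial>cellm T) = ?C i j - ?H i j" for i j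
  proof -
    have "?C i j - ?H i j = (\<integral>p. D (dx i) (\<lambda>q. v q $ j) p * (\<psi> p * G\<^sub>\<epsilon> i j p)
        - D (dx i) (\<lambda>q. v q $ j) p * (\<psi> p * G i j (F\<^sub>\<epsilon> p)) \<partial>cellm T)"
      by (subst Bochner_Integration.integral_diff; (intro int bb)?) simp
    also have "\<dots> = (\<integral>p. \<psi> p * ((G\<^sub>\<epsilon> i j p - G i j (F\<^sub>\<epsilon> p)) * D (dx i) (\<lambda>q. v q $ j) p) \<partial>cellm T)"
      by (intro Bochner_Integration.integral_cong) (auto simp: algebra_simps)
    finally show ?thesis by simp
  qed
  have "(\<Sum>j\<in>UNIV. \<Sum>i\<in>UNIV. ?K i j) = (\<Sum>i\<in>UNIV. \<Sum>j\<in>UNIV. - ?B i j - ?C i j)"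
    by (subst sum.swap, intro sum.cong refl) (use 4 in \<open>simp add: algebra_simps eq_neg_iff_add_eq_0\<close>)
  with 1 show ?thesis
    unfolding 2 3 5 by (simp add: sum_subtractf sum_negf)
qed

text \<open>Every error below is a moment of this increment over the unit ball: closeness to the limit costs
the first moment, the commutator the second, and Besov regularity controls the third.\<close>

definition dev :: "spacetime \<Rightarrow> spacetime \<Rightarrow> real" where
  "dev p z = norm (F (p + \<epsilon> *\<^sub>R z) - F p) + norm (v (p + \<epsilon> *\<^sub>R z) - v p)"

definition Q :: "nat \<Rightarrow> spacetime \<Rightarrow> real" where
  "Q m p = (\<integral>z. dev p z ^ m \<partial>ubm)"

definition vol :: real where
  "vol = measure (ubm :: spacetime measure) UNIV"

lemma vol_pos: "0 < vol"
proof -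
  \<comment> \<open>A bounded kernel of mass one needs a domain of positive measure.\<close>
  have "norm (moll \<rho> \<epsilon> (\<lambda>p. 1::real) 0) \<le> L * (\<integral>z. 1 \<partial>(ubm :: spacetime measure))"
    by (rule moll_norm_le[OF \<rho>(1,2), where B = 1]) auto
  then have "1 \<le> L * vol"
    using moll_const[OF \<rho>(3,1), of \<epsilon> "1::real" 0] by (simp add: vol_def)
  then show ?thesis using L0 by (metis mult_nonneg_nonpos not_less order_trans zero_less_one)
qed

lemma dev_nonneg: "0 \<le> dev p z" by (simp add: dev_def)

lemma dev_le: "dev p z \<le> 4 * L"
  unfolding dev_def
  using norm_triangle_ineq4[of "F (p + \<epsilon> *\<^sub>R z)" "F p"] norm_triangle_ineq4[of "v (p + \<epsilon> *\<^sub>R z)" "v p"]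
    F(3)[of p] F(3)[of "p + \<epsilon> *\<^sub>R z"] v(3)[of p] v(3)[of "p + \<epsilon> *\<^sub>R z"] by linarith

lemma dev_measurable [measurable]: "case_prod dev \<in> borel_measurable borel"
  unfolding dev_def split_beta' by measurable

lemma dev_bb: "bounded_borel (\<lambda>z. dev p z)"
  by (rule bounded_borelI[where B = "4 * L"])
    (use dev_le dev_nonneg in \<open>auto simp: abs_of_nonneg dev_def\<close>)

lemma dev_pow_le: "\<bar>dev p z ^ m\<bar> \<le> (4 * L) ^ m"
  using power_mono[OF dev_le dev_nonneg, of p z m] dev_nonneg[of p z] by simp

lemma dev_pow_measurable: "case_prod (\<lambda>p z. dev p z ^ m) \<in> borel_measurable borel"
  using borel_measurable_power[OF dev_measurable, of m] by (simp add: split_beta')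

lemma Q_bb: "bounded_borel (Q m)"
proof (rule bounded_borelI[where B = "(4 * L) ^ m * vol"])
  show "Q m \<in> borel_measurable borel"
    using integral_swap(2)[OF dev_pow_measurable dev_pow_le] by (simp add: Q_def[abs_def])
  show "\<bar>Q m p\<bar> \<le> (4 * L) ^ m * vol" for p
  proof -
    have "\<bar>Q m p\<bar> \<le> (\<integral>z. \<bar>dev p z ^ m\<bar> \<partial>ubm)" unfolding Q_def by (rule integral_abs_bound)
    also have "\<dots> \<le> (\<integral>z. (4 * L) ^ m \<partial>(ubm :: spacetime measure))"
      by (intro integral_mono dev_pow_le bounded_borel_integrable_ubm bb dev_bb)
    finally show ?thesis by (simp add: vol_def mult_ac)
  qed
qed

lemma Q_nonneg: "0 \<le> Q m p"
  unfolding Q_def by (intro integral_nonneg_AE) (auto simp: dev_nonneg)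

lemma Q1_sq: "(Q 1 p)\<^sup>2 \<le> vol * Q 2 p"
proof -
  \<comment> \<open>The mean of the increment: its variance is nonnegative.\<close>
  define t where "t = Q 1 p / vol"
  have "0 \<le> (\<integral>z. dev p z ^ 2 - (2 * t) * dev p z ^ 1 + t\<^sup>2 \<partial>ubm)"
  proof (intro integral_nonneg_AE AE_I2)
    fix z
    have "dev p z ^ 2 - (2 * t) * dev p z ^ 1 + t\<^sup>2 = (dev p z - t)\<^sup>2"
      by (simp add: power2_eq_square algebra_simps)
    then show "0 \<le> dev p z ^ 2 - (2 * t) * dev p z ^ 1 + t\<^sup>2" by simp
  qed
  also have "\<dots> = Q 2 p - 2 * t * Q 1 p + t\<^sup>2 * vol"
    unfolding Q_def
    by (subst Bochner_Integration.integral_add Bochner_Integration.integral_diff;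
        (intro bounded_borel_integrable_ubm bb dev_bb)?)+ (simp add: vol_def)
  also have "\<dots> = Q 2 p - (Q 1 p)\<^sup>2 / vol"
    using vol_pos by (simp add: t_def power2_eq_square)
  finally show ?thesis using vol_pos by (simp add: field_simps)
qed

text \<open>A form of the Chebyshev sum inequality.  With t the mean of the increment, t d^2 is at most
d^3 + t^3 pointwise, and t^3 is at most the mean of d^3.\<close>

lemma Q1_Q2: "Q 1 p * Q 2 p \<le> 2 * vol * Q 3 p"
proof -
  define t where "t = Q 1 p / vol"
  have t: "0 \<le> t" "Q 1 p = t * vol" using vol_pos Q_nonneg[of 1 p] by (auto simp: t_def)
  have "t * Q 2 p = (\<integral>z. t * dev p z ^ 2 \<partial>ubm)" by (simp add: Q_def)
  also have "\<dots> \<le> (\<integral>z. dev p z ^ 3 + t ^ 3 \<partial>ubm)"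
  proof (rule integral_mono)
    fix z
    show "t * dev p z ^ 2 \<le> dev p z ^ 3 + t ^ 3"
    proof (cases "t \<le> dev p z")
      case True
      then have "t * dev p z ^ 2 \<le> dev p z * dev p z ^ 2" by (intro mult_right_mono) auto
      then show ?thesis using t(1) by (simp add: power3_eq_cube power2_eq_square add_increasing2)
    next
      case False
      then have "t * dev p z ^ 2 \<le> t * t ^ 2"
        using t(1) dev_nonneg[of p z] by (intro mult_left_mono power_mono) auto
      then show ?thesis using dev_nonneg[of p z] by (simp add: power3_eq_cube power2_eq_square add_increasing)
    qed
  qed (intro bounded_borel_integrable_ubm bb dev_bb)+
  also have "\<dots> = Q 3 p + t ^ 3 * vol"
    unfolding Q_def
    by (subst Bochner_Integration.integral_add; (intro bounded_borel_integrable_ubm bb dev_bb)?)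
       (simp add: vol_def)
  finally have 1: "t * Q 2 p \<le> Q 3 p + t ^ 3 * vol" .
  have "t ^ 3 * vol \<le> Q 3 p"
  proof -
    have "0 \<le> (\<integral>z. dev p z ^ 3 - (3 * t\<^sup>2) * dev p z ^ 1 + 2 * t ^ 3 \<partial>ubm)"
    proof (intro integral_nonneg_AE AE_I2)
      fix z
      have "dev p z ^ 3 - (3 * t\<^sup>2) * dev p z ^ 1 + 2 * t ^ 3 = (dev p z - t)\<^sup>2 * (dev p z + 2 * t)"
        by (simp add: power2_eq_square power3_eq_cube algebra_simps)
      then show "0 \<le> dev p z ^ 3 - (3 * t\<^sup>2) * dev p z ^ 1 + 2 * t ^ 3"
        using dev_nonneg t(1) by simp
    qed
    also have "\<dots> = Q 3 p - 3 * t\<^sup>2 * Q 1 p + 2 * t ^ 3 * vol"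
      unfolding Q_def
      by (subst Bochner_Integration.integral_add Bochner_Integration.integral_diff;
          (intro bounded_borel_integrable_ubm bb dev_bb)?)+ (simp add: vol_def)
    also have "\<dots> = Q 3 p - t ^ 3 * vol"
      unfolding t(2) by (simp add: power2_eq_square power3_eq_cube)
    finally show ?thesis by simp
  qed
  with 1 have "t * Q 2 p \<le> 2 * Q 3 p" by simp
  then have "vol * (t * Q 2 p) \<le> vol * (2 * Q 3 p)" using vol_pos by (intro mult_left_mono) auto
  then show ?thesis unfolding t(2) by (simp add: mult_ac)
qed

text \<open>Splitting at the height \<mu>: small increments contribute at most \<mu>, large ones are dominated by
their cubes.  It replaces the Hoelder inequality.\<close>

lemma Q1_le_Q3:
  assumes "0 < \<mu>"
  shows "Q 1 p \<le> \<mu> * vol + Q 3 p / \<mu>\<^sup>2"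
proof -
  have "Q 1 p \<le> (\<integral>z. \<mu> + dev p z ^ 3 / \<mu>\<^sup>2 \<partial>ubm)"
    unfolding Q_def
  proof (rule integral_mono)
    fix z
    show "dev p z ^ 1 \<le> \<mu> + dev p z ^ 3 / \<mu>\<^sup>2"
    proof (cases "dev p z \<le> \<mu>")
      case True
      then show ?thesis using dev_nonneg[of p z] by (simp add: add_increasing2)
    next
      case False
      then have "dev p z * \<mu>\<^sup>2 \<le> dev p z * dev p z ^ 2"
        using assms by (intro mult_left_mono power_mono) auto
      then have "dev p z \<le> dev p z ^ 3 / \<mu>\<^sup>2"
        using assms by (simp add: pos_le_divide_eq power3_eq_cube power2_eq_square mult_ac)
      then show ?thesis using assms by simp
    qed
  qed (intro bounded_borel_integrable_ubm bb dev_bb)+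
  also have "\<dots> = \<mu> * vol + Q 3 p / \<mu>\<^sup>2"
    unfolding Q_def
    by (subst Bochner_Integration.integral_add; (intro bounded_borel_integrable_ubm bb dev_bb)?)
       (simp add: vol_def)
  finally show ?thesis .
qed

text \<open>The order of integration is exchanged so that, for each fixed z, the Besov bound applies to the
increment by \<epsilon> z.\<close>

lemma Q3_integral:
  "(\<integral>p. indicator (window a b) p * Q 3 p \<partial>cellm T) \<le> 8 * L * vol * \<epsilon> powr (3 * \<alpha>)"
proof -
  let ?w = "\<lambda>p. indicator (window a b) p :: real"
  have meas: "case_prod (\<lambda>p z. ?w p * dev p z ^ 3) \<in> borel_measurable borel"
  proof -
    have "(\<lambda>x :: spacetime \<times> spacetime. ?w (fst x)) \<in> borel_measurable borel"
      by (rule measurable_compose[OF fst_borel borel_measurable_indicator[OF window_borel]])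
    then show ?thesis
      using dev_pow_measurable[of 3] by (simp add: split_beta')
  qed
  have bd: "\<bar>?w p * dev p z ^ 3\<bar> \<le> (4 * L) ^ 3" for p z
    using dev_pow_le[of p z 3] L0 by (simp add: indicator_def)
  have fac: "norm (F (p + \<xi>) - F p) \<le> 2 * L" "norm (v (p + \<xi>) - v p) \<le> 2 * L" for p \<xi>
    using norm_triangle_ineq4[of "F (p + \<xi>)" "F p"] norm_triangle_ineq4[of "v (p + \<xi>)" "v p"]
      F(3)[of p] F(3)[of "p + \<xi>"] v(3)[of p] v(3)[of "p + \<xi>"] by linarith+
  have dF: "bounded_borel (\<lambda>p. norm (F (p + \<xi>) - F p))" and dv: "bounded_borel (\<lambda>p. norm (v (p + \<xi>) - v p))" for \<xi>
    by (rule bounded_borelI[where B = "2 * L"]; use fac in auto)+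
  have "(\<integral>p. ?w p * Q 3 p \<partial>cellm T) = (\<integral>p. (\<integral>z. ?w p * dev p z ^ 3 \<partial>ubm) \<partial>cellm T)"
    by (simp add: Q_def)
  also have "\<dots> = (\<integral>z. (\<integral>p. ?w p * dev p z ^ 3 \<partial>cellm T) \<partial>ubm)"
    by (rule integral_swap(1)[OF meas bd])
  also have "\<dots> \<le> (\<integral>z. 8 * L * \<epsilon> powr (3 * \<alpha>) \<partial>(ubm :: spacetime measure))"
  proof (rule integral_mono_AE)
    show "integrable ubm (\<lambda>z. \<integral>p. ?w p * dev p z ^ 3 \<partial>cellm T)"
    proof (rule bounded_borel_integrable_ubm, rule bounded_borelI)
      show "(\<lambda>z. \<integral>p. ?w p * dev p z ^ 3 \<partial>cellm T) \<in> borel_measurable borel"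
        by (rule integral_swap(3)[OF meas bd])
      show "\<bar>\<integral>p. ?w p * dev p z ^ 3 \<partial>cellm T\<bar> \<le> (4 * L) ^ 3 * measure (cellm T) UNIV" for z
      proof -
        have "\<bar>\<integral>p. ?w p * dev p z ^ 3 \<partial>cellm T\<bar> \<le> (\<integral>p. \<bar>?w p * dev p z ^ 3\<bar> \<partial>cellm T)"
          by (rule integral_abs_bound)
        also have "\<dots> \<le> (\<integral>p. (4 * L) ^ 3 \<partial>cellm T)"
          unfolding dev_def
          by (intro integral_mono bd[unfolded dev_def] bounded_borel_integrable_cellm bb dF dv window_borel)
        finally show ?thesis by (simp add: mult.commute)
      qed
    qed
    show "AE z in ubm. (\<integral>p. ?w p * dev p z ^ 3 \<partial>cellm T) \<le> 8 * L * \<epsilon> powr (3 * \<alpha>)"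
      using ubm_AE_ball
    proof eventually_elim
      fix z :: spacetime assume z: "norm z < 1"
      define \<xi> where "\<xi> = \<epsilon> *\<^sub>R z"
      have "norm \<xi> \<le> \<epsilon>"
        using z \<epsilon> mult_left_mono[of "norm z" 1 \<epsilon>] by (simp add: \<xi>_def)
      then have x: "norm \<xi> \<le> \<epsilon>" "norm \<xi> < \<delta>" using \<epsilon> by auto
      have "norm \<xi> powr (3 * \<alpha>) \<le> \<epsilon> powr (3 * \<alpha>)"
        using x \<alpha> by (intro powr_mono2) auto
      then have pw: "L * norm \<xi> powr (3 * \<alpha>) \<le> L * \<epsilon> powr (3 * \<alpha>)" by (intro mult_left_mono L0)
      have cube: "(x + y) ^ 3 \<le> 4 * x ^ 3 + 4 * y ^ 3" if "0 \<le> x" "0 \<le> y" for x y :: real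
      proof -
        have "4 * x ^ 3 + 4 * y ^ 3 - (x + y) ^ 3 = 3 * ((x - y)\<^sup>2 * (x + y))"
          by (simp add: power2_eq_square power3_eq_cube algebra_simps)
        then show ?thesis using that by (smt (verit) mult_nonneg_nonneg zero_le_power2)
      qed
      have "(\<integral>p. ?w p * dev p z ^ 3 \<partial>cellm T) \<le>
          (\<integral>p. 4 * (?w p * norm (F (p + \<xi>) - F p) ^ 3) + 4 * (?w p * norm (v (p + \<xi>) - v p) ^ 3) \<partial>cellm T)"
      proof (rule integral_mono)
        show "?w p * dev p z ^ 3 \<le> 4 * (?w p * norm (F (p + \<xi>) - F p) ^ 3) + 4 * (?w p * norm (v (p + \<xi>) - v p) ^ 3)" for p
          using cube[of "norm (F (p + \<xi>) - F p)" "norm (v (p + \<xi>) - v p)"]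
          by (simp add: dev_def \<xi>_def indicator_def)
        show "integrable (cellm T) (\<lambda>p. ?w p * dev p z ^ 3)"
          unfolding dev_def by (intro bounded_borel_integrable_cellm bb dF dv window_borel)
      qed (intro bounded_borel_integrable_cellm bb dF dv window_borel)
      also have "\<dots> = 4 * (\<integral>p. ?w p * norm (F (p + \<xi>) - F p) ^ 3 \<partial>cellm T)
          + 4 * (\<integral>p. ?w p * norm (v (p + \<xi>) - v p) ^ 3 \<partial>cellm T)"
        by (subst Bochner_Integration.integral_add;
            (intro bounded_borel_integrable_cellm bb dF dv window_borel)?) simp
      also have "\<dots> \<le> 8 * L * \<epsilon> powr (3 * \<alpha>)"
        using besov[OF x(2)] pw by linarith
      finally show "(\<integral>p. ?w p * dev p z ^ 3 \<partial>cellm T) \<le> 8 * L * \<epsilon> powr (3 * \<alpha>)" .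
    qed
  qed (intro bounded_borel_integrable_ubm bb)
  finally show ?thesis by (simp add: vol_def mult_ac)
qed

lemma Q1_integral:
  "(\<integral>p. indicator (window a b) p * Q 1 p \<partial>cellm T) \<le> (vol * measure (cellm T) UNIV + 8 * L * vol) * \<epsilon> powr \<alpha>"
proof -
  let ?w = "\<lambda>p. indicator (window a b) p :: real"
  define \<mu> where "\<mu> = \<epsilon> powr \<alpha>"
  have l: "0 < \<mu>" using \<epsilon> by (simp add: \<mu>_def)
  have "(\<integral>p. ?w p * Q 1 p \<partial>cellm T) \<le> (\<integral>p. \<mu> * vol + (?w p * Q 3 p) / \<mu>\<^sup>2 \<partial>cellm T)"
  proof (rule integral_mono)
    show "?w p * Q 1 p \<le> \<mu> * vol + (?w p * Q 3 p) / \<mu>\<^sup>2" for p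
      using Q1_le_Q3[OF l, of p] l vol_pos by (auto simp: indicator_def)
  qed (intro bounded_borel_integrable_cellm bb Q_bb window_borel)+
  also have "\<dots> = \<mu> * vol * measure (cellm T) UNIV + (\<integral>p. ?w p * Q 3 p \<partial>cellm T) / \<mu>\<^sup>2"
    by (subst Bochner_Integration.integral_add;
        (intro bounded_borel_integrable_cellm bb Q_bb window_borel)?) simp
  also have "\<dots> \<le> \<mu> * vol * measure (cellm T) UNIV + (8 * L * vol * \<epsilon> powr (3 * \<alpha>)) / \<mu>\<^sup>2"
    by (intro add_left_mono divide_right_mono Q3_integral) simp
  also have "\<epsilon> powr (3 * \<alpha>) = \<mu> ^ 3"
  proof -
    have "\<mu> ^ 3 = \<mu> powr 3" using l by (simp add: powr_numeral)
    then show ?thesis by (simp add: \<mu>_def powr_powr mult.commute)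
  qed
  also have "\<mu> * vol * measure (cellm T) UNIV + (8 * L * vol * \<mu> ^ 3) / \<mu>\<^sup>2
      = (vol * measure (cellm T) UNIV + 8 * L * vol) * \<mu>"
    using l by (simp add: power2_eq_square power3_eq_cube field_simps)
  finally show ?thesis by (simp add: \<mu>_def)
qed

lemma Q12_integral:
  "(\<integral>p. indicator (window a b) p * (Q 1 p * Q 2 p) \<partial>cellm T) \<le> 16 * L * vol\<^sup>2 * \<epsilon> powr (3 * \<alpha>)"
proof -
  let ?w = "\<lambda>p. indicator (window a b) p :: real"
  have "(\<integral>p. ?w p * (Q 1 p * Q 2 p) \<partial>cellm T) \<le> (\<integral>p. 2 * vol * (?w p * Q 3 p) \<partial>cellm T)"
  proof (rule integral_mono)
    show "?w p * (Q 1 p * Q 2 p) \<le> 2 * vol * (?w p * Q 3 p)" for p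
      using Q1_Q2[of p] by (simp add: indicator_def)
  qed (intro bounded_borel_integrable_cellm bb Q_bb window_borel)+
  also have "\<dots> = 2 * vol * (\<integral>p. ?w p * Q 3 p \<partial>cellm T)" by simp
  also have "\<dots> \<le> 2 * vol * (8 * L * vol * \<epsilon> powr (3 * \<alpha>))"
    using vol_pos by (intro mult_left_mono Q3_integral) auto
  finally show ?thesis by (simp add: power2_eq_square mult_ac)
qed

lemma moll_increment_le:
  fixes g :: "spacetime \<Rightarrow> 'b::euclidean_space"
  assumes k: "kernel k" "\<And>z. \<bar>k z\<bar> \<le> K" and g [measurable]: "g \<in> borel_measurable borel" and B: "\<And>q. norm (g q) \<le> B"
    and c: "\<And>z. norm (g (p + \<epsilon> *\<^sub>R z) - g p) \<le> c * dev p z"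
  shows "norm (moll k \<epsilon> g p - moll k \<epsilon> (\<lambda>q. g p) p) \<le> K * (c * Q 1 p)"
proof -
  have "moll k \<epsilon> g p - moll k \<epsilon> (\<lambda>q. g p) p = moll k \<epsilon> (\<lambda>q. g q - g p) p"
    by (rule moll_diff[symmetric, OF k(1) g B _ B]) simp
  also have "norm \<dots> \<le> K * (\<integral>z. c * dev p z \<partial>ubm)"
  proof (rule moll_norm_le[OF k])
    show "norm (g q - g p) \<le> 2 * B" for q
      using norm_triangle_ineq4[of "g q" "g p"] B[of q] B[of p] by linarith
  qed (auto intro!: c bounded_borel_integrable_ubm bb dev_bb)
  finally show ?thesis by (simp add: Q_def)
qed

lemma moll_close:
  fixes g :: "spacetime \<Rightarrow> 'b::euclidean_space"
  assumes g: "g \<in> borel_measurable borel" and B: "\<And>q. norm (g q) \<le> B"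
    and c: "\<And>z. norm (g (p + \<epsilon> *\<^sub>R z) - g p) \<le> c * dev p z"
  shows "norm (moll \<rho> \<epsilon> g p - g p) \<le> L * (c * Q 1 p)"
  using moll_increment_le[OF \<rho>(1,2) g B c] by (simp add: moll_const[OF \<rho>(3,1)])

lemma D_le:
  fixes g :: "spacetime \<Rightarrow> 'b::euclidean_space"
  assumes e: "e \<in> directions" and g: "g \<in> borel_measurable borel" and B: "\<And>q. norm (g q) \<le> B"
    and c: "\<And>z. norm (g (p + \<epsilon> *\<^sub>R z) - g p) \<le> c * dev p z"
  shows "norm (D e g p) \<le> (L / \<epsilon>) * (c * Q 1 p)"
proof -
  have "\<bar>dker \<rho> \<epsilon> e z\<bar> \<le> L / \<epsilon>" for z
  proof -
    have "\<bar>dker \<rho> \<epsilon> e z\<bar> = \<bar>dker \<rho> 1 e z\<bar> / \<epsilon>" using \<epsilon> by (simp add: dker_def abs_mult)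
    then show ?thesis using \<rho>(4)[OF e, of z] \<epsilon> by (simp add: divide_right_mono)
  qed
  from moll_increment_le[OF kernel_dker[OF \<rho>(1)] this g B c]
  show ?thesis by (simp add: D_def moll_dker_const[OF \<rho>(1) \<epsilon>_nz])
qed

lemma F_close: "norm (F\<^sub>\<epsilon> p - F p) \<le> L * Q 1 p"
  using moll_close[OF F(1,3), of p 1] by (simp add: dev_def)

lemma v_close: "norm (v\<^sub>\<epsilon> p - v p) \<le> L * Q 1 p"
  using moll_close[OF v(1,3), of p 1] by (simp add: dev_def)

lemma v_nth_close: "\<bar>v\<^sub>\<epsilon> p $ j - v p $ j\<bar> \<le> L * Q 1 p"
  using Finite_Cartesian_Product.norm_nth_le[of "v\<^sub>\<epsilon> p - v p" j] v_close[of p] by simp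

lemma v_nth_bound: "\<bar>v p $ j\<bar> \<le> L"
  using Finite_Cartesian_Product.norm_nth_le[of "v p" j] v(3)[of p] by simp

lemma v_moll_bound: "\<bar>v\<^sub>\<epsilon> p $ j\<bar> \<le> L * (L * vol)"
proof -
  have "norm (v\<^sub>\<epsilon> p) \<le> L * (\<integral>z. L \<partial>(ubm :: spacetime measure))"
    by (rule moll_norm_le[OF \<rho>(1,2) v(1,3)]) (auto intro: v(3))
  then show ?thesis
    using Finite_Cartesian_Product.norm_nth_le[of "v\<^sub>\<epsilon> p" j] by (simp add: vol_def mult_ac)
qed

lemma G_close: "\<bar>G\<^sub>\<epsilon> i j p - G i j (F p)\<bar> \<le> L * (L * Q 1 p)"
proof -
  have "norm (G\<^sub>\<epsilon> i j p - G i j (F p)) \<le> L * (L * Q 1 p)"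
  proof (rule moll_close)
    show "norm (G i j (F (p + \<epsilon> *\<^sub>R z)) - G i j (F p)) \<le> L * dev p z" for z
    proof -
      have "L * norm (F (p + \<epsilon> *\<^sub>R z) - F p) \<le> L * dev p z"
        using L0 by (intro mult_left_mono) (auto simp: dev_def)
      then show ?thesis unfolding real_norm_def by (rule order_trans[OF G(2)])
    qed
    show "norm (G i j (F q)) \<le> L" for q by (simp add: G(1))
  qed measurable
  then show ?thesis by simp
qed

lemma Dv_le: "\<bar>D (dx i) (\<lambda>q. v q $ j) p\<bar> \<le> (L / \<epsilon>) * Q 1 p"
proof -
  have "norm (D (dx i) v p) \<le> (L / \<epsilon>) * (1 * Q 1 p)"
    by (rule D_le[OF _ v(1,3)]) (auto simp: directions_def dev_def)
  then show ?thesis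
    using Finite_Cartesian_Product.norm_nth_le[of "D (dx i) v p" j] by (simp add: Dv_nth)
qed

text \<open>Both the mollified stress and the stress of the mollified field are expanded around F p.  Since
averaging commutes with the linear map DG, the zeroth and first order terms cancel, and two
quadratic remainders stay.\<close>

lemma commutator: "\<bar>G\<^sub>\<epsilon> i j p - G i j (F\<^sub>\<epsilon> p)\<bar> \<le> (L * L + L * (L\<^sup>2 * vol)) * Q 2 p"
proof -
  let ?A = "DG i j (F p)"
  interpret A: bounded_linear ?A by (rule DG(1))
  have Am [measurable]: "?A \<in> borel_measurable borel"
    by (intro borel_measurable_continuous_onI linear_continuous_on DG(1))
  obtain KA where KA: "KA \<ge> 0" "\<And>H. norm (?A H) \<le> norm H * KA" using A.nonneg_bounded by blast
  have AF: "norm (?A (F q)) \<le> L * KA" for q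
    using KA(2)[of "F q"] mult_right_mono[OF F(3)[of q] KA(1)] by linarith
  let ?r = "\<lambda>q. G i j (F q) - G i j (F p) - ?A (F q - F p)"
  have "moll \<rho> \<epsilon> (\<lambda>q. G i j (F q) - ?A (F q)) p = G\<^sub>\<epsilon> i j p - moll \<rho> \<epsilon> (\<lambda>q. ?A (F q)) p"
    by (rule moll_diff[OF \<rho>(1), where A = L and B = "L * KA"]) (use AF in \<open>auto simp: G(1)\<close>)
  also have "moll \<rho> \<epsilon> (\<lambda>q. ?A (F q)) p = ?A (F\<^sub>\<epsilon> p)"
    by (rule moll_bounded_linear[OF \<rho>(1) F(1,3) DG(1)])
  finally have 1: "moll \<rho> \<epsilon> (\<lambda>q. G i j (F q) - ?A (F q)) p = G\<^sub>\<epsilon> i j p - ?A (F\<^sub>\<epsilon> p)" .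
  have bd: "\<bar>G i j (F q) - ?A (F q)\<bar> \<le> L + L * KA" for q
    using G(1)[of i j "F q"] AF[of q] by simp
  have "moll \<rho> \<epsilon> (\<lambda>q. (G i j (F q) - ?A (F q)) - (G i j (F p) - ?A (F p))) p
      = moll \<rho> \<epsilon> (\<lambda>q. G i j (F q) - ?A (F q)) p - moll \<rho> \<epsilon> (\<lambda>q. G i j (F p) - ?A (F p)) p"
    by (rule moll_diff[OF \<rho>(1), where A = "L + L * KA" and B = "L + L * KA"])
       (use bd in auto)
  then have 2: "moll \<rho> \<epsilon> ?r p = G\<^sub>\<epsilon> i j p - G i j (F p) - ?A (F\<^sub>\<epsilon> p - F p)"
    unfolding 1 moll_const[OF \<rho>(3,1)] by (simp add: A.diff algebra_simps)
  have rb: "norm (?r q) \<le> 2 * L + 2 * (L * KA)" for q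
    using G(1)[of i j "F q"] G(1)[of i j "F p"] AF[of q] AF[of p] unfolding A.diff real_norm_def by linarith
  have "norm (moll \<rho> \<epsilon> ?r p) \<le> L * (\<integral>z. L * dev p z ^ 2 \<partial>ubm)"
  proof (rule moll_norm_le[OF \<rho>(1,2) _ rb])
    show "norm (?r (p + \<epsilon> *\<^sub>R z)) \<le> L * dev p z ^ 2" for z
    proof -
      have "norm (?r (p + \<epsilon> *\<^sub>R z)) \<le> L * norm (F (p + \<epsilon> *\<^sub>R z) - F p) ^ 2"
        using DG(2) by simp
      also have "\<dots> \<le> L * dev p z ^ 2"
        using L0 by (intro mult_left_mono power_mono) (auto simp: dev_def)
      finally show ?thesis .
    qed
  qed (auto intro!: bounded_borel_integrable_ubm bb dev_bb)
  then have 3: "\<bar>G\<^sub>\<epsilon> i j p - G i j (F p) - ?A (F\<^sub>\<epsilon> p - F p)\<bar> \<le> L * L * Q 2 p"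
    unfolding 2 by (simp add: Q_def)
  have "\<bar>G i j (F\<^sub>\<epsilon> p) - G i j (F p) - ?A (F\<^sub>\<epsilon> p - F p)\<bar> \<le> L * (norm (F\<^sub>\<epsilon> p - F p))\<^sup>2"
    by (rule DG(2))
  also have "\<dots> \<le> L * (L * Q 1 p)\<^sup>2"
    using L0 F_close by (intro mult_left_mono power_mono) auto
  also have "\<dots> \<le> L * (L\<^sup>2 * (vol * Q 2 p))"
    unfolding power_mult_distrib by (intro mult_left_mono Q1_sq L0 zero_le_power2)
  finally show ?thesis using 3 by (simp add: algebra_simps) 
qed

abbreviation limit_balance :: real where
  "limit_balance \<equiv> (\<integral>p. D\<psi> p dt * E p \<partial>cellm T)
   - (\<Sum>i\<in>UNIV. \<Sum>j\<in>UNIV. \<integral>p. D\<psi> p (dx i) * (G i j (F p) * v p $ j) \<partial>cellm T)"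

lemma window_integral_le:
  assumes f: "bounded_borel f" and h: "bounded_borel h" 
    and le: "\<And>p. p \<in> window a b \<Longrightarrow> \<bar>f p\<bar> \<le> c * h p" and z: "\<And>p. p \<notin> window a b \<Longrightarrow> f p = 0"
  shows "\<bar>\<integral>p. f p \<partial>cellm T\<bar> \<le> c * (\<integral>p. indicator (window a b) p * h p \<partial>cellm T)"
proof -
  have "\<bar>\<integral>p. f p \<partial>cellm T\<bar> \<le> (\<integral>p. \<bar>f p\<bar> \<partial>cellm T)" by (rule integral_abs_bound)
  also have "\<dots> \<le> (\<integral>p. c * (indicator (window a b) p * h p) \<partial>cellm T)"
  proof (rule integral_mono)
    show "\<bar>f p\<bar> \<le> c * (indicator (window a b) p * h p)" for p
      using le[of p] z[of p] by (auto simp: indicator_def)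
  qed (intro bounded_borel_integrable_cellm bounded_borel_intros f h window_borel)+
  finally show ?thesis by simp
qed

lemma D\<psi>_zero: "p \<notin> window a b \<Longrightarrow> D\<psi> p e = 0" using D\<psi>(3) by blast

lemma energy_close:
  "\<bar>(\<integral>p. D\<psi> p dt * E p \<partial>cellm T)
    - (\<integral>p. D\<psi> p dt * E\<^sub>\<epsilon> p \<partial>cellm T)\<bar>
   \<le> L * (L * L + 3 * (L * (L * (L * vol) + L))) * (\<integral>p. indicator (window a b) p * Q 1 p \<partial>cellm T)"
proof -
  have dirs: "dt \<in> directions" by (auto simp: directions_def)
  have WF: "bounded_borel (\<lambda>p. W (F p))" by (rule bounded_borelI[where B = L]) (auto simp: W(2))
  let ?f = "\<lambda>p. D\<psi> p dt * E p
    - D\<psi> p dt * E\<^sub>\<epsilon> p"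
  have "\<bar>\<integral>p. ?f p \<partial>cellm T\<bar> \<le> L * (L * L + 3 * (L * (L * (L * vol) + L))) * (\<integral>p. indicator (window a b) p * Q 1 p \<partial>cellm T)"
  proof (rule window_integral_le)
    show "bounded_borel ?f" by (intro bb WF dirs)
    show "?f p = 0" if "p \<notin> window a b" for p using D\<psi>_zero[OF that] by simp
    show "\<bar>?f p\<bar> \<le> L * (L * L + 3 * (L * (L * (L * vol) + L))) * Q 1 p" for p
    proof -
      have w: "\<bar>W (F p) - W (F\<^sub>\<epsilon> p)\<bar> \<le> L * (L * Q 1 p)"
        using W(3)[of "F p" "F\<^sub>\<epsilon> p"] mult_left_mono[OF F_close[of p] L0] by (simp add: norm_minus_commute)
      have vv: "\<bar>v p $ j * v p $ j - v\<^sub>\<epsilon> p $ j * v\<^sub>\<epsilon> p $ j\<bar> \<le> (L * Q 1 p) * (L * (L * vol) + L)" for j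
      proof -
        have "\<bar>v p $ j * v p $ j - v\<^sub>\<epsilon> p $ j * v\<^sub>\<epsilon> p $ j\<bar> = \<bar>v\<^sub>\<epsilon> p $ j - v p $ j\<bar> * \<bar>v\<^sub>\<epsilon> p $ j + v p $ j\<bar>"
          unfolding abs_mult[symmetric] by (subst abs_minus_commute) (simp add: algebra_simps)
        also have "\<dots> \<le> (L * Q 1 p) * (L * (L * vol) + L)"
          using v_nth_close[of p j] v_moll_bound[of p j] v_nth_bound[of p j]
          by (intro mult_mono) auto
        finally show ?thesis .
      qed
      have s: "\<bar>(\<Sum>j\<in>UNIV. v p $ j * v p $ j) - (\<Sum>j\<in>UNIV. v\<^sub>\<epsilon> p $ j * v\<^sub>\<epsilon> p $ j)\<bar>
          \<le> 3 * ((L * Q 1 p) * (L * (L * vol) + L))"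
        unfolding sum_subtractf[symmetric]
        by (rule order_trans[OF sum_abs]) (use vv[of 1] vv[of 2] vv[of 3] in \<open>simp add: sum_3\<close>)
      have "\<bar>?f p\<bar> = \<bar>D\<psi> p dt\<bar> * \<bar>(W (F p) - W (F\<^sub>\<epsilon> p))
          + ((\<Sum>j\<in>UNIV. v p $ j * v p $ j) - (\<Sum>j\<in>UNIV. v\<^sub>\<epsilon> p $ j * v\<^sub>\<epsilon> p $ j)) / 2\<bar>"
        unfolding abs_mult[symmetric] by (rule arg_cong[where f = abs]) (simp add: field_simps)
      also have "\<dots> \<le> L * (L * (L * Q 1 p) + 3 * ((L * Q 1 p) * (L * (L * vol) + L)))"
      proof (rule mult_mono)
        have half: "\<bar>x + y / 2\<bar> \<le> X + Y" if "\<bar>x\<bar> \<le> X" "\<bar>y\<bar> \<le> Y" for x y X Y :: real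
          using that by linarith
        show "\<bar>(W (F p) - W (F\<^sub>\<epsilon> p))
          + ((\<Sum>j\<in>UNIV. v p $ j * v p $ j) - (\<Sum>j\<in>UNIV. v\<^sub>\<epsilon> p $ j * v\<^sub>\<epsilon> p $ j)) / 2\<bar>
          \<le> L * (L * Q 1 p) + 3 * ((L * Q 1 p) * (L * (L * vol) + L))"
          by (rule half[OF w s])
      qed (use D\<psi>(2)[OF dirs, of p] L0 in auto)
      finally show ?thesis by (simp add: algebra_simps)
    qed
  qed (rule Q_bb)
  moreover have "(\<integral>p. ?f p \<partial>cellm T) = (\<integral>p. D\<psi> p dt * E p \<partial>cellm T)
    - (\<integral>p. D\<psi> p dt * E\<^sub>\<epsilon> p \<partial>cellm T)"
    by (intro Bochner_Integration.integral_diff bounded_borel_integrable_cellm bb WF dirs)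
  ultimately show ?thesis by simp
qed

lemma flux_close:
  "\<bar>(\<integral>p. D\<psi> p (dx i) * (G i j (F p) * v p $ j) \<partial>cellm T)
    - (\<integral>p. D\<psi> p (dx i) * (G\<^sub>\<epsilon> i j p * v\<^sub>\<epsilon> p $ j) \<partial>cellm T)\<bar>
   \<le> L * (L * L * (L * (L * vol)) + L * L) * (\<integral>p. indicator (window a b) p * Q 1 p \<partial>cellm T)"
proof -
  have dirs: "dx i \<in> directions" by (auto simp: directions_def)
  let ?f = "\<lambda>p. D\<psi> p (dx i) * (G i j (F p) * v p $ j) - D\<psi> p (dx i) * (G\<^sub>\<epsilon> i j p * v\<^sub>\<epsilon> p $ j)"
  have "\<bar>\<integral>p. ?f p \<partial>cellm T\<bar> \<le> L * (L * L * (L * (L * vol)) + L * L) * (\<integral>p. indicator (window a b) p * Q 1 p \<partial>cellm T)"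
  proof (rule window_integral_le)
    show "bounded_borel ?f" by (intro bb dirs)
    show "?f p = 0" if "p \<notin> window a b" for p using D\<psi>_zero[OF that] by simp
    show "\<bar>?f p\<bar> \<le> L * (L * L * (L * (L * vol)) + L * L) * Q 1 p" for p
    proof -
      have "\<bar>G i j (F p) * v p $ j - G\<^sub>\<epsilon> i j p * v\<^sub>\<epsilon> p $ j\<bar>
          \<le> \<bar>G\<^sub>\<epsilon> i j p - G i j (F p)\<bar> * \<bar>v\<^sub>\<epsilon> p $ j\<bar> + \<bar>G i j (F p)\<bar> * \<bar>v\<^sub>\<epsilon> p $ j - v p $ j\<bar>"
        unfolding abs_mult[symmetric] by (simp add: algebra_simps)
      also have "\<dots> \<le> (L * (L * Q 1 p)) * (L * (L * vol)) + L * (L * Q 1 p)"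
        using G_close[of i j p] v_moll_bound[of p j] G(1)[of i j "F p"] v_nth_close[of p j] L0 Q_nonneg[of 1 p]
        by (intro add_mono mult_mono) auto
      finally have "\<bar>D\<psi> p (dx i)\<bar> * \<bar>G i j (F p) * v p $ j - G\<^sub>\<epsilon> i j p * v\<^sub>\<epsilon> p $ j\<bar>
          \<le> L * ((L * (L * Q 1 p)) * (L * (L * vol)) + L * (L * Q 1 p))"
        using D\<psi>(2)[OF dirs, of p] L0 by (intro mult_mono) auto
      then show ?thesis unfolding abs_mult[symmetric] by (simp add: algebra_simps)
    qed
  qed (rule Q_bb)
  moreover have "(\<integral>p. ?f p \<partial>cellm T) = (\<integral>p. D\<psi> p (dx i) * (G i j (F p) * v p $ j) \<partial>cellm T)
    - (\<integral>p. D\<psi> p (dx i) * (G\<^sub>\<epsilon> i j p * v\<^sub>\<epsilon> p $ j) \<partial>cellm T)"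
    by (intro Bochner_Integration.integral_diff bounded_borel_integrable_cellm bb dirs)
  ultimately show ?thesis by simp
qed

text \<open>One derivative of v costs 1/\<epsilon> and one increment, the commutator supplies two increments.\<close>

lemma defect_le:
  "\<bar>\<integral>p. \<psi> p * ((G\<^sub>\<epsilon> i j p - G i j (F\<^sub>\<epsilon> p)) * D (dx i) (\<lambda>q. v q $ j) p) \<partial>cellm T\<bar>
   \<le> (L * (L * L + L * (L\<^sup>2 * vol)) * (L / \<epsilon>)) * (\<integral>p. indicator (window a b) p * (Q 1 p * Q 2 p) \<partial>cellm T)"
proof (rule window_integral_le)
  show "\<psi> p * ((G\<^sub>\<epsilon> i j p - G i j (F\<^sub>\<epsilon> p)) * D (dx i) (\<lambda>q. v q $ j) p) = 0" if "p \<notin> window a b" for p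
    using \<psi>(4)[of p] that by (cases "\<psi> p = 0") auto
  show "\<bar>\<psi> p * ((G\<^sub>\<epsilon> i j p - G i j (F\<^sub>\<epsilon> p)) * D (dx i) (\<lambda>q. v q $ j) p)\<bar>
      \<le> (L * (L * L + L * (L\<^sup>2 * vol)) * (L / \<epsilon>)) * (Q 1 p * Q 2 p)" for p
  proof -
    have c0: "0 \<le> (L * L + L * (L\<^sup>2 * vol)) * Q 2 p"
      using order_trans[OF abs_ge_zero commutator[of undefined undefined p]] .
    have "\<bar>\<psi> p * ((G\<^sub>\<epsilon> i j p - G i j (F\<^sub>\<epsilon> p)) * D (dx i) (\<lambda>q. v q $ j) p)\<bar>
        \<le> L * (((L * L + L * (L\<^sup>2 * vol)) * Q 2 p) * ((L / \<epsilon>) * Q 1 p))"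
      unfolding abs_mult by (intro mult_mono \<psi>(3) commutator Dv_le L0 c0 mult_nonneg_nonneg abs_ge_zero)
    then show ?thesis by (simp add: mult_ac)
  qed
qed (intro bb Q_bb)+

lemma limit_balance_le:
  "\<bar>limit_balance\<bar> \<le>
    (L * (L * L + 3 * (L * (L * (L * vol) + L))) + 9 * (L * (L * L * (L * (L * vol)) + L * L)))
      * (vol * measure (cellm T) UNIV + 8 * L * vol) * \<epsilon> powr \<alpha>
    + 9 * (L * (L * L + L * (L\<^sup>2 * vol)) * L * (16 * L * vol\<^sup>2)) * \<epsilon> powr (3 * \<alpha> - 1)"
proof -
  let ?q = "\<integral>p. indicator (window a b) p * Q 1 p \<partial>cellm T"
  let ?E = "\<integral>p. D\<psi> p dt * E p \<partial>cellm T"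
  let ?E' = "\<integral>p. D\<psi> p dt * E\<^sub>\<epsilon> p \<partial>cellm T"
  let ?B = "\<lambda>i j. \<integral>p. D\<psi> p (dx i) * (G i j (F p) * v p $ j) \<partial>cellm T"
  let ?B' = "\<lambda>i j. \<integral>p. D\<psi> p (dx i) * (G\<^sub>\<epsilon> i j p * v\<^sub>\<epsilon> p $ j) \<partial>cellm T"
  let ?R = "\<lambda>i j. \<integral>p. \<psi> p * ((G\<^sub>\<epsilon> i j p - G i j (F\<^sub>\<epsilon> p)) * D (dx i) (\<lambda>q. v q $ j) p) \<partial>cellm T"
  define c1 where "c1 = L * (L * L + 3 * (L * (L * (L * vol) + L)))"
  define c2 where "c2 = L * (L * L * (L * (L * vol)) + L * L)"
  define c3 where "c3 = L * (L * L + L * (L\<^sup>2 * vol)) * L"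
  have c: "0 \<le> c1" "0 \<le> c2" "0 \<le> c3"
    using L0 vol_pos by (auto simp: c1_def c2_def c3_def)
  have nine: "\<bar>\<Sum>i\<in>UNIV. \<Sum>j\<in>UNIV. f i j\<bar> \<le> 9 * x" if "\<And>i j. \<bar>f i j\<bar> \<le> x" for f :: "3 \<Rightarrow> 3 \<Rightarrow> real" and x
  proof -
    have "\<bar>\<Sum>j\<in>UNIV. f i j\<bar> \<le> 3 * x" for i
      using that[of i 1] that[of i 2] that[of i 3] by (simp add: sum_3 abs_le_iff)
    from this[of 1] this[of 2] this[of 3] show ?thesis
      by (subst sum_3) (simp add: abs_le_iff)
  qed
  have e: "\<bar>?E - ?E'\<bar> \<le> c1 * ?q" using energy_close by (simp add: c1_def)
  have f: "\<bar>\<Sum>i\<in>UNIV. \<Sum>j\<in>UNIV. ?B i j - ?B' i j\<bar> \<le> 9 * (c2 * ?q)"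
    unfolding c2_def by (rule nine) (rule flux_close)
  have r: "\<bar>\<Sum>i\<in>UNIV. \<Sum>j\<in>UNIV. ?R i j\<bar> \<le> 9 * (c3 * (16 * L * vol\<^sup>2) * \<epsilon> powr (3 * \<alpha> - 1))"
  proof (rule nine)
    fix i j
    have "\<bar>?R i j\<bar> \<le> c3 / \<epsilon> * (\<integral>p. indicator (window a b) p * (Q 1 p * Q 2 p) \<partial>cellm T)"
      using defect_le[of i j] by (simp add: c3_def)
    also have "\<dots> \<le> c3 / \<epsilon> * (16 * L * vol\<^sup>2 * \<epsilon> powr (3 * \<alpha>))"
      using c(3) \<epsilon> by (intro mult_left_mono Q12_integral) auto
    also have "\<dots> = c3 * (16 * L * vol\<^sup>2) * \<epsilon> powr (3 * \<alpha> - 1)"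
      using \<epsilon> by (simp add: powr_diff)
    finally show "\<bar>?R i j\<bar> \<le> c3 * (16 * L * vol\<^sup>2) * \<epsilon> powr (3 * \<alpha> - 1)" .
  qed
  have "limit_balance = (?E - ?E') - (\<Sum>i\<in>UNIV. \<Sum>j\<in>UNIV. ?B i j - ?B' i j) + (\<Sum>i\<in>UNIV. \<Sum>j\<in>UNIV. ?R i j)"
    unfolding mollified_balance[symmetric] sum_subtractf by simp
  then have "\<bar>limit_balance\<bar> \<le> c1 * ?q + 9 * (c2 * ?q) + 9 * (c3 * (16 * L * vol\<^sup>2) * \<epsilon> powr (3 * \<alpha> - 1))"
    using e f r by linarith
  also have "c1 * ?q + 9 * (c2 * ?q) = (c1 + 9 * c2) * ?q" by (simp add: algebra_simps)
  also have "\<dots> \<le> (c1 + 9 * c2) * ((vol * measure (cellm T) UNIV + 8 * L * vol) * \<epsilon> powr \<alpha>)"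
    using c by (intro mult_left_mono Q1_integral) auto
  finally show ?thesis unfolding c1_def c2_def c3_def by (simp add: mult_ac)
qed

end

text \<open>The defect is of order \<epsilon> to the power 3\<alpha> - 1, which is positive exactly because \<alpha> > 1/3.\<close>

theorem energy_balance:
  "(\<integral>p. D\<psi> p dt * E p \<partial>cellm T)
   = (\<Sum>i\<in>UNIV. \<Sum>j\<in>UNIV. \<integral>p. D\<psi> p (dx i) * (G i j (F p) * v p $ j) \<partial>cellm T)"
proof -
  define A B where "A = (L * (L * L + 3 * (L * (L * (L * vol) + L))) + 9 * (L * (L * L * (L * (L * vol)) + L * L)))
      * (vol * measure (cellm T) UNIV + 8 * L * vol)"
    and "B = 9 * (L * (L * L + L * (L\<^sup>2 * vol)) * L * (16 * L * vol\<^sup>2))"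
  have le: "\<bar>limit_balance\<bar> \<le> A * \<epsilon> powr \<alpha> + B * \<epsilon> powr (3 * \<alpha> - 1)" if "0 < \<epsilon>" "\<epsilon> < \<delta>" for \<epsilon>
    using limit_balance_le[OF that] by (simp add: A_def B_def)
  have lim: "((\<lambda>\<epsilon>. \<epsilon> powr c) \<longlongrightarrow> 0) (at_right (0::real))" if "0 < c" for c
    using that by (auto intro!: tendsto_zero_powrI[of _ _ "\<lambda>_. c" c] tendsto_ident_at simp: eventually_at_filter)
  have "((\<lambda>\<epsilon>. A * \<epsilon> powr \<alpha> + B * \<epsilon> powr (3 * \<alpha> - 1)) \<longlongrightarrow> A * 0 + B * 0) (at_right 0)"
    using \<alpha> by (intro tendsto_intros lim) auto
  moreover have "\<forall>\<^sub>F \<epsilon> in at_right 0. \<bar>limit_balance\<bar> \<le> A * \<epsilon> powr \<alpha> + B * \<epsilon> powr (3 * \<alpha> - 1)"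
    using eventually_at_right_real[OF \<delta>(1)] by eventually_elim (auto intro: le)
  ultimately have "\<bar>limit_balance\<bar> \<le> A * 0 + B * 0"
    by (intro tendsto_lowerbound[of _ _ "at_right (0::real)"]) auto
  then show ?thesis by simp
qed

end

section \<open>Borel representatives and Besov increments\<close>

lemma borel_version:
  fixes f :: "'a::euclidean_space \<Rightarrow> 'b::euclidean_space"
  assumes f: "f \<in> borel_measurable lebesgue"
  obtains g where "g \<in> borel_measurable borel" "negligible {x. g x \<noteq> f x}"
proof -
  have "\<exists>h\<in>borel_measurable lborel. AE x in lborel. f x \<bullet> b = h x" for b
    by (intro completion_ex_borel_measurable_real borel_measurable_inner f) auto
  then obtain h where h: "\<And>b. h b \<in> borel_measurable lborel" "\<And>b. AE x in lborel. f x \<bullet> b = h b x"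
    by metis
  define g where "g x = (\<Sum>b\<in>Basis. h b x *\<^sub>R b)" for x
  have m: "g \<in> borel_measurable borel" unfolding g_def using h(1) by auto
  have "AE x in lborel. \<forall>b\<in>Basis. f x \<bullet> b = h b x"
    using h(2) by (intro AE_finite_allI) auto
  then have "AE x in lborel. g x = f x"
  proof eventually_elim
    fix x assume "\<forall>b\<in>Basis. f x \<bullet> b = h b x"
    then have "g x = (\<Sum>b\<in>Basis. (f x \<bullet> b) *\<^sub>R b)" unfolding g_def by (intro sum.cong) auto
    then show "g x = f x" by (simp add: euclidean_representation)
  qed
  then have "AE x in lebesgue. g x = f x" by (rule AE_completion)
  then have "negligible {x. g x \<noteq> f x}"
    unfolding negligible_iff_null_sets by (simp add: AE_iff_null_sets completion.AE_iff_null_sets)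
  with m show thesis by (rule that)
qed

lemma cell_lebesgue: "cell T \<in> sets lebesgue"
  using measurable_cell by auto

lemma cell_not_negligible:
  assumes "0 < T"
  shows "\<not> negligible (cell T)"
proof -
  have "{0<..<T} \<times> box 0 1 \<subseteq> cell T"
    by (auto simp: cell_def mem_box_cart less_imp_le)
  moreover have "(T / 2, \<chi> i. 1 / 2) \<in> {0<..<T} \<times> box 0 (1 :: vec3)"
    using assms by (auto simp: mem_box_cart)
  moreover have "open ({0<..<T} \<times> box 0 (1 :: vec3))"
    by (intro open_Times open_box) simp
  ultimately show ?thesis
    using open_not_negligible negligible_subset by blast
qed

text \<open>Each value outside the essential range has a ball with null preimage; by the Lindeloef property
countably many of these balls suffice.\<close>

lemma negligible_off_ess_range:
  fixes f :: "spacetime \<Rightarrow> 'b::euclidean_space"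
  assumes f: "f \<in> borel_measurable (lebesgue_on (cell T))"
  shows "negligible {p \<in> cell T. f p \<notin> ess_range T f}"
proof -
  define \<B> where "\<B> = {ball y r | y r. 0 < r \<and> negligible {p \<in> cell T. f p \<in> ball y r}}"
  have "\<And>S. S \<in> \<B> \<Longrightarrow> open S" by (auto simp: \<B>_def)
  then obtain \<C> where C: "\<C> \<subseteq> \<B>" "countable \<C>" "\<Union>\<C> = \<Union>\<B>"
    using Lindelof[of \<B>] by metis
  have "f p \<in> \<Union>\<B>" if p: "p \<in> cell T" "f p \<notin> ess_range T f" for p
  proof -
    obtain r where r: "r > 0" "\<not> emeasure lebesgue {q \<in> cell T. norm (f q - f p) < r} > 0"
      using p(2) by (auto simp: ess_range_def)
    have eq: "{q \<in> cell T. norm (f q - f p) < r} = {q \<in> cell T. f q \<in> ball (f p) r}"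
      by (auto simp: dist_norm norm_minus_commute)
    have "{q \<in> cell T. f q \<in> ball (f p) r} = f -` ball (f p) r \<inter> space (lebesgue_on (cell T))"
      by (auto simp: space_restrict_space)
    also have "\<dots> \<in> sets (lebesgue_on (cell T))"
      by (rule measurable_sets[OF f]) simp
    finally have "{q \<in> cell T. f q \<in> ball (f p) r} \<in> sets lebesgue"
      using cell_lebesgue sets_restrict_space_iff[of "cell T" lebesgue] by auto
    with r(2) have "negligible {q \<in> cell T. f q \<in> ball (f p) r}"
      unfolding eq negligible_iff_null_sets by auto
    then have "ball (f p) r \<in> \<B>" using r(1) by (auto simp: \<B>_def)
    then show ?thesis using r(1) by (meson UnionI centre_in_ball)
  qed
  then have "{p \<in> cell T. f p \<notin> ess_range T f} \<subseteq> (\<Union>S\<in>\<C>. {p \<in> cell T. f p \<in> S})"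
    using C(3) by blast
  moreover have "negligible (\<Union>S\<in>\<C>. {p \<in> cell T. f p \<in> S})"
    using C by (intro negligible_countable_Union) (auto simp: \<B>_def)
  ultimately show ?thesis using negligible_subset by blast
qed

definition wrap :: "spacetime \<Rightarrow> spacetime" where
  "wrap p = (fst p, \<chi> i. snd p $ i - of_int \<lfloor>snd p $ i\<rfloor>)"

lemma wrap_measurable [measurable]: "wrap \<in> borel_measurable borel"
proof -
  have "(\<lambda>p::spacetime. \<chi> i. snd p $ i - of_int \<lfloor>snd p $ i\<rfloor>) \<in> borel_measurable borel"
  proof (subst borel_measurable_euclidean_space, intro ballI)
    fix b :: vec3 assume "b \<in> Basis"
    then obtain i where b: "b = axis i 1" by (auto simp: Basis_vec_def)
    have s: "(\<lambda>p::spacetime. snd p $ i) \<in> borel_measurable borel"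
      by (intro borel_measurable_continuous_onI continuous_intros)
    show "(\<lambda>p::spacetime. (\<chi> i. snd p $ i - of_int \<lfloor>snd p $ i\<rfloor>) \<bullet> b) \<in> borel_measurable borel"
      unfolding b inner_axis using s measurable_compose[OF s borel_measurable_real_floor] by simp
  qed
  then show ?thesis unfolding wrap_def by (intro borel_measurable_Pair) measurable
qed

lemma wrap_periodic: "lattice_vec k \<Longrightarrow> wrap (p + (0, k)) = wrap p"
proof -
  assume k: "lattice_vec k"
  have "snd p $ i + k $ i - of_int \<lfloor>snd p $ i + k $ i\<rfloor> = snd p $ i - of_int \<lfloor>snd p $ i\<rfloor>" for i
  proof -
    obtain n where "k $ i = of_int n" using k by (metis lattice_vec_def Ints_cases)
    then show ?thesis by simp
  qed
  then show ?thesis by (simp add: wrap_def vec_eq_iff)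
qed

lemma wrap_lattice: "\<exists>k\<in>lattice. p = wrap p + k"
proof
  show "(0, \<chi> i. of_int \<lfloor>snd p $ i\<rfloor>) \<in> lattice" by (auto simp: lattice_def lattice_vec_def)
  show "p = wrap p + (0, \<chi> i. of_int \<lfloor>snd p $ i\<rfloor>)"
    by (cases p) (auto simp: wrap_def vec_eq_iff)
qed

lemma wrap_cell: "p \<in> cover T \<Longrightarrow> wrap p \<in> cell T"
  unfolding wrap_def cover_def cell_def by (cases p) (auto simp: floor_correct, linarith)

lemma wrap_id: "p \<in> cell T \<Longrightarrow> wrap p = p"
  unfolding wrap_def cell_def by (cases p) (auto simp: vec_eq_iff floor_eq_iff)

lemma fun_on_X_lattice:
  assumes "fun_on_X T f" "p \<in> cover T" "k \<in> lattice"
  shows "f (p + k) = f p"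
  using assms by (cases p) (auto simp: fun_on_X_def cover_def lattice_def lattice_vec_def)

text \<open>A Borel version is taken on one cell, repaired on a null set so that all its values lie in the
essential range, and then extended periodically.  It thereby becomes bounded and takes values where
the energy density and its extension agree, at every point rather than almost everywhere.\<close>

lemma periodic_representative:
  fixes f :: "spacetime \<Rightarrow> 'b::euclidean_space"
  assumes T: "0 < T" and f: "f \<in> borel_measurable (lebesgue_on (cell T))" and per: "fun_on_X T f"
    and K: "compact (ess_range T f)"
  obtains g where "g \<in> borel_measurable borel" "periodic g" "range g \<subseteq> ess_range T f"
    "negligible {p \<in> cover T. g p \<noteq> f p}"
proof -
  let ?K = "ess_range T f"
  note off = negligible_off_ess_range[OF f]
  have "?K \<noteq> {}"
  proof
    assume "?K = {}"
    then have "negligible (cell T)" using off by simp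
    then show False using cell_not_negligible[OF T] by simp
  qed
  then obtain k0 where k0: "k0 \<in> ?K" by blast
  obtain h where h [measurable]: "h \<in> borel_measurable borel"
    and hn: "negligible {p. h p \<noteq> (if p \<in> cell T then f p else 0)}"
    using borel_version[OF borel_measurable_if_I[OF f cell_lebesgue]] by blast
  have Kb [measurable]: "?K \<in> sets borel" by (rule borel_closed[OF compact_imp_closed[OF K]])
  define g where "g p = (if h (wrap p) \<in> ?K then h (wrap p) else k0)" for p
  have gm: "g \<in> borel_measurable borel"
  proof -
    have hw [measurable]: "(\<lambda>p. h (wrap p)) \<in> borel_measurable borel"
      by (rule measurable_compose[OF wrap_measurable h])
    show ?thesis unfolding g_def by measurable
  qed
  have gp: "periodic g" unfolding periodic_def g_def by (intro allI impI) (simp only: wrap_periodic)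
  define N where "N = {p \<in> cell T. g p \<noteq> f p}"
  have "N \<subseteq> {p. h p \<noteq> (if p \<in> cell T then f p else 0)} \<union> {p \<in> cell T. f p \<notin> ?K}"
    by (auto simp: N_def g_def wrap_id split: if_splits)
  then have N: "negligible N" using hn off negligible_Un negligible_subset by blast
  have "{p \<in> cover T. g p \<noteq> f p} \<subseteq> (\<Union>k\<in>lattice. (+) k ` N)"
  proof
    fix p assume p: "p \<in> {p \<in> cover T. g p \<noteq> f p}"
    obtain k where k: "k \<in> lattice" "p = wrap p + k" using wrap_lattice by blast
    have w: "wrap p \<in> cell T" using p wrap_cell by auto
    then have "wrap p \<in> cover T" by (auto simp: cell_def cover_def)
    then have "f p = f (wrap p)" using fun_on_X_lattice[OF per _ k(1)] k(2) by metis
    moreover have "g p = g (wrap p)" using periodic_lattice[OF gp k(1)] k(2) by metis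
    ultimately have "wrap p \<in> N" using p w by (simp add: N_def)
    then have "k + wrap p \<in> (+) k ` N" by (rule imageI)
    then show "p \<in> (\<Union>k\<in>lattice. (+) k ` N)"
      using k by (intro UN_I[OF k(1)]) (simp add: add.commute)
  qed
  moreover have "negligible (\<Union>k\<in>lattice. (+) k ` N)"
    using countable_lattice N by (intro negligible_countable_Union) (auto intro: negligible_translation)
  ultimately have n: "negligible {p \<in> cover T. g p \<noteq> f p}" using negligible_subset by blast
  have "range g \<subseteq> ?K" using k0 by (auto simp: g_def)
  then show thesis by (rule that[OF gm gp _ n])
qed

lemma bounded_borel_set_integrable:
  fixes h :: "'a::euclidean_space \<Rightarrow> real"
  assumes h: "bounded_borel h" and A: "A \<in> sets borel" "emeasure lborel A < \<infinity>"
  shows "set_integrable lborel A h"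
proof -
  obtain B where "\<And>p. \<bar>h p\<bar> \<le> B" "h \<in> borel_measurable borel" using h by (auto simp: bounded_borel_def)
  then show ?thesis unfolding set_integrable_def
    using A by (intro integrableI_bounded_set_indicator[where B = B]) auto
qed

text \<open>Lebesgue measure is complete, so f inherits integrability from the Borel function h without any
measurability assumption on f.\<close>

lemma set_integrable_spike:
  fixes f h :: "'a::euclidean_space \<Rightarrow> real"
  assumes h: "bounded_borel h" and A: "A \<in> sets borel" "emeasure lborel A < \<infinity>"
    and N: "negligible N" "\<And>p. p \<in> A - N \<Longrightarrow> f p = h p"
  shows "set_integrable lebesgue A f" "(LINT p:A|lebesgue. f p) = (\<integral>p. indicator A p * h p \<partial>lborel)"
proof -
  have m: "(\<lambda>p. indicator A p *\<^sub>R h p) \<in> borel_measurable lborel"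
    using h A by (auto simp: bounded_borel_def)
  have i: "set_integrable lebesgue A h"
    using bounded_borel_set_integrable[OF h A] integrable_completion[OF m]
    by (simp add: set_integrable_def)
  show f: "set_integrable lebesgue A f"
    by (rule absolutely_integrable_spike[OF i N])
  have "(LINT p:A|lebesgue. f p) = integral A f"
    by (rule set_lebesgue_integral_eq_integral(2)[OF f])
  also have "\<dots> = integral A h"
    by (rule integral_spike[OF N(1)]) (use N(2) in simp)
  also have "\<dots> = (LINT p:A|lebesgue. h p)"
    by (rule set_lebesgue_integral_eq_integral(2)[OF i, symmetric])
  also have "\<dots> = (\<integral>p. indicator A p *\<^sub>R h p \<partial>lborel)"
    unfolding set_lebesgue_integral_def by (rule integral_completion[OF m])
  finally show "(LINT p:A|lebesgue. f p) = (\<integral>p. indicator A p * h p \<partial>lborel)" by simp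
qed

lemma cell_integral_spike:
  assumes h: "bounded_borel h" and N: "negligible N" "\<And>p. p \<in> cell T - N \<Longrightarrow> f p = h p"
  shows "(LINT p:cell T|lebesgue. f p) = (\<integral>p. h p \<partial>cellm T)"
proof -
  have "h \<in> borel_measurable borel" using h by (simp add: bounded_borel_def)
  then show ?thesis
    using set_integrable_spike(2)[OF h measurable_cell emeasure_cell_finite N] integral_cellm[of h T] by simp
qed

lemma cover_open: "open (cover T)"
  unfolding cover_def by (intro open_Times) auto

lemma norm_cube_le:
  fixes x :: "'a::euclidean_space"
  shows "norm x ^ 3 \<le> real DIM('a) ^ 3 * (\<Sum>b\<in>Basis. \<bar>x \<bullet> b\<bar> ^ 3)"
proof -
  obtain m where m: "m \<in> Basis" "\<And>b. b \<in> Basis \<Longrightarrow> \<bar>x \<bullet> b\<bar> \<le> \<bar>x \<bullet> m\<bar>"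
  proof -
    have "Max ((\<lambda>b. \<bar>x \<bullet> b\<bar>) ` Basis) \<in> (\<lambda>b. \<bar>x \<bullet> b\<bar>) ` Basis" by (rule Max_in) auto
    then obtain m where "m \<in> Basis" "\<bar>x \<bullet> m\<bar> = Max ((\<lambda>b. \<bar>x \<bullet> b\<bar>) ` Basis)" by force
    then show thesis by (intro that) (auto intro: Max_ge)
  qed
  have "norm x \<le> (\<Sum>b\<in>Basis. \<bar>x \<bullet> b\<bar>)" by (rule norm_le_l1)
  also have "\<dots> \<le> real DIM('a) * \<bar>x \<bullet> m\<bar>"
    using sum_bounded_above[of Basis "\<lambda>b. \<bar>x \<bullet> b\<bar>" "\<bar>x \<bullet> m\<bar>"] m(2) by simp
  finally have "norm x ^ 3 \<le> (real DIM('a) * \<bar>x \<bullet> m\<bar>) ^ 3" by (intro power_mono) auto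
  also have "\<dots> = real DIM('a) ^ 3 * \<bar>x \<bullet> m\<bar> ^ 3" by (rule power_mult_distrib)
  also have "\<dots> \<le> real DIM('a) ^ 3 * (\<Sum>b\<in>Basis. \<bar>x \<bullet> b\<bar> ^ 3)"
    using m(1) by (intro mult_left_mono member_le_sum) auto
  finally show ?thesis .
qed

text \<open>For small increments the time window lies in the overlap of X and its translate.  The sign of \<xi>
flips because the Besov norm compares with the value at p - \<xi>.\<close>

lemma besov_increment_scalar:
  fixes f g :: "spacetime \<Rightarrow> real"
  assumes bes: "besov_inf T \<alpha> 3 f" and g: "bounded_borel g"
    and N: "negligible {p \<in> cover T. g p \<noteq> f p}" and ab: "\<delta> \<le> a" "b + \<delta> \<le> T"
  obtains M where "0 \<le> M" "\<And>\<xi>. norm \<xi> < \<delta> \<Longrightarrow>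
    (\<integral>p. indicator (window a b) p * \<bar>g (p + \<xi>) - g p\<bar> ^ 3 \<partial>cellm T) \<le> M * norm \<xi> powr (3 * \<alpha>)"
proof -
  let ?A = "\<lambda>\<xi>. cell T \<inter> (\<lambda>p. p + \<xi>) ` cover T"
  obtain M0 where M0: "\<And>\<xi>. \<xi> \<noteq> 0 \<Longrightarrow> norm \<xi> powr (- \<alpha>) * Lq_norm 3 (?A \<xi>) (\<lambda>p. f p - f (p - \<xi>)) \<le> M0"
    using bes unfolding besov_inf_def bdd_above_def by blast
  define M where "M = max M0 0"
  have M: "0 \<le> M" "\<And>\<xi>. \<xi> \<noteq> 0 \<Longrightarrow> norm \<xi> powr (- \<alpha>) * Lq_norm 3 (?A \<xi>) (\<lambda>p. f p - f (p - \<xi>)) \<le> M"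
    using M0 by (auto simp: M_def le_max_iff_disj)
  show thesis
  proof (rule that[of "M ^ 3"])
    fix \<xi> :: spacetime assume xi: "norm \<xi> < \<delta>"
    let ?g = "\<lambda>p. g (p + \<xi>) - g p"
    have gm [measurable]: "g \<in> borel_measurable borel" using g by (simp add: bounded_borel_def)
    obtain B where B: "\<And>p. \<bar>g p\<bar> \<le> B" using g by (auto simp: bounded_borel_def)
    have gs: "bounded_borel (\<lambda>p. g (p + \<xi>))"
      by (rule bounded_borelI[where B = B]) (use B in auto)
    note bb = bounded_borel_intros g gs
    show "(\<integral>p. indicator (window a b) p * \<bar>?g p\<bar> ^ 3 \<partial>cellm T) \<le> M ^ 3 * norm \<xi> powr (3 * \<alpha>)"
    proof (cases "\<xi> = 0")
      case False
      define A where "A = ?A (- \<xi>)"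
      define I where "I = (\<integral>p. indicator A p * \<bar>?g p\<bar> ^ 3 \<partial>lborel)"
      have Aeq: "A = cell T \<inter> {p. p + \<xi> \<in> cover T}"
        unfolding A_def by (auto simp: image_iff) (metis add_diff_cancel_right' diff_add_cancel)
      have "open ((\<lambda>p. p + - \<xi>) ` cover T)"
        using open_translation[OF cover_open, of "- \<xi>" T] by (simp add: add.commute)
      then have Am [measurable]: "A \<in> sets borel" unfolding A_def by (intro sets.Int measurable_cell borel_open)
      have Af: "emeasure lborel A < \<infinity>"
        using emeasure_mono[of A "cell T" lborel] emeasure_cell_finite[of T] by (auto simp: A_def)
      have "Lq_norm 3 A (\<lambda>p. f p - f (p - (- \<xi>))) = I powr (1 / 3)"
      proof -
        have "integral\<^sup>L (lebesgue_on A) (\<lambda>p. \<bar>f p - f (p - (- \<xi>))\<bar> powr 3)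
            = (LINT p:A|lebesgue. \<bar>f p - f (p + \<xi>)\<bar> powr 3)"
          using Am by (subst integral_restrict_space) (auto simp: set_lebesgue_integral_def)
        also have "\<dots> = (\<integral>p. indicator A p * \<bar>?g p\<bar> ^ 3 \<partial>lborel)"
        proof (rule set_integrable_spike(2)[OF _ Am Af])
          let ?N = "{p \<in> cover T. g p \<noteq> f p}"
          show "bounded_borel (\<lambda>p. \<bar>?g p\<bar> ^ 3)" by (intro bb)
          show "negligible (?N \<union> (+) (- \<xi>) ` ?N)"
            by (intro negligible_Un negligible_translation N)
          fix p assume p: "p \<in> A - (?N \<union> (+) (- \<xi>) ` ?N)"
          then have c: "p \<in> cover T" "p + \<xi> \<in> cover T"
            unfolding Aeq by (auto simp: cell_def cover_def)
          have "g p = f p" using p c(1) by auto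
          moreover have "g (p + \<xi>) = f (p + \<xi>)"
          proof (rule ccontr)
            assume "g (p + \<xi>) \<noteq> f (p + \<xi>)"
            then have "- \<xi> + (p + \<xi>) \<in> (+) (- \<xi>) ` ?N" using c by blast
            then show False using p by simp
          qed
          ultimately have "\<bar>f p - f (p + \<xi>)\<bar> = \<bar>?g p\<bar>" by simp
          then show "\<bar>f p - f (p + \<xi>)\<bar> powr 3 = \<bar>?g p\<bar> ^ 3"
            by (cases "?g p = 0") (simp_all add: powr_numeral)
        qed
        finally show ?thesis by (simp add: Lq_norm_def I_def)
      qed
      with M(2)[of "- \<xi>"] False have "norm \<xi> powr (- \<alpha>) * I powr (1 / 3) \<le> M" by (simp add: A_def)
      then have "I powr (1 / 3) \<le> M * norm \<xi> powr \<alpha>"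
        using False by (simp add: powr_minus field_simps)
      then have "(I powr (1 / 3)) ^ 3 \<le> (M * norm \<xi> powr \<alpha>) ^ 3"
        by (intro power_mono) auto
      moreover have "0 \<le> I" unfolding I_def by (intro integral_nonneg_AE) auto
      then have "(I powr (1 / 3)) ^ 3 = I"
        by (cases "I = 0") (simp_all add: powr_powr powr_numeral[symmetric])
      moreover have "(norm \<xi> powr \<alpha>) ^ 3 = norm \<xi> powr (3 * \<alpha>)"
        using False by (subst powr_numeral[symmetric]) (simp_all add: powr_powr mult.commute)
      ultimately have I: "I \<le> M ^ 3 * norm \<xi> powr (3 * \<alpha>)" by (simp add: power_mult_distrib)
      have "(\<integral>p. indicator (window a b) p * \<bar>?g p\<bar> ^ 3 \<partial>cellm T)
          = (\<integral>p. indicator (cell T) p *\<^sub>R (indicator (window a b) p * \<bar>?g p\<bar> ^ 3) \<partial>lborel)"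
        by (rule integral_cellm) measurable
      also have "\<dots> \<le> I"
        unfolding I_def
      proof (rule integral_mono)
        show "integrable lborel (\<lambda>p. indicator (cell T) p *\<^sub>R (indicator (window a b) p * \<bar>?g p\<bar> ^ 3))"
          unfolding set_integrable_def[symmetric]
          by (intro bounded_borel_set_integrable measurable_cell emeasure_cell_finite bb window_borel)
        show "integrable lborel (\<lambda>p. indicator A p * \<bar>?g p\<bar> ^ 3)"
          unfolding real_scaleR_def[symmetric] set_integrable_def[symmetric]
          by (intro bounded_borel_set_integrable Am Af bb)
        show "indicator (cell T) p *\<^sub>R (indicator (window a b) p * \<bar>?g p\<bar> ^ 3) \<le> indicator A p * \<bar>?g p\<bar> ^ 3" for p
        proof (cases "p \<in> cell T \<and> p \<in> window a b")
          case True
          have "\<bar>fst \<xi>\<bar> < \<delta>" using norm_fst_le[of "fst \<xi>" "snd \<xi>"] xi by simp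
          then have "p \<in> A" using True ab unfolding Aeq by (cases p; cases \<xi>) (auto simp: cover_def)
          then show ?thesis by (simp add: indicator_def)
        qed (auto simp: indicator_def)
      qed
      finally show ?thesis using I by linarith
    qed simp
  qed (use M(1) in simp)
qed

lemma besov_increment:
  fixes f g :: "spacetime \<Rightarrow> 'b::euclidean_space"
  assumes bes: "\<And>c. c \<in> Basis \<Longrightarrow> besov_inf T \<alpha> 3 (\<lambda>p. f p \<bullet> c)" 
    and g [measurable]: "g \<in> borel_measurable borel" and B: "\<And>p. norm (g p) \<le> B"
    and N: "negligible {p \<in> cover T. g p \<noteq> f p}" and ab: "\<delta> \<le> a" "b + \<delta> \<le> T"
  obtains M where "0 \<le> M" "\<And>\<xi>. norm \<xi> < \<delta> \<Longrightarrow>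
    cubic_increment T a b g \<xi> \<le> M * norm \<xi> powr (3 * \<alpha>)"
proof -
  have gc: "bounded_borel (\<lambda>p. g p \<bullet> c)" if "c \<in> Basis" for c
    by (rule bounded_borelI[where B = B]) (use order_trans[OF Basis_le_norm[OF that] B] in auto)
  have Nc: "negligible {p \<in> cover T. g p \<bullet> c \<noteq> f p \<bullet> c}" for c
    by (rule negligible_subset[OF N]) auto
  define P where "P c M \<longleftrightarrow> 0 \<le> M \<and> (\<forall>\<xi>. norm \<xi> < \<delta> \<longrightarrow>
      (\<integral>p. indicator (window a b) p * \<bar>g (p + \<xi>) \<bullet> c - g p \<bullet> c\<bar> ^ 3 \<partial>cellm T) \<le> M * norm \<xi> powr (3 * \<alpha>))" for c M
  have "\<exists>M. P c M" if "c \<in> Basis" for c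
    unfolding P_def by (rule besov_increment_scalar[OF bes[OF that] gc[OF that] Nc ab]) blast
  then obtain M where "\<And>c. c \<in> Basis \<Longrightarrow> P c (M c)" by metis
  then have M: "\<And>c. c \<in> Basis \<Longrightarrow> 0 \<le> M c"
    "\<And>c \<xi>. c \<in> Basis \<Longrightarrow> norm \<xi> < \<delta> \<Longrightarrow> (\<integral>p. indicator (window a b) p * \<bar>g (p + \<xi>) \<bullet> c - g p \<bullet> c\<bar> ^ 3 \<partial>cellm T)
      \<le> M c * norm \<xi> powr (3 * \<alpha>)" by (auto simp: P_def)
  show thesis
  proof (rule that[of "real DIM('b) ^ 3 * (\<Sum>c\<in>Basis. M c)"])
    show "0 \<le> real DIM('b) ^ 3 * (\<Sum>c\<in>Basis. M c)" using M(1) by (simp add: sum_nonneg)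
    fix \<xi> :: spacetime assume xi: "norm \<xi> < \<delta>"
    have gs: "bounded_borel (\<lambda>p. g (p + \<xi>) \<bullet> c)" if "c \<in> Basis" for c
      by (rule bounded_borelI[where B = B]) (use order_trans[OF Basis_le_norm[OF that] B] in auto)
    have gn: "bounded_borel (\<lambda>p. norm (g (p + \<xi>) - g p))"
    proof (rule bounded_borelI[where B = "B + B"])
      show "\<bar>norm (g (p + \<xi>) - g p)\<bar> \<le> B + B" for p
        using order_trans[OF norm_triangle_ineq4 add_mono[OF B B]] by simp
    qed measurable
    have "cubic_increment T a b g \<xi>
        \<le> (\<integral>p. real DIM('b) ^ 3 * (\<Sum>c\<in>Basis. indicator (window a b) p * \<bar>g (p + \<xi>) \<bullet> c - g p \<bullet> c\<bar> ^ 3) \<partial>cellm T)"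
    proof (rule integral_mono)
      show "indicator (window a b) p * norm (g (p + \<xi>) - g p) ^ 3
          \<le> real DIM('b) ^ 3 * (\<Sum>c\<in>Basis. indicator (window a b) p * \<bar>g (p + \<xi>) \<bullet> c - g p \<bullet> c\<bar> ^ 3)" for p
        using norm_cube_le[of "g (p + \<xi>) - g p"] by (auto simp: indicator_def inner_diff_left)
    qed (intro bounded_borel_integrable_cellm bounded_borel_intros gn gc gs window_borel; assumption)+
    also have "\<dots> = real DIM('b) ^ 3 * (\<Sum>c\<in>Basis. \<integral>p. indicator (window a b) p * \<bar>g (p + \<xi>) \<bullet> c - g p \<bullet> c\<bar> ^ 3 \<partial>cellm T)"
      unfolding integral_mult_right_zero
      by (subst Bochner_Integration.integral_sum)
        (intro bounded_borel_integrable_cellm bounded_borel_intros gc gs window_borel refl; assumption)+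
    also have "\<dots> \<le> real DIM('b) ^ 3 * (\<Sum>c\<in>Basis. M c * norm \<xi> powr (3 * \<alpha>))"
      by (intro mult_left_mono sum_mono M(2) xi) auto
    finally show "cubic_increment T a b g \<xi>
        \<le> real DIM('b) ^ 3 * (\<Sum>c\<in>Basis. M c) * norm \<xi> powr (3 * \<alpha>)"
      by (simp add: sum_distrib_right mult.assoc)
  qed
qed

section \<open>Test functions and the energy equation\<close>

lemma periodic_bounded:
  fixes f :: "spacetime \<Rightarrow> real"
  assumes f: "continuous_on UNIV f" and per: "periodic f" and supp: "\<And>p. f p \<noteq> 0 \<Longrightarrow> p \<in> window a b"
  shows "bounded_borel f"
proof -
  let ?C = "{a..b} \<times> cbox 0 (1 :: vec3)"
  have "compact (f ` ?C)"
    by (intro compact_continuous_image continuous_on_subset[OF f] compact_Times compact_cbox compact_Icc) auto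
  then obtain B where B: "0 < B" "\<And>p. p \<in> ?C \<Longrightarrow> \<bar>f p\<bar> \<le> B"
    using compact_imp_bounded[of "f ` ?C"] by (auto simp: bounded_pos)
  have "\<bar>f p\<bar> \<le> B" for p
  proof (cases "f p = 0")
    case False
    obtain k where k: "k \<in> lattice" "p = wrap p + k" using wrap_lattice by blast
    have fw: "f p = f (wrap p)" using periodic_lattice[OF per k(1), of "wrap p"] k(2) by simp
    have "wrap p \<in> window a b" using supp[of "wrap p"] False fw by auto
    moreover have "snd (wrap p) \<in> cbox 0 1"
    proof -
      have "0 \<le> x - of_int \<lfloor>x\<rfloor> \<and> x - of_int \<lfloor>x\<rfloor> \<le> 1" for x :: real by linarith
      then show ?thesis by (simp add: mem_box_cart wrap_def)
    qed
    ultimately have "wrap p \<in> ?C" by (cases "wrap p") auto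
    then show ?thesis using B(2) fw by simp
  qed (use B in simp)
  then show ?thesis using borel_measurable_continuous_onI[OF f] by (intro bounded_borelI)
qed

lemma frechet_derivative_periodic:
  fixes f :: "spacetime \<Rightarrow> real"
  assumes d: "\<And>p. f differentiable (at p)" and per: "periodic f"
  shows "periodic (\<lambda>p. frechet_derivative f (at p) e)"
  unfolding periodic_def
proof (intro allI impI)
  fix p k assume k: "lattice_vec k"
  let ?s = "(0, k) :: spacetime"
  have "(f has_derivative frechet_derivative f (at (p + ?s))) (at (p + ?s))"
    using d frechet_derivative_works by blast
  moreover have "((\<lambda>q. q + ?s) has_derivative (\<lambda>e. e)) (at p)"
    by (auto intro!: derivative_eq_intros)
  ultimately have "((\<lambda>q. f (q + ?s)) has_derivative frechet_derivative f (at (p + ?s))) (at p)"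
    using has_derivative_compose[of "\<lambda>q. q + ?s" "\<lambda>e. e" p UNIV f] by simp
  moreover have "(\<lambda>q. f (q + ?s)) = f"
    using per k unfolding periodic_def by blast
  ultimately show "frechet_derivative f (at (p + ?s)) e = frechet_derivative f (at p) e"
    using frechet_derivative_at by metis
qed

lemma periodic_testD:
  assumes "periodic_test T \<phi>"
  shows "periodic \<phi>" "\<And>k. C_k_on k UNIV \<phi>" "\<phi> differentiable (at p)"
    "bounded_borel (\<lambda>p. frechet_derivative \<phi> (at p) e)"
proof -
  show per: "periodic \<phi>" and C: "C_k_on k UNIV \<phi>" for k
    using assms by (auto simp: periodic_test_def smooth_on_def)
  show d: "\<phi> differentiable (at p)" for p using C[of "Suc 0"] unfolding C_k_on.simps by blast
  obtain a b where supp: "\<And>p. p \<notin> window a b \<Longrightarrow> \<phi> p = 0"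
    using assms unfolding periodic_test_def by blast
  show "bounded_borel (\<lambda>p. frechet_derivative \<phi> (at p) e)"
  proof (rule periodic_bounded)
    show "continuous_on UNIV (\<lambda>p. frechet_derivative \<phi> (at p) e)"
      using C[of "Suc 0"] unfolding C_k_on.simps by blast
    show "frechet_derivative \<phi> (at p) e \<noteq> 0 \<Longrightarrow> p \<in> window a b" for p
      using frechet_derivative_zero_off[OF window_closed, of a b \<phi> p e] supp by blast
  qed (rule frechet_derivative_periodic[OF d per])
qed

lemma periodic_test_imp_test_fun:
  assumes "periodic_test T \<phi>"
  shows "test_fun T \<phi>"
proof -
  obtain a b where ab: "0 < a" "b < T" "\<And>p. \<phi> p \<noteq> 0 \<Longrightarrow> p \<in> window a b"
    using assms unfolding periodic_test_def by blast
  have "fun_on_X T \<phi>"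
    using periodic_testD(1)[OF assms] unfolding fun_on_X_def periodic_def lattice_vec_def
    by (metis add_Pair add.right_neutral)
  moreover have "smooth_on (cover T) \<phi>"
    using periodic_testD(2)[OF assms] C_k_on_subset unfolding smooth_on_def by blast
  moreover have "compact {a..b}" "{a..b} \<subseteq> {0<..<T}" using ab(1,2) by auto
  moreover have "\<phi> (t, x) = 0" if "t \<in> {0<..<T} - {a..b}" for t x
    using ab(3)[of "(t, x)"] that by (cases "\<phi> (t, x) = 0") auto
  ultimately show ?thesis unfolding test_fun_def by blast
qed

text \<open>A test function is meaningful only on the cover.  Extending its restriction by zero gives a smooth
function on all of space-time, since its support in time is compact.\<close>

lemma test_fun_extension:
  assumes "test_fun T \<phi>" "0 < T"
  obtains a b \<psi> where "0 < a" "b < T" "\<And>p. \<psi> p \<noteq> 0 \<Longrightarrow> p \<in> window a b" "periodic_test T \<psi>"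
    "\<And>p e. p \<in> cover T \<Longrightarrow> frechet_derivative \<phi> (at p) e = frechet_derivative \<psi> (at p) e"
proof -
  obtain K where K: "compact K" "K \<subseteq> {0<..<T}" "\<And>t x. t \<in> {0<..<T} - K \<Longrightarrow> \<phi> (t, x) = 0"
    and per: "fun_on_X T \<phi>" and sm: "smooth_on (cover T) \<phi>"
    using assms(1) unfolding test_fun_def by blast
  obtain a b where ab: "0 < a" "b < T" "K \<subseteq> {a..b}"
  proof (cases "K = {}")
    case True
    then show thesis using that[of T 0] assms(2) by simp
  next
    case False
    obtain s where s: "s \<in> K" "\<And>t. t \<in> K \<Longrightarrow> s \<le> t" using compact_attains_inf[OF K(1) False] by blast
    obtain r where r: "r \<in> K" "\<And>t. t \<in> K \<Longrightarrow> t \<le> r" using compact_attains_sup[OF K(1) False] by blast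
    show thesis by (rule that[of s r]) (use s r K(2) in auto)
  qed
  define \<psi> where "\<psi> p = (if p \<in> cover T then \<phi> p else 0)" for p
  have supp: "p \<in> window a b" if "\<psi> p \<noteq> 0" for p
  proof -
    have "p \<in> cover T" "\<phi> p \<noteq> 0" using that by (auto simp: \<psi>_def split: if_splits)
    then have "fst p \<in> K" using K(3)[of "fst p" "snd p"] by (cases p) (auto simp: cover_def)
    then show ?thesis using ab(3) by auto
  qed
  have psi: "\<psi> p = \<phi> p" if "p \<in> cover T" for p using that by (simp add: \<psi>_def)
  have "C_k_on k UNIV \<psi>" for k
  proof (rule C_k_on_extend_zero[OF cover_open window_closed])
    show "window a b \<subseteq> cover T" using ab by (auto simp: cover_def)
    show "C_k_on k (cover T) \<psi>"
    proof (rule C_k_on_cong[OF cover_open])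
      show "C_k_on k (cover T) \<phi>" using sm unfolding smooth_on_def by blast
    qed (use psi in simp)
    show "p \<notin> window a b \<Longrightarrow> \<psi> p = 0" for p using supp by blast
  qed
  moreover have "periodic \<psi>"
    using per unfolding periodic_def \<psi>_def fun_on_X_def cover_def lattice_vec_def by auto
  ultimately have pt: "periodic_test T \<psi>"
    unfolding periodic_test_def smooth_on_def using ab supp by blast
  have "frechet_derivative \<phi> (at p) e = frechet_derivative \<psi> (at p) e" if p: "p \<in> cover T" for p e
  proof -
    have "(\<psi> has_derivative frechet_derivative \<psi> (at p)) (at p)"
      using periodic_testD(3)[OF pt] frechet_derivative_works by blast
    then have "(\<phi> has_derivative frechet_derivative \<psi> (at p)) (at p)"
      by (rule has_derivative_transform_within_open[OF _ cover_open p psi])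
    then show ?thesis using frechet_derivative_at by metis
  qed
  with ab supp pt show thesis by (intro that)
qed

text \<open>Each estimate holds with every sufficiently large constant, so that finitely many of them can be
combined by intersecting eventual sets; no maximum of constants has to be formed.\<close>

lemma eventually_bound:
  assumes "\<And>x y. f x y \<le> C * g x y" "\<And>x y. 0 \<le> g x y"
  shows "eventually (\<lambda>L. \<forall>x y. f x y \<le> L * g x y) (at_top :: real filter)"
  using eventually_ge_at_top[of C]
  by eventually_elim (meson assms mult_right_mono order_trans)

lemma eventually_bound_on:
  assumes "\<And>x. P x \<Longrightarrow> f x \<le> C * g x" "\<And>x. 0 \<le> g x"
  shows "eventually (\<lambda>L. \<forall>x. P x \<longrightarrow> f x \<le> L * g x) (at_top :: real filter)"
  using eventually_ge_at_top[of C]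
  by eventually_elim (meson assms mult_right_mono order_trans)

lemma eventually_bound1:
  assumes "\<And>x. f x \<le> C"
  shows "eventually (\<lambda>L. \<forall>x. f x \<le> L) (at_top :: real filter)"
  using eventually_ge_at_top[of C] by eventually_elim (meson assms order_trans)

lemma mat_sum: "(\<Sum>i\<in>UNIV. \<Sum>j\<in>UNIV. (H $ i $ j) *\<^sub>R axis i (axis j 1)) = (H :: mat3)"
  by (simp add: vec_eq_iff forall_3 sum_3 axis_def)
  
lemma derivative_partial_W:
  assumes "V differentiable (at A)"
  shows "(V has_derivative (\<lambda>H. \<Sum>i\<in>UNIV. \<Sum>j\<in>UNIV. partial_W V i j A * H $ i $ j)) (at A)"
proof -
  have d: "(V has_derivative frechet_derivative V (at A)) (at A)"
    using assms frechet_derivative_works by blast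
  note lin = has_derivative_linear[OF d]
  have "frechet_derivative V (at A) H = (\<Sum>i\<in>UNIV. \<Sum>j\<in>UNIV. partial_W V i j A * H $ i $ j)" for H
    by (subst mat_sum[symmetric]) (simp add: linear_sum[OF lin] linear_cmul[OF lin] partial_W_def mult.commute)
  then have "frechet_derivative V (at A) = (\<lambda>H. \<Sum>i\<in>UNIV. \<Sum>j\<in>UNIV. partial_W V i j A * H $ i $ j)" by (rule ext)
  with d show ?thesis by metis
qed

lemma bounded_borel_weight:
  fixes g :: "'a::topological_space \<Rightarrow> 'b::euclidean_space"
  assumes "g \<in> borel_measurable borel" "range g \<subseteq> K" "compact K" "continuous_on UNIV h"
  shows "bounded_borel (\<lambda>p. h (g p) :: real)"
proof -
  have "compact (h ` K)" using assms by (intro compact_continuous_image continuous_on_subset[OF assms(4)]) auto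
  then obtain B where "\<And>y. y \<in> K \<Longrightarrow> \<bar>h y\<bar> \<le> B"
    using compact_imp_bounded[of "h ` K"] by (auto simp: bounded_iff)
  then show ?thesis
    using assms(2) measurable_compose[OF assms(1) borel_measurable_continuous_onI[OF assms(4)]]
    by (intro bounded_borelI) auto
qed

lemma locally_integrable_spike:
  assumes h: "bounded_borel h" and N: "negligible N" "\<And>p. p \<in> cover T - N \<Longrightarrow> f p = h p"
  shows "locally_integrable T f"
  unfolding locally_integrable_def
proof (intro allI impI, elim conjE)
  fix K :: "spacetime set" assume K: "compact K" "K \<subseteq> cover T"
  show "set_integrable lebesgue K f"
    using K N emeasure_bounded_finite[OF compact_imp_bounded[OF K(1)]]
    by (intro set_integrable_spike(1)[OF h _ _ N(1)]) (auto intro: borel_closed compact_imp_closed)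
qed

lemma mat_Basis: "c \<in> (Basis :: mat3 set) \<Longrightarrow> \<exists>i j. c = axis i (axis j 1)"
  by (auto simp: Basis_vec_def)

lemma vec_Basis: "c \<in> (Basis :: vec3 set) \<Longrightarrow> \<exists>j. c = axis j 1"
  by (auto simp: Basis_vec_def)

lemma besov_measurable:
  fixes f :: "spacetime \<Rightarrow> 'b::euclidean_space"
  assumes "\<And>c. c \<in> Basis \<Longrightarrow> besov_inf T \<alpha> q (\<lambda>p. f p \<bullet> c)"
  shows "f \<in> borel_measurable (lebesgue_on (cell T))"
  using assms unfolding besov_inf_def in_Lq_def
  by (subst borel_measurable_euclidean_space) blast

theorem mainTheorem3:
  fixes T \<alpha> :: real
    and U :: "mat3 set"
    and W :: "mat3 \<Rightarrow> real"
    and F :: "spacetime \<Rightarrow> mat3"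
    and v :: "spacetime \<Rightarrow> vec3"
  assumes "T > 0"
    and "0 < \<alpha>" and "\<alpha> < 1" and "\<alpha> > 1/3"
    and "open U"
    and "C_k_on 3 U W"
    and "fun_on_X T F" and "fun_on_X T v"
    and "\<And>i j. besov_inf T \<alpha> 3 (\<lambda>p. F p $ i $ j)"
    and "\<And>j. besov_inf T \<alpha> 3 (\<lambda>p. v p $ j)"
    and "AE p in lebesgue_on (cell T). F p \<in> U"
    and "weak_solution_elasticity T W F v"
    and "compact (ess_range T F)" and "ess_range T F \<subseteq> U"
    and "compact (ess_range T v)"
  shows "weak_solution_energy T W F v"
proof -
  let ?K = "ess_range T F"
  have besF: "besov_inf T \<alpha> 3 (\<lambda>p. F p \<bullet> c)" if "c \<in> Basis" for c
    using mat_Basis[OF that] assms(9) by (auto simp: inner_axis)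
  have besv: "besov_inf T \<alpha> 3 (\<lambda>p. v p \<bullet> c)" if "c \<in> Basis" for c
    using vec_Basis[OF that] assms(10) by (auto simp: inner_axis)
  obtain F' where F': "F' \<in> borel_measurable borel" "periodic F'" "range F' \<subseteq> ?K"
    and NF: "negligible {p \<in> cover T. F' p \<noteq> F p}"
    by (rule periodic_representative[OF assms(1) besov_measurable[OF besF] assms(7,13)])
  obtain v' where v': "v' \<in> borel_measurable borel" "periodic v'" "range v' \<subseteq> ess_range T v"
    and Nv: "negligible {p \<in> cover T. v' p \<noteq> v p}"
    by (rule periodic_representative[OF assms(1) besov_measurable[OF besv] assms(8,15)])
  define N where "N = {p \<in> cover T. F' p \<noteq> F p} \<union> {p \<in> cover T. v' p \<noteq> v p}"
  have N: "negligible N" using NF Nv by (simp add: N_def)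
  have rep: "F p = F' p" "v p = v' p" if "p \<in> cover T - N" for p
    using that by (auto simp: N_def)
  have cell_cover: "cell T \<subseteq> cover T" by (auto simp: cell_def cover_def)

  obtain V R M where V: "C_k_on 3 UNIV V" and R: "compact R" "\<And>A. A \<notin> R \<Longrightarrow> V A = 0"
    and M: "open M" "?K \<subseteq> M" "M \<subseteq> U" "\<And>A. A \<in> M \<Longrightarrow> V A = W A"
    by (rule C_k_extension[OF assms(13,5,14,6)]) blast
  have V3: "C_k_on (Suc 2) UNIV V" and V1: "C_k_on 1 UNIV V"
    using V C_k_on_mono[OF V, of 1] by (simp_all add: numeral_3_eq_3 numeral_2_eq_2)
  have Vd: "V differentiable (at A)" for A using V3 unfolding C_k_on.simps by blast
  define G where "G i j = partial_W V i j" for i j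
  have GC: "C_k_on 2 UNIV (G i j)" for i j
    unfolding G_def partial_W_def using C_k_on_SucD(2)[OF V3] .
  have GC1: "C_k_on 1 UNIV (G i j)" for i j by (rule C_k_on_mono[OF GC]) simp
  have GR: "G i j A = 0" if "A \<notin> R" for i j A
    unfolding G_def partial_W_def using frechet_derivative_zero_off[OF compact_imp_closed[OF R(1)] R(2) that] .
  have GW: "G i j A = partial_W W i j A" if A: "A \<in> ?K" for i j A
  proof -
    have "(V has_derivative frechet_derivative V (at A)) (at A)"
      using Vd frechet_derivative_works by blast
    then have "(W has_derivative frechet_derivative V (at A)) (at A)"
      by (rule has_derivative_transform_within_open[OF _ M(1)]) (use A M in auto)
    from frechet_derivative_at[OF this] show ?thesis by (simp add: G_def partial_W_def)
  qed
  have F'K: "F' p \<in> ?K" for p using F'(3) by auto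
  \<comment> \<open>From here on V replaces W: both agree, with their gradients, at every value of \<open>F'\<close>.\<close>
  have VF: "V (F' p) = W (F' p)" for p using F'K M by blast
  have GF: "G i j (F' p) = partial_W W i j (F' p)" for i j p by (rule GW[OF F'K])

  note bF = bounded_borel_weight[OF F'(1,3) assms(13)]
  note bv = bounded_borel_weight[OF v'(1,3) assms(15)]
  have bFc: "bounded_borel (\<lambda>p. F' p $ i $ j)" for i j
    by (rule bF) (intro continuous_intros)
  have bvc: "bounded_borel (\<lambda>p. v' p $ j)" for j
    by (rule bv) (intro continuous_intros)
  have bG: "bounded_borel (\<lambda>p. G i j (F' p))" for i j
    by (rule bF[OF C_k_on_imp_continuous_on[OF GC]])
  have bV: "bounded_borel (\<lambda>p. V (F' p))"
    by (rule bF[OF C_k_on_imp_continuous_on[OF V]])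
  note bb = bounded_borel_intros bFc bvc bG bV

  have energy_eq: "(norm (v p))\<^sup>2 / 2 + W (F p) = V (F' p) + (\<Sum>j\<in>UNIV. v' p $ j * v' p $ j) / 2"
    if "p \<in> cover T - N" for p
    using rep[OF that] by (simp add: VF power2_norm_eq_inner inner_vec_def)
  have flux_eq: "(\<Sum>j\<in>UNIV. partial_W W i j (F p) * v p $ j) = (\<Sum>j\<in>UNIV. G i j (F' p) * v' p $ j)"
    if "p \<in> cover T - N" for p i
    using rep[OF that] by (simp add: GF)
  have cellN: "p \<in> cover T - N" if "p \<in> cell T - N" for p using that cell_cover by auto

  have weak_F: "(\<integral>p. F' p $ i $ j * frechet_derivative \<phi> (at p) dt \<partial>cellm T) =
      (\<integral>p. v' p $ j * frechet_derivative \<phi> (at p) (dx i) \<partial>cellm T)" if t: "periodic_test T \<phi>" for i j \<phi>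
  proof -
    note bd = periodic_testD(4)[OF t]
    have "dist_deriv T dt (\<lambda>p. F p $ i $ j) \<phi> = dist_deriv T (dx i) (\<lambda>p. v p $ j) \<phi>"
      using assms(12) periodic_test_imp_test_fun[OF t] unfolding weak_solution_elasticity_def by blast
    moreover have "(LINT p:cell T|lebesgue. F p $ i $ j * frechet_derivative \<phi> (at p) dt)
        = (\<integral>p. F' p $ i $ j * frechet_derivative \<phi> (at p) dt \<partial>cellm T)"
      by (rule cell_integral_spike[OF _ N]) (auto intro!: bb bd simp: rep[OF cellN])
    moreover have "(LINT p:cell T|lebesgue. v p $ j * frechet_derivative \<phi> (at p) (dx i))
        = (\<integral>p. v' p $ j * frechet_derivative \<phi> (at p) (dx i) \<partial>cellm T)"
      by (rule cell_integral_spike[OF _ N]) (auto intro!: bb bd simp: rep[OF cellN])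
    ultimately show ?thesis unfolding dist_deriv_def by simp
  qed
  have weak_v: "(\<integral>p. v' p $ j * frechet_derivative \<phi> (at p) dt \<partial>cellm T) =
      (\<Sum>i\<in>UNIV. \<integral>p. G i j (F' p) * frechet_derivative \<phi> (at p) (dx i) \<partial>cellm T)" if t: "periodic_test T \<phi>" for j \<phi>
  proof -
    note bd = periodic_testD(4)[OF t]
    have "dist_deriv T dt (\<lambda>p. v p $ j) \<phi> = (\<Sum>i\<in>UNIV. dist_deriv T (dx i) (\<lambda>p. partial_W W i j (F p)) \<phi>)"
      using assms(12) periodic_test_imp_test_fun[OF t] unfolding weak_solution_elasticity_def by blast
    moreover have "(LINT p:cell T|lebesgue. v p $ j * frechet_derivative \<phi> (at p) dt)
        = (\<integral>p. v' p $ j * frechet_derivative \<phi> (at p) dt \<partial>cellm T)"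
      by (rule cell_integral_spike[OF _ N]) (auto intro!: bb bd simp: rep[OF cellN])
    moreover have "(LINT p:cell T|lebesgue. partial_W W i j (F p) * frechet_derivative \<phi> (at p) (dx i))
        = (\<integral>p. G i j (F' p) * frechet_derivative \<phi> (at p) (dx i) \<partial>cellm T)" for i
      by (rule cell_integral_spike[OF _ N]) (auto intro!: bb bd simp: rep[OF cellN] GF[symmetric])
    ultimately show ?thesis unfolding dist_deriv_def by (simp add: sum_negf)
  qed

  show ?thesis
    unfolding weak_solution_energy_def
  proof (intro conjI allI impI)
    show "locally_integrable T (\<lambda>p. (norm (v p))\<^sup>2 / 2 + W (F p))"
      by (rule locally_integrable_spike[OF _ N energy_eq]) (intro bb)
    show "locally_integrable T (\<lambda>p. \<Sum>j\<in>UNIV. partial_W W i j (F p) * v p $ j)" for i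
      by (rule locally_integrable_spike[OF _ N flux_eq]) (intro bb)
  next
    fix \<phi> assume test: "test_fun T \<phi>"
    obtain a b \<psi> where ab: "0 < a" "b < T" and supp: "\<And>p. \<psi> p \<noteq> 0 \<Longrightarrow> p \<in> window a b"
      and psi: "periodic_test T \<psi>"
      and dpsi: "\<And>p e. p \<in> cover T \<Longrightarrow> frechet_derivative \<phi> (at p) e = frechet_derivative \<psi> (at p) e"
      by (rule test_fun_extension[OF test assms(1)]) blast
    define D where "D p e = frechet_derivative \<psi> (at p) e" for p e
    have bD: "bounded_borel (\<lambda>p. D p e)" for e unfolding D_def by (rule periodic_testD(4)[OF psi])
    \<comment> \<open>Half the distance of the support in time from the end points 0 and T.\<close>
    define \<delta> where "\<delta> = min a (T - b) / 2"
    have \<delta>: "0 < \<delta>" "\<delta> < a" "b + \<delta> < T" using ab by (auto simp: \<delta>_def min_def field_simps)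
    obtain \<rho> :: "spacetime \<Rightarrow> real" where rho: "kernel \<rho>" "(\<integral>z. \<rho> z \<partial>ubm) = 1"
      using standard_mollifier by blast

    \<comment> \<open>One constant for all estimates; every conjunct holds for all large L.\<close>
    define good where "good L \<longleftrightarrow> (\<forall>p. norm (F' p) \<le> L) \<and> (\<forall>p. norm (v' p) \<le> L) \<and>
        (\<forall>\<xi>. norm \<xi> < \<delta> \<longrightarrow>
          cubic_increment T a b F' \<xi> \<le> L * norm \<xi> powr (3 * \<alpha>)) \<and>
        (\<forall>\<xi>. norm \<xi> < \<delta> \<longrightarrow>
          cubic_increment T a b v' \<xi> \<le> L * norm \<xi> powr (3 * \<alpha>)) \<and>
        (\<forall>A. \<bar>V A\<bar> \<le> L) \<and> (\<forall>A B. \<bar>V A - V B\<bar> \<le> L * norm (A - B)) \<and>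
        (\<forall>i j A. \<bar>G i j A\<bar> \<le> L) \<and> (\<forall>i j A B. \<bar>G i j A - G i j B\<bar> \<le> L * norm (A - B)) \<and>
        (\<forall>i j A B. \<bar>G i j A - G i j B - frechet_derivative (G i j) (at B) (A - B)\<bar>
          \<le> L * (norm (A - B))\<^sup>2) \<and>
        (\<forall>p. \<bar>\<psi> p\<bar> \<le> L) \<and> (\<forall>e\<in>directions. \<forall>p. \<bar>D p e\<bar> \<le> L) \<and>
        (\<forall>z. \<bar>\<rho> z\<bar> \<le> L) \<and> (\<forall>e\<in>directions. \<forall>z. \<bar>dker \<rho> 1 e z\<bar> \<le> L)" for L
    have "\<forall>\<^sub>F L in at_top. \<forall>p. norm (F' p) \<le> L"
    proof -
      obtain B where "\<And>A. A \<in> ?K \<Longrightarrow> norm A \<le> B"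
        using compact_imp_bounded[OF assms(13)] by (auto simp: bounded_iff)
      then show ?thesis using F'K by (intro eventually_bound1[of _ B]) auto
    qed
    moreover have "\<forall>\<^sub>F L in at_top. \<forall>p. norm (v' p) \<le> L"
    proof -
      obtain B where "\<And>A. A \<in> ess_range T v \<Longrightarrow> norm A \<le> B"
        using compact_imp_bounded[OF assms(15)] by (auto simp: bounded_iff)
      then show ?thesis using v'(3) by (intro eventually_bound1[of _ B]) auto
    qed
    moreover have "\<forall>\<^sub>F L in at_top. \<forall>\<xi>. norm \<xi> < \<delta> \<longrightarrow>
        cubic_increment T a b F' \<xi> \<le> L * norm \<xi> powr (3 * \<alpha>)"
    proof -
      obtain B where B: "\<And>p. norm (F' p) \<le> B"
        using compact_imp_bounded[OF assms(13)] F'K by (meson bounded_iff)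
      show ?thesis
      proof (rule besov_increment[OF besF F'(1) B NF less_imp_le[OF \<delta>(2)] less_imp_le[OF \<delta>(3)]])
        fix M :: real
        assume "\<And>\<xi>. norm \<xi> < \<delta> \<Longrightarrow>
          cubic_increment T a b F' \<xi> \<le> M * norm \<xi> powr (3 * \<alpha>)"
        then show ?thesis by (rule eventually_bound_on) simp_all
      qed
    qed
    moreover have "\<forall>\<^sub>F L in at_top. \<forall>\<xi>. norm \<xi> < \<delta> \<longrightarrow>
        cubic_increment T a b v' \<xi> \<le> L * norm \<xi> powr (3 * \<alpha>)"
    proof -
      obtain B where B: "\<And>p. norm (v' p) \<le> B"
        using compact_imp_bounded[OF assms(15)] v'(3) by (meson bounded_iff rangeI subsetD)
      show ?thesis
      proof (rule besov_increment[OF besv v'(1) B Nv less_imp_le[OF \<delta>(2)] less_imp_le[OF \<delta>(3)]])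
        fix M :: real
        assume "\<And>\<xi>. norm \<xi> < \<delta> \<Longrightarrow>
          cubic_increment T a b v' \<xi> \<le> M * norm \<xi> powr (3 * \<alpha>)"
        then show ?thesis by (rule eventually_bound_on) simp_all
      qed
    qed
    moreover have "\<forall>\<^sub>F L in at_top. \<forall>A. \<bar>V A\<bar> \<le> L"
    proof (rule compact_support_bounded[OF C_k_on_imp_continuous_on[OF V] R])
      fix C
      assume "\<And>A. norm (V A) \<le> C"
      then show ?thesis by (intro eventually_bound1[of _ C]) simp
    qed
    moreover have "\<forall>\<^sub>F L in at_top. \<forall>A B. \<bar>V A - V B\<bar> \<le> L * norm (A - B)"
    proof (rule C1_compact_support_Lipschitz[OF V1 R])
      fix C
      assume "\<And>A B. norm (V A - V B) \<le> C * norm (A - B)"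
      then show ?thesis by (intro eventually_bound[of _ C]) auto
    qed
    moreover have "\<forall>\<^sub>F L in at_top. \<forall>i j A. \<bar>G i j A\<bar> \<le> L"
    proof (intro eventually_all_finite)
      fix i j
      show "\<forall>\<^sub>F L in at_top. \<forall>A. \<bar>G i j A\<bar> \<le> L"
      proof (rule compact_support_bounded[OF C_k_on_imp_continuous_on[OF GC] R(1) GR])
        fix C
        assume "\<And>A. norm (G i j A) \<le> C"
        then show ?thesis by (intro eventually_bound1[of _ C]) simp
      qed
    qed
    moreover have "\<forall>\<^sub>F L in at_top. \<forall>i j A B. \<bar>G i j A - G i j B\<bar> \<le> L * norm (A - B)"
    proof (intro eventually_all_finite)
      fix i j
      show "\<forall>\<^sub>F L in at_top. \<forall>A B. \<bar>G i j A - G i j B\<bar> \<le> L * norm (A - B)"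
      proof (rule C1_compact_support_Lipschitz[OF GC1 R(1) GR])
        fix C
        assume "\<And>A B. norm (G i j A - G i j B) \<le> C * norm (A - B)"
        then show ?thesis by (intro eventually_bound[of _ C]) auto
      qed
    qed
    moreover have "\<forall>\<^sub>F L in at_top. \<forall>i j A B. \<bar>G i j A - G i j B
        - frechet_derivative (G i j) (at B) (A - B)\<bar> \<le> L * (norm (A - B))\<^sup>2"
    proof (intro eventually_all_finite)
      fix i j
      show "\<forall>\<^sub>F L in at_top. \<forall>A B. \<bar>G i j A - G i j B
          - frechet_derivative (G i j) (at B) (A - B)\<bar> \<le> L * (norm (A - B))\<^sup>2"
      proof (rule C2_compact_support_Taylor[OF GC R(1) GR])
        fix C
        assume "\<And>A B. norm (G i j A - G i j B - frechet_derivative (G i j) (at B) (A - B)) \<le> C * (norm (A - B))\<^sup>2"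
        then show ?thesis by (intro eventually_bound[of _ C]) auto
      qed
    qed
    moreover have "\<forall>\<^sub>F L in at_top. \<forall>p. \<bar>\<psi> p\<bar> \<le> L"
    proof -
      have "bounded_borel \<psi>"
        by (rule periodic_bounded[OF C_k_on_imp_continuous_on[OF periodic_testD(2)[OF psi, of 0]] periodic_testD(1)[OF psi] supp])
      then obtain C where "\<And>p. \<bar>\<psi> p\<bar> \<le> C" by (auto simp: bounded_borel_def)
      then show ?thesis by (rule eventually_bound1)
    qed
    moreover have "\<forall>\<^sub>F L in at_top. \<forall>e\<in>directions. \<forall>p. \<bar>D p e\<bar> \<le> L"
    proof (rule eventually_ball_finite)
      show "finite directions" by (simp add: directions_def)
      show "\<forall>e\<in>directions. \<forall>\<^sub>F L in at_top. \<forall>p. \<bar>D p e\<bar> \<le> L"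
      proof
        fix e
        obtain C where "\<And>p. \<bar>D p e\<bar> \<le> C" using bD[of e] by (auto simp: bounded_borel_def)
        then show "\<forall>\<^sub>F L in at_top. \<forall>p. \<bar>D p e\<bar> \<le> L" by (rule eventually_bound1)
      qed
    qed
    moreover have "\<forall>\<^sub>F L in at_top. \<forall>z. \<bar>\<rho> z\<bar> \<le> L"
    proof -
      obtain C where "\<And>z. \<bar>\<rho> z\<bar> \<le> C" using kernel_bound[OF rho(1)] by blast
      then show ?thesis by (rule eventually_bound1)
    qed
    moreover have "\<forall>\<^sub>F L in at_top. \<forall>e\<in>directions. \<forall>z. \<bar>dker \<rho> 1 e z\<bar> \<le> L"
    proof (rule eventually_ball_finite)
      show "finite directions" by (simp add: directions_def)
      show "\<forall>e\<in>directions. \<forall>\<^sub>F L in at_top. \<forall>z. \<bar>dker \<rho> 1 e z\<bar> \<le> L"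
      proof
        fix e
        obtain C where "\<And>z. \<bar>dker \<rho> 1 e z\<bar> \<le> C" using kernel_bound[OF kernel_dker[OF rho(1)]] by blast
        then show "\<forall>\<^sub>F L in at_top. \<forall>z. \<bar>dker \<rho> 1 e z\<bar> \<le> L" by (rule eventually_bound1)
      qed
    qed
    ultimately have "eventually good at_top"
      unfolding good_def by (intro eventually_conj)
    then obtain L where "good L"
      using eventually_happens'[of at_top good] by auto
    then have L: "\<And>p. norm (F' p) \<le> L" "\<And>p. norm (v' p) \<le> L"
        "\<And>\<xi>. norm \<xi> < \<delta> \<Longrightarrow>
          cubic_increment T a b F' \<xi> \<le> L * norm \<xi> powr (3 * \<alpha>)"
        "\<And>\<xi>. norm \<xi> < \<delta> \<Longrightarrow>
          cubic_increment T a b v' \<xi> \<le> L * norm \<xi> powr (3 * \<alpha>)"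
        "\<And>A. \<bar>V A\<bar> \<le> L" "\<And>A B. \<bar>V A - V B\<bar> \<le> L * norm (A - B)"
        "\<And>i j A. \<bar>G i j A\<bar> \<le> L" "\<And>i j A B. \<bar>G i j A - G i j B\<bar> \<le> L * norm (A - B)"
        "\<And>i j A B. \<bar>G i j A - G i j B - frechet_derivative (G i j) (at B) (A - B)\<bar> \<le> L * (norm (A - B))\<^sup>2"
        "\<And>p. \<bar>\<psi> p\<bar> \<le> L" "\<And>e p. e \<in> directions \<Longrightarrow> \<bar>D p e\<bar> \<le> L"
        "\<And>z. \<bar>\<rho> z\<bar> \<le> L" "\<And>e z. e \<in> directions \<Longrightarrow> \<bar>dker \<rho> 1 e z\<bar> \<le> L"
      by (simp_all only: good_def)
    interpret flow: elastic_flow T a b \<delta> \<alpha> L F' v' V G "\<lambda>i j A. frechet_derivative (G i j) (at A)" \<psi> D \<rho>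
    proof (rule elastic_flow.intro)
      show "0 < \<delta>" "\<delta> < a" "b + \<delta> < T" by (rule \<delta>)+
      show "1 / 3 < \<alpha>" using assms(4) by simp
      show "(V has_derivative (\<lambda>H. \<Sum>i\<in>UNIV. \<Sum>j\<in>UNIV. G i j A * H $ i $ j)) (at A)" for A
        unfolding G_def by (rule derivative_partial_W[OF Vd])
      show "bounded_linear (frechet_derivative (G i j) (at A))" for i j A
        using C_k_on_SucD(1)[of 0 UNIV "G i j" A] GC1[of i j] by (auto intro: has_derivative_bounded_linear)
      show "(\<psi> has_derivative (\<lambda>e. D p e)) (at p)" for p
        unfolding D_def using periodic_testD(3)[OF psi] frechet_derivative_works by blast
      show "periodic \<psi>" by (rule periodic_testD(1)[OF psi])
      show "\<psi> p \<noteq> 0 \<Longrightarrow> p \<in> window a b" for p by (rule supp)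
      show "(\<lambda>p. D p e) \<in> borel_measurable borel" for e using bD by (simp add: bounded_borel_def)
      show "p \<in> window a b" if "D p e \<noteq> 0" for e p
        using that supp frechet_derivative_zero_off[OF window_closed, of a b \<psi> p e] unfolding D_def by blast
    qed (fact F' v' L rho weak_F weak_v)+
    have energy: "(LINT p:cell T|lebesgue. ((norm (v p))\<^sup>2 / 2 + W (F p)) * frechet_derivative \<phi> (at p) dt)
        = (\<integral>p. D p dt * (V (F' p) + (\<Sum>j\<in>UNIV. v' p $ j * v' p $ j) / 2) \<partial>cellm T)"
    proof (rule cell_integral_spike[OF _ N])
      show "bounded_borel (\<lambda>p. D p dt * (V (F' p) + (\<Sum>j\<in>UNIV. v' p $ j * v' p $ j) / 2))"
        by (intro bb bD)
      fix p assume p: "p \<in> cell T - N"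
      then have "p \<in> cover T" using cell_cover by auto
      then show "((norm (v p))\<^sup>2 / 2 + W (F p)) * frechet_derivative \<phi> (at p) dt
          = D p dt * (V (F' p) + (\<Sum>j\<in>UNIV. v' p $ j * v' p $ j) / 2)"
        unfolding energy_eq[OF cellN[OF p]] by (simp add: dpsi D_def)
    qed
    have flux: "(LINT p:cell T|lebesgue. (\<Sum>j\<in>UNIV. partial_W W i j (F p) * v p $ j) * frechet_derivative \<phi> (at p) (dx i))
        = (\<Sum>j\<in>UNIV. \<integral>p. D p (dx i) * (G i j (F' p) * v' p $ j) \<partial>cellm T)" for i
    proof -
      have "(LINT p:cell T|lebesgue. (\<Sum>j\<in>UNIV. partial_W W i j (F p) * v p $ j) * frechet_derivative \<phi> (at p) (dx i))
          = (\<integral>p. (\<Sum>j\<in>UNIV. D p (dx i) * (G i j (F' p) * v' p $ j)) \<partial>cellm T)"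
      proof (rule cell_integral_spike[OF _ N])
        show "bounded_borel (\<lambda>p. \<Sum>j\<in>UNIV. D p (dx i) * (G i j (F' p) * v' p $ j))"
          by (intro bb bD)
        fix p assume p: "p \<in> cell T - N"
        then have "p \<in> cover T" using cell_cover by auto
        then show "(\<Sum>j\<in>UNIV. partial_W W i j (F p) * v p $ j) * frechet_derivative \<phi> (at p) (dx i)
            = (\<Sum>j\<in>UNIV. D p (dx i) * (G i j (F' p) * v' p $ j))"
          unfolding flux_eq[OF cellN[OF p]] by (simp add: dpsi D_def sum_distrib_left mult.commute)
      qed
      also have "\<dots> = (\<Sum>j\<in>UNIV. \<integral>p. D p (dx i) * (G i j (F' p) * v' p $ j) \<partial>cellm T)"
        by (intro Bochner_Integration.integral_sum bounded_borel_integrable_cellm bb bD)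
      finally show ?thesis .
    qed
    show "dist_deriv T dt (\<lambda>p. (norm (v p))\<^sup>2 / 2 + W (F p)) \<phi>
        - (\<Sum>i\<in>UNIV. dist_deriv T (dx i) (\<lambda>p. \<Sum>j\<in>UNIV. partial_W W i j (F p) * v p $ j) \<phi>) = 0"
      unfolding dist_deriv_def energy flux flow.energy_balance by (simp add: sum_negf)
  qed
qed

end
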